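(* (i) There exist $n$ and a bounded pseudoconvex domain $\Omega\subset\mathbb C^n$ with $0\in\Omega$ such that the maximal ellipsoid in $\Omega$ is not unique, i.e. there is more than one $E\in\mathbb E_0$ that is maximal in $\Omega$. (ii) If $\Omega\subset\mathbb C^n$ is a bounded pseudoconvex domain with $0\in\Omega$, and $\partial\Omega$ contains no holomorphic disc, then there is exactly one $E\in\mathbb E_0$ that is maximal in $\Omega$.
   Context: A domain is a connected open set. An open set $\Omega\subset\mathbb C^n$ is pseudoconvex if it admits a continuous plurisubharmonic exhaustion function $u:\Omega\to\mathbb R$, i.e. one for which $\{\zeta\in\Omega:u(\zeta)\le c\}$ is compact for every $c\in\mathbb R$. A hermitian ellipsoid is the image of the open unit ball of $\mathbb C^n$ under an invertible $\mathbb C$-linear transformation (so it is centered at $0$); $\mathbb E_0$ denotes the set of all hermitian ellipsoids in $\mathbb C^n$. An ellipsoid $E\in\mathbb E_0$ is called maximal in $\Omega$ if $E\subset\Omega$ and $E$ has maximal volume (Lebesgue measure on $\mathbb C^n\cong\mathbb R^{2n}$) among all elements of $\mathbb E_0$ contained in $\Omega$. A holomorphic disc is the range of a nonconstant holomorphic map $\Delta\to\mathbb C^n$, where $\Delta\subset\mathbb C$ is a disc. *)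

theory Defs
  imports "HOL-Complex_Analysis.Complex_Analysis"
begin

text \<open>
  Since the dimension is quantified inside the formulas, \<open>\<complex>\<^sup>n\<close> is modelled by the functions on
  \<open>{..<n}\<close>, extended by \<^const>\<open>undefined\<close>. This is the carrier of both the library's product
  topology and its product measure.
\<close>

abbreviation cspace :: "nat \<Rightarrow> (nat \<Rightarrow> complex) set" where
  "cspace n \<equiv> {..<n} \<rightarrow>\<^sub>E UNIV"

abbreviation ctop :: "nat \<Rightarrow> (nat \<Rightarrow> complex) topology" where
  "ctop n \<equiv> product_topology (\<lambda>_. euclidean) {..<n}"

abbreviation cleb :: "nat \<Rightarrow> (nat \<Rightarrow> complex) measure" where
  "cleb n \<equiv> PiM {..<n} (\<lambda>_. lborel)"

definition czero :: "nat \<Rightarrow> nat \<Rightarrow> complex" where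
  "czero n = (\<lambda>i\<in>{..<n}. 0)"

definition cadd :: "nat \<Rightarrow> (nat \<Rightarrow> complex) \<Rightarrow> (nat \<Rightarrow> complex) \<Rightarrow> nat \<Rightarrow> complex" where
  "cadd n z w = (\<lambda>i\<in>{..<n}. z i + w i)"

definition cscale :: "nat \<Rightarrow> complex \<Rightarrow> (nat \<Rightarrow> complex) \<Rightarrow> nat \<Rightarrow> complex" where
  "cscale n c z = (\<lambda>i\<in>{..<n}. c * z i)"

definition cnorm :: "nat \<Rightarrow> (nat \<Rightarrow> complex) \<Rightarrow> real" where
  "cnorm n z = L2_set (\<lambda>i. cmod (z i)) {..<n}"

definition cbounded :: "nat \<Rightarrow> (nat \<Rightarrow> complex) set \<Rightarrow> bool" where
  "cbounded n S \<longleftrightarrow> (\<exists>B. \<forall>z\<in>S. cnorm n z \<le> B)"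

definition cdomain :: "nat \<Rightarrow> (nat \<Rightarrow> complex) set \<Rightarrow> bool" where
  "cdomain n \<Omega> \<longleftrightarrow> openin (ctop n) \<Omega> \<and> connectedin (ctop n) \<Omega>"

text \<open>
  Continuity is part of the two definitions below: only continuous plurisubharmonic functions are
  needed, and for these the circle means are genuine integrals.
\<close>

definition cont_subharmonic_on :: "complex set \<Rightarrow> (complex \<Rightarrow> real) \<Rightarrow> bool" where
  "cont_subharmonic_on U h \<longleftrightarrow> continuous_on U h \<and>
     (\<forall>c r. 0 < r \<and> cball c r \<subseteq> U \<longrightarrow>
        h c \<le> 1 / (2 * pi) * integral {0..2 * pi} (\<lambda>\<theta>. h (c + of_real r * cis \<theta>)))"

definition cont_plurisubharmonic_on ::
    "nat \<Rightarrow> (nat \<Rightarrow> complex) set \<Rightarrow> ((nat \<Rightarrow> complex) \<Rightarrow> real) \<Rightarrow> bool" where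
  "cont_plurisubharmonic_on n \<Omega> u \<longleftrightarrow>
     continuous_map (subtopology (ctop n) \<Omega>) euclideanreal u \<and>
     (\<forall>a\<in>cspace n. \<forall>b\<in>cspace n.
        cont_subharmonic_on {\<tau>. cadd n a (cscale n \<tau> b) \<in> \<Omega>}
          (\<lambda>\<tau>. u (cadd n a (cscale n \<tau> b))))"

definition pseudoconvex :: "nat \<Rightarrow> (nat \<Rightarrow> complex) set \<Rightarrow> bool" where
  "pseudoconvex n \<Omega> \<longleftrightarrow> openin (ctop n) \<Omega> \<and>
     (\<exists>u. cont_plurisubharmonic_on n \<Omega> u \<and>
          (\<forall>c. compactin (ctop n) {z\<in>\<Omega>. u z \<le> c}))"

definition invertible_clinear ::
    "nat \<Rightarrow> ((nat \<Rightarrow> complex) \<Rightarrow> nat \<Rightarrow> complex) \<Rightarrow> bool" where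
  "invertible_clinear n T \<longleftrightarrow> bij_betw T (cspace n) (cspace n) \<and>
     (\<forall>z\<in>cspace n. \<forall>w\<in>cspace n. T (cadd n z w) = cadd n (T z) (T w)) \<and>
     (\<forall>c. \<forall>z\<in>cspace n. T (cscale n c z) = cscale n c (T z))"

definition cunit_ball :: "nat \<Rightarrow> (nat \<Rightarrow> complex) set" where
  "cunit_ball n = {z\<in>cspace n. cnorm n z < 1}"

definition hermitian_ellipsoids :: "nat \<Rightarrow> (nat \<Rightarrow> complex) set set" where
  "hermitian_ellipsoids n = {T ` cunit_ball n | T. invertible_clinear n T}"

definition maximal_ellipsoid :: "nat \<Rightarrow> (nat \<Rightarrow> complex) set \<Rightarrow> (nat \<Rightarrow> complex) set \<Rightarrow> bool" where
  "maximal_ellipsoid n \<Omega> E \<longleftrightarrow> E \<in> hermitian_ellipsoids n \<and> E \<subseteq> \<Omega> \<and>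
     (\<forall>E'\<in>hermitian_ellipsoids n. E' \<subseteq> \<Omega> \<longrightarrow> emeasure (cleb n) E' \<le> emeasure (cleb n) E)"

definition holomorphic_disc :: "nat \<Rightarrow> (nat \<Rightarrow> complex) set \<Rightarrow> bool" where
  "holomorphic_disc n D \<longleftrightarrow>
     (\<exists>c r f. 0 < r \<and> f \<in> ball c r \<rightarrow> cspace n \<and>
        (\<forall>i<n. (\<lambda>\<zeta>. f \<zeta> i) holomorphic_on ball c r) \<and>
        \<not> f constant_on ball c r \<and> D = f ` ball c r)"

end

theory Submission
  imports Defs "Jordan_Normal_Form.Determinant"
begin

text \<open>
  Uniqueness: by the singular value decomposition, two maximal ellipsoids can be written as \<open>S B\<close> and
  \<open>S D B\<close> with \<open>B\<close> the unit ball and \<open>D\<close> a positive diagonal matrix of determinant \<open>1\<close>. For \<open>w \<in> \<partial>B\<close>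
  the map \<open>\<zeta> \<mapsto> S D\<^sup>\<zeta> w\<close> is holomorphic, and since \<open>D\<^bsup>i y\<^esup>\<close> is unitary, the boundary of the strip
  \<open>0 \<le> Re \<zeta> \<le> 1\<close> is mapped to the boundaries of the two ellipsoids. The continuity principle gives
  \<open>S D\<^sup>\<zeta> B \<subseteq> \<Omega>\<close> on the strip, and a refinement of it shows that \<open>S D\<^bsup>1/2\<^esup> w \<in> \<partial>\<Omega>\<close> forces the
  whole disc \<open>S D\<^sup>\<zeta> w\<close> into \<open>\<partial>\<Omega>\<close>. Without discs in \<open>\<partial>\<Omega>\<close>, the ellipsoid \<open>S D\<^bsup>1/2\<^esup> B\<close> touches \<open>\<partial>\<Omega>\<close>
  at most along the eigenspace of \<open>D\<close> for the eigenvalue \<open>1\<close>; shrinking it slightly there and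
  stretching it in the other directions increases its volume inside \<open>\<Omega>\<close>.

  Non-uniqueness: in \<open>{\<bar>z\<^sub>0 z\<^sub>1\<bar> < 1/2, \<bar>z\<^sub>0\<bar> < 2, \<bar>z\<^sub>1\<bar> < 2}\<close> the images of the ball under
  \<open>diag(d, 1/d)\<close>, \<open>1/2 < d < 2\<close>, are all maximal.
\<close>

section \<open>The coordinate space\<close>

text \<open>Plurisubharmonicity is tested only on affine complex lines, while the interpolating
  discs are exponential curves; a maximum principle for curved discs therefore precedes the
  continuity principle. The strip is unbounded, which is met by a damping factor in
  \<open>\<zeta>\<close>. The exponent 1/2 yields a contradiction because the square root of
  \<open>D\<close> again has determinant 1: the middle ellipsoid has the volume of the two given
  ones, so any gain is too much. There is room for a gain because \<open>D\<close> differs from the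
  identity in some direction, and a point of contact with a nonzero coordinate there would put a
  nonconstant disc into the frontier. Volumes enter only through the factor |det T|^2 by which a
  complex linear map \<open>T\<close> scales them, so maximality becomes a comparison of
  determinants. In the example |z0 z1| is invariant under diag(d, 1/d), whose determinant is 1. No
  larger determinant is possible, since the product of two linear forms in two variables attains at
  least half the modulus of their determinant on the unit sphere.\<close>

lemma ctop_eq: "ctop n = top_of_set (cspace n)"
proof -
  \<comment> \<open>Viewing \<open>cspace n\<close> as a subspace of the function space makes
    \<open>closed\<close>, \<open>compact\<close> and \<open>continuous_on\<close> available for its
    subsets.\<close>
  have 1: "continuous_map (ctop n) (top_of_set (cspace n)) (\<lambda>x. x)"
    unfolding continuous_map_in_subtopology
  proof
    show "continuous_map (ctop n) euclidean (\<lambda>x. x)"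
      unfolding euclidean_product_topology[symmetric] continuous_map_componentwise_UNIV
    proof
      fix k show "continuous_map (ctop n) euclidean (\<lambda>x. x k)"
      proof (cases "k < n")
        case True then show ?thesis by (intro continuous_map_product_projection) auto
      next
        \<comment> \<open>From \<open>n\<close> on, every point of the carrier takes the value
          \<open>undefined\<close>, so this projection is constant.\<close>
        case False
        have eq: "undefined = x k" if "x \<in> topspace (ctop n)" for x :: "nat \<Rightarrow> complex"
        proof -
          have "x \<in> extensional {..<n}" using that unfolding topspace_product_topology PiE_iff by blast
          then show ?thesis using False unfolding extensional_def by fastforce
        qed
        have cm: "continuous_map (ctop n) euclidean (\<lambda>x::nat\<Rightarrow>complex. undefined::complex)"
          by (rule continuous_map_const[THEN iffD2]) simp
        show ?thesis by (rule continuous_map_eq[OF cm]) (rule eq)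
      qed
    qed
  qed auto
  have 2: "continuous_map (top_of_set (cspace n)) (ctop n) (\<lambda>x. x)"
    unfolding continuous_map_componentwise
  proof (intro conjI ballI)
    show "(\<lambda>x. x) ` topspace (top_of_set (cspace n)) \<subseteq> extensional {..<n}"
      by (simp add: PiE_def)
    show "continuous_map (top_of_set (cspace n)) euclidean (\<lambda>x. x k)" for k
      unfolding continuous_map_iff_continuous
      by (rule continuous_on_subset[OF continuous_on_product_coordinates subset_UNIV])
  qed
  show ?thesis
  proof (rule topology_eq[THEN iffD2], intro allI iffI)
    fix S assume S: "openin (ctop n) S"
    then have "S \<subseteq> cspace n" using openin_subset by fastforce
    moreover have "openin (top_of_set (cspace n)) {x \<in> cspace n. x \<in> S}"
      using openin_continuous_map_preimage[OF 2 S] by simp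
    ultimately show "openin (top_of_set (cspace n)) S"
      by (simp add: Collect_conj_eq Int_absorb1)
  next
    fix S assume S: "openin (top_of_set (cspace n)) S"
    then have "S \<subseteq> cspace n" using openin_subset by fastforce
    moreover have "openin (ctop n) {x \<in> cspace n. x \<in> S}"
      using openin_continuous_map_preimage[OF 1 S] by simp
    ultimately show "openin (ctop n) S"
      by (simp add: Collect_conj_eq Int_absorb1)
  qed
qed

lemma compactin_ctop: "compactin (ctop n) K \<longleftrightarrow> compact K \<and> K \<subseteq> cspace n"
  unfolding ctop_eq by (simp add: compactin_subtopology)

text \<open>A product of closed sets: the whole plane below \<open>n\<close>, the singleton of
  \<open>undefined\<close> from \<open>n\<close> on.\<close>

lemma closed_cspace: "closed (cspace n)"
proof -
  have "closedin (product_topology (\<lambda>i. euclidean) (UNIV::nat set))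
      (PiE UNIV (\<lambda>i. if i < n then UNIV else {undefined::complex}))"
    by (subst closedin_product_topology) auto
  moreover have "PiE UNIV (\<lambda>i. if i < n then UNIV else {undefined::complex}) = cspace n"
    unfolding PiE_def extensional_def Pi_def by (auto split: if_splits)
  ultimately show ?thesis by (simp add: euclidean_product_topology)
qed

lemma compact_cbox_cspace: "compact ({..<n::nat} \<rightarrow>\<^sub>E cball (0::complex) R)"
proof -
  have "compactin (ctop n) ({..<n} \<rightarrow>\<^sub>E cball (0::complex) R)"
    by (subst compactin_PiE) auto
  then show ?thesis by (simp add: compactin_ctop)
qed

text \<open>Heine-Borel with boundedness measured in each coordinate: a closed subset of a compact
  polydisc.\<close>

lemma cspace_bounded_closed_compact:
  assumes "S \<subseteq> cspace n" "closed S" "\<And>z i. z \<in> S \<Longrightarrow> i < n \<Longrightarrow> cmod (z i) \<le> R"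
  shows "compact S"
proof -
  have "S \<subseteq> ({..<n} \<rightarrow>\<^sub>E cball (0::complex) R)"
  proof
    fix z assume "z \<in> S"
    with assms(1) have "z \<in> extensional {..<n}" unfolding PiE_def by blast
    with \<open>z \<in> S\<close> show "z \<in> {..<n} \<rightarrow>\<^sub>E cball (0::complex) R"
      by (simp add: PiE_def Pi_def assms(3))
  qed
  then have "S = S \<inter> ({..<n} \<rightarrow>\<^sub>E cball (0::complex) R)" by blast
  then show ?thesis
    using closed_Int_compact[OF assms(2) compact_cbox_cspace] by metis
qed

lemma openin_cspace_ball:
  assumes "openin (ctop n) \<Omega>" "z \<in> \<Omega>"
  obtains e where "e > 0" "\<And>w. w \<in> cspace n \<Longrightarrow> (\<And>i. i < n \<Longrightarrow> cmod (w i - z i) < e) \<Longrightarrow> w \<in> \<Omega>"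
proof -
  obtain W where W: "\<forall>i<n. open (W i)" "z \<in> PiE {..<n} W" "PiE {..<n} W \<subseteq> \<Omega>"
    using assms(1)[unfolded openin_product_topology_alt, rule_format, OF assms(2)]
    unfolding open_openin[symmetric] by (metis lessThan_iff)
  have "\<exists>e>0. ball (z i) e \<subseteq> W i" if "i < n" for i
    using W(1,2) that unfolding open_contains_ball PiE_iff by blast
  then obtain d where d: "\<And>i. i < n \<Longrightarrow> d i > 0 \<and> ball (z i) (d i) \<subseteq> W i" by metis
  \<comment> \<open>The extra element 1 keeps the minimum defined when \<open>n = 0\<close>.\<close>
  define e where "e = Min (insert 1 (d ` {..<n}))"
  have "e > 0" using d by (auto simp: e_def)
  moreover have "w \<in> \<Omega>" if w: "w \<in> cspace n" "\<And>i. i < n \<Longrightarrow> cmod (w i - z i) < e" for w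
  proof -
    have "w i \<in> W i" if "i < n" for i
    proof -
      have "e \<le> d i" using that unfolding e_def by (intro Min_le) auto
      with w(2)[OF that] have "w i \<in> ball (z i) (d i)" by (simp add: dist_norm norm_minus_commute)
      then show ?thesis using d[OF that] by blast
    qed
    then have "w \<in> PiE {..<n} W" using w(1) unfolding PiE_def Pi_def by simp
    then show ?thesis using W(3) by (rule set_mp[rotated])
  qed
  ultimately show thesis using that by blast
qed

lemma cnorm_nonneg [simp]: "0 \<le> cnorm n z"
  by (simp add: cnorm_def L2_set_nonneg)

lemma cnorm_sq: "(cnorm n z)\<^sup>2 = (\<Sum>i<n. (cmod (z i))\<^sup>2)"
  by (simp add: cnorm_def L2_set_def sum_nonneg)

lemma component_le_cnorm: "i < n \<Longrightarrow> cmod (z i) \<le> cnorm n z"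
  unfolding cnorm_def by (rule member_le_L2_set) auto

lemma continuous_on_into_cspace:
  assumes "\<And>i. i < n \<Longrightarrow> continuous_on S (\<lambda>x. f x i)" "\<And>x. x \<in> S \<Longrightarrow> f x \<in> cspace n"
  shows "continuous_on S f"
proof (rule continuous_on_coordinatewise_then_product)
  fix i
  show "continuous_on S (\<lambda>x. f x i)"
  proof (cases "i < n")
    case False
    have "continuous_on S (\<lambda>x. undefined::complex)" by simp
    then show ?thesis using assms(2) False
      by (subst continuous_on_cong[OF refl, of _ _ "\<lambda>_. undefined"]) (auto simp: PiE_iff extensional_def)
  qed (use assms in auto)
qed

lemma continuous_on_cnorm:
  assumes "continuous_on S f" shows "continuous_on S (\<lambda>x. cnorm n (f x))"
  unfolding cnorm_def L2_set_def
  by (intro continuous_on_real_sqrt continuous_on_sum continuous_on_power continuous_on_norm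
      continuous_on_product_then_coordinatewise[OF assms])

section \<open>Plurisubharmonic functions on holomorphic discs\<close>

text \<open>Cauchy's formula at the centre: on the circle, the derivative of
  \<open>circlepath\<close> divided by \<open>u - c\<close> is the constant
  \<open>2 * pi * \<i>\<close>, so the contour integral is an ordinary mean.\<close>

lemma holomorphic_circle_mean:
  fixes g :: "complex \<Rightarrow> complex"
  assumes "g holomorphic_on U" "open U" "cball c r \<subseteq> U" "0 < r"
  shows "((\<lambda>\<theta>. g (c + of_real r * cis \<theta>)) has_integral (2 * pi * g c)) {0..2*pi}"
proof -
  have "g holomorphic_on cball c r" by (rule holomorphic_on_subset[OF assms(1,3)])
  then have "((\<lambda>u. g u / (u - c)) has_contour_integral (2 * of_real pi * \<i> * g c)) (circlepath c r)"
    by (rule Cauchy_integral_circlepath_simple) (simp add: assms(4))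
  then have *: "((\<lambda>x. g (circlepath c r x) / (circlepath c r x - c) * 
      vector_derivative (circlepath c r) (at x within {0..1})) has_integral (2 * of_real pi * \<i> * g c)) {0..1}"
    unfolding has_contour_integral_def .
  have eq: "g (circlepath c r x) / (circlepath c r x - c) * 
      vector_derivative (circlepath c r) (at x within {0..1}) = (2 * of_real pi * \<i>) * g (c + of_real r * cis (2*pi*x))"
    if "x \<in> {0..1}" for x
  proof -
    have "0 \<le> x" "x \<le> 1" using that by auto
    moreover have "circlepath c r x = c + of_real r * cis (2*pi*x)"
      by (simp add: circlepath cis_conv_exp mult_ac)
    moreover have "exp (2 * of_real pi * \<i> * of_real x) = cis (2*pi*x)"
      by (simp add: cis_conv_exp mult_ac)
    ultimately show ?thesis using \<open>0 < r\<close> by (simp add: vector_derivative_circlepath01)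
  qed
  have "((\<lambda>x. (2 * of_real pi * \<i>) * g (c + of_real r * cis (2*pi*x))) has_integral (2 * of_real pi * \<i> * g c)) {0..1}"
    by (rule has_integral_eq[OF eq *])
  from has_integral_mult_right[OF this, of "1 / (2 * of_real pi * \<i>)"]
  have "((\<lambda>x. g (c + of_real r * cis (2*pi*x))) has_integral g c) {0..1}" by simp
  from has_integral_stretch_real[OF this, of "1/(2*pi)"]
  have "((\<lambda>x. g (c + of_real r * cis x)) has_integral (2*pi) *\<^sub>R g c) ((\<lambda>x. x * (2*pi)) ` {0..1})"
    by simp
  moreover have "(\<lambda>x. x * (2*pi)) ` {0..1} = {0..2*pi}" 
    using image_mult_atLeastAtMost[of "2*pi" 0 1] by (simp add: mult.commute[of _ "2*pi"])
  ultimately show ?thesis by (simp add: scaleR_conv_of_real)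
qed

section \<open>Vector operations and uniform neighbourhoods in \<open>cspace n\<close>\<close>

lemma cspace_cadd [simp]: "cadd n z w \<in> cspace n"
  and cspace_cscale [simp]: "cscale n c z \<in> cspace n"
  and cspace_czero [simp]: "czero n \<in> cspace n"
  by (simp_all add: cadd_def cscale_def czero_def)

lemma cspace_eqI: "z \<in> cspace n \<Longrightarrow> w \<in> cspace n \<Longrightarrow> (\<And>i. i < n \<Longrightarrow> z i = w i) \<Longrightarrow> z = w"
  by (rule PiE_ext) auto

lemma cadd_czero: "z \<in> cspace n \<Longrightarrow> cadd n z (czero n) = z"
  by (rule cspace_eqI) (auto simp: cadd_def czero_def)

lemma cnorm_czero [simp]: "cnorm n (czero n) = 0"
  by (simp add: cnorm_def czero_def L2_set_def)

lemma openin_ctop_subset: "openin (ctop n) \<Omega> \<Longrightarrow> \<Omega> \<subseteq> cspace n"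
  using openin_subset by fastforce

lemma continuous_map_ctop_iff:
  "\<Omega> \<subseteq> cspace n \<Longrightarrow> continuous_map (subtopology (ctop n) \<Omega>) euclideanreal u \<longleftrightarrow> continuous_on \<Omega> u"
  unfolding ctop_eq by (simp add: subtopology_subtopology Int_absorb1)

lemma cnorm_le_sum: "cnorm n z \<le> (\<Sum>i<n. cmod (z i))"
  unfolding cnorm_def by (rule L2_set_le_sum) simp

text \<open>A Lebesgue number argument. A relation between two points covers uniform containment and
  uniform continuity at once; both points vary in the hypothesis because a point of \<open>K\<close>
  is in general not the centre of the covering box that contains it.\<close>

lemma compact_uniform_nbhd:
  assumes K: "compact K" "K \<subseteq> cspace n"
    and Q: "\<And>z. z \<in> K \<Longrightarrow> \<exists>e>0. \<forall>v\<in>cspace n. \<forall>w\<in>cspace n.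
      (\<forall>i<n. cmod (v i - z i) < e) \<longrightarrow> (\<forall>i<n. cmod (w i - z i) < e) \<longrightarrow> Q v w"
  obtains e where "e > 0" "\<And>z w. z \<in> K \<Longrightarrow> w \<in> cspace n \<Longrightarrow> (\<And>i. i < n \<Longrightarrow> cmod (w i - z i) < e) \<Longrightarrow> Q z w"
proof -
  obtain d where d: "\<And>z. z \<in> K \<Longrightarrow> d z > 0"
    and dQ: "\<And>z v w. z \<in> K \<Longrightarrow> v \<in> cspace n \<Longrightarrow> w \<in> cspace n \<Longrightarrow> \<forall>i<n. cmod (v i - z i) < d z \<Longrightarrow>
       \<forall>i<n. cmod (w i - z i) < d z \<Longrightarrow> Q v w"
    using Q by metis
  \<comment> \<open>Half the radius leaves room for the triangle inequality from \<open>w\<close>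
    over \<open>z\<close> to the centre.\<close>
  define W where "W z = {v. \<forall>i<n. cmod (v i - z i) < d z / 2}" for z
  have Wo: "open (W z)" for z
  proof -
    have eq: "W z = (\<Inter>i\<in>{..<n}. {v. cmod (v i - z i) < d z / 2})" by (auto simp: W_def)
    have o: "open {v. cmod (v i - z i) < d z / 2}" for i
      by (intro open_Collect_less continuous_on_norm continuous_on_diff continuous_on_product_coordinates
           continuous_on_const)
    show ?thesis unfolding eq by (intro open_INT ballI o finite_lessThan)
  qed
  have "K \<subseteq> (\<Union>z\<in>K. W z)" using d by (auto simp: W_def)
  from compactE_image[OF K(1) _ this] Wo obtain F where F: "F \<subseteq> K" "finite F" "K \<subseteq> (\<Union>z\<in>F. W z)"
    by metis
  define e where "e = Min (insert 1 ((\<lambda>z. d z / 2) ` F))"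
  have "e > 0" unfolding e_def using F d by (subst Min_gr_iff) auto
  moreover have "Q z w" if z: "z \<in> K" and w: "w \<in> cspace n" "\<And>i. i < n \<Longrightarrow> cmod (w i - z i) < e" for z w
  proof -
    obtain y where y: "y \<in> F" "z \<in> W y" using F z by blast
    have "e \<le> d y / 2" unfolding e_def using F y by (intro Min_le) auto
    have dy: "d y > 0" using d y F by blast
    show ?thesis
    proof (rule dQ[of y])
      show "\<forall>i<n. cmod (z i - y i) < d y" using y(2) dy by (fastforce simp: W_def)
      show "\<forall>i<n. cmod (w i - y i) < d y"
      proof (intro allI impI)
        fix i assume "i < n"
        have "cmod (w i - y i) \<le> cmod (w i - z i) + cmod (z i - y i)"
          using norm_triangle_ineq[of "w i - z i" "z i - y i"] by simp
        also have "\<dots> < e + d y / 2" using w(2)[OF \<open>i < n\<close>] y(2) \<open>i < n\<close> by (fastforce simp: W_def intro: add_strict_mono)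
        finally show "cmod (w i - y i) < d y" using \<open>e \<le> d y / 2\<close> by linarith
      qed
    qed (use y F z K w in auto)
  qed
  ultimately show thesis using that by blast
qed

lemma continuous_on_cspaceD:
  assumes "continuous_on \<Omega> (u :: (nat \<Rightarrow> complex) \<Rightarrow> real)" "openin (ctop n) \<Omega>" "z \<in> \<Omega>" "0 < k"
  shows "\<exists>e>0. \<forall>v\<in>cspace n. (\<forall>i<n. cmod (v i - z i) < e) \<longrightarrow> v \<in> \<Omega> \<and> \<bar>u v - u z\<bar> < k"
proof -
  obtain A where A: "open A" "A \<inter> \<Omega> = u -` ball (u z) k \<inter> \<Omega>"
    using assms(1)[unfolded continuous_on_open_invariant, rule_format, OF open_ball] by metis
  obtain B where B: "open B" "\<Omega> = cspace n \<inter> B"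
    using assms(2) unfolding ctop_eq openin_open by blast
  have "openin (ctop n) (A \<inter> \<Omega>)"
    unfolding ctop_eq openin_open using A B by (intro exI[of _ "A \<inter> B"]) auto
  moreover have "z \<in> A \<inter> \<Omega>" unfolding A using assms by simp
  ultimately obtain e where "e > 0"
    "\<And>w. w \<in> cspace n \<Longrightarrow> (\<And>i. i < n \<Longrightarrow> cmod (w i - z i) < e) \<Longrightarrow> w \<in> A \<inter> \<Omega>"
    by (rule openin_cspace_ball) blast
  then show ?thesis unfolding A
    by (intro exI[of _ e]) (auto simp: dist_real_def abs_minus_commute)
qed

lemma cnorm_triangle_diff: "cnorm n (\<lambda>i\<in>{..<n}. e i - r i) \<le> cnorm n e + (\<Sum>i<n. cmod (r i))"
proof -
  have "cnorm n (\<lambda>i\<in>{..<n}. e i - r i) \<le> L2_set (\<lambda>i. cmod (e i) + cmod (r i)) {..<n}"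
    unfolding cnorm_def by (rule L2_set_mono) (auto simp: norm_triangle_ineq4)
  also have "\<dots> \<le> cnorm n e + L2_set (\<lambda>i. cmod (r i)) {..<n}"
    unfolding cnorm_def by (rule L2_set_triangle_ineq)
  also have "L2_set (\<lambda>i. cmod (r i)) {..<n} \<le> (\<Sum>i<n. cmod (r i))"
    by (rule L2_set_le_sum) simp
  finally show ?thesis by simp
qed

lemma cmod_add_sq: "(cmod (a + b))\<^sup>2 = (cmod a)\<^sup>2 + 2 * Re (cnj a * b) + (cmod b)\<^sup>2"
  unfolding cmod_power2 by (simp add: power2_eq_square algebra_simps)

text \<open>
  The hypothesis only concerns affine discs. To reach a curved disc \<open>\<phi>\<close>, maximise
  \<open>u (\<phi> \<zeta> + e) + \<epsilon> \<bar>\<zeta>\<bar>\<^sup>2 - K \<bar>e\<bar>\<^sup>2\<close> over \<open>\<zeta>\<close> and a small displacement \<open>e\<close>. At an interior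
  maximum, move along the affine tangent disc: the displacement becomes \<open>e - R \<zeta>\<close>, where the
  remainder \<open>R\<close> has mean \<open>0\<close> over small circles of radius \<open>\<rho>\<close> and satisfies \<open>R = o(\<rho>)\<close>, so the circle
  mean of the penalty grows by only \<open>o(\<rho>\<^sup>2)\<close>, less than the gain \<open>\<epsilon> \<rho>\<^sup>2\<close>.
\<close>

lemma psh_max_principle:
  assumes psh: "cont_plurisubharmonic_on n \<Omega> u" and \<Omega>: "openin (ctop n) \<Omega>"
    and U: "open U" "bounded U"
    and \<phi>: "\<And>\<zeta>. \<zeta> \<in> closure U \<Longrightarrow> \<phi> \<zeta> \<in> \<Omega>"
    and cont: "\<And>i. i < n \<Longrightarrow> continuous_on (closure U) (\<lambda>\<zeta>. \<phi> \<zeta> i)"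
    and hol: "\<And>i. i < n \<Longrightarrow> (\<lambda>\<zeta>. \<phi> \<zeta> i) holomorphic_on U"
    and bd: "\<And>\<zeta>. \<zeta> \<in> frontier U \<Longrightarrow> u (\<phi> \<zeta>) \<le> M"
    and \<zeta>1: "\<zeta>1 \<in> U"
  shows "u (\<phi> \<zeta>1) \<le> M"
proof (rule ccontr)
  assume "\<not> u (\<phi> \<zeta>1) \<le> M"
  \<comment> \<open>The displacement and the term in \<open>\<epsilon>\<close> change the values by
    at most \<open>\<kappa>\<close> each, so an excess of \<open>5 * \<kappa>\<close> over
    \<open>M\<close> keeps the maximiser away from the frontier.\<close>
  define \<kappa> where "\<kappa> = (u (\<phi> \<zeta>1) - M) / 5"
  have \<kappa>: "\<kappa> > 0" and u1: "u (\<phi> \<zeta>1) = M + 5 * \<kappa>" using \<open>\<not> _\<close> by (simp_all add: \<kappa>_def field_simps)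
  have \<Omega>s: "\<Omega> \<subseteq> cspace n" using openin_ctop_subset[OF \<Omega>] .
  have ucont: "continuous_on \<Omega> u"
    using psh continuous_map_ctop_iff[OF \<Omega>s] unfolding cont_plurisubharmonic_on_def by blast
  have ccl: "compact (closure U)" using U by simp
  have \<phi>c: "\<phi> \<zeta> \<in> cspace n" if "\<zeta> \<in> closure U" for \<zeta> using \<phi>[OF that] \<Omega>s by blast
  have \<phi>cont: "continuous_on (closure U) \<phi>"
    using cont \<phi>c by (rule continuous_on_into_cspace)
  have cK: "compact (\<phi> ` closure U)" using compact_continuous_image[OF \<phi>cont ccl] .
  have Ks: "\<phi> ` closure U \<subseteq> cspace n" using \<phi>c by blast
  obtain \<eta>' where \<eta>': "\<eta>' > 0" "\<And>z w. z \<in> \<phi> ` closure U \<Longrightarrow> w \<in> cspace n \<Longrightarrow>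
      (\<And>i. i < n \<Longrightarrow> cmod (w i - z i) < \<eta>') \<Longrightarrow> w \<in> \<Omega> \<and> \<bar>u w - u z\<bar> < \<kappa>"
  proof (rule compact_uniform_nbhd[OF cK Ks, of "\<lambda>z w. w \<in> \<Omega> \<and> \<bar>u w - u z\<bar> < \<kappa>"])
    fix z assume "z \<in> \<phi> ` closure U"
    then have "z \<in> \<Omega>" using \<phi> by blast
    from continuous_on_cspaceD[OF ucont \<Omega> this, of "\<kappa>/2"] \<kappa> obtain e where e: "e > 0" 
      "\<And>v. v\<in>cspace n \<Longrightarrow> (\<forall>i<n. cmod (v i - z i) < e) \<Longrightarrow> v \<in> \<Omega> \<and> \<bar>u v - u z\<bar> < \<kappa>/2" by auto
    show "\<exists>e>0. \<forall>v\<in>cspace n. \<forall>w\<in>cspace n. (\<forall>i<n. cmod (v i - z i) < e) \<longrightarrow>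
        (\<forall>i<n. cmod (w i - z i) < e) \<longrightarrow> w \<in> \<Omega> \<and> \<bar>u w - u v\<bar> < \<kappa>"
    proof (intro exI[of _ e] conjI ballI impI)
      fix v w assume vw: "v \<in> cspace n" "w \<in> cspace n" "\<forall>i<n. cmod (v i - z i) < e" "\<forall>i<n. cmod (w i - z i) < e"
      show "w \<in> \<Omega>" using e(2)[OF vw(2,4)] by simp
      show "\<bar>u w - u v\<bar> < \<kappa>" using e(2)[OF vw(2,4)] e(2)[OF vw(1,3)] by linarith
    qed (rule e(1))
  qed blast
  define \<eta> where "\<eta> = \<eta>' / 2"
  have \<eta>: "\<eta> > 0" using \<eta>' by (simp add: \<eta>_def)
  have near: "cadd n (\<phi> \<zeta>) e \<in> \<Omega> \<and> \<bar>u (cadd n (\<phi> \<zeta>) e) - u (\<phi> \<zeta>)\<bar> < \<kappa>"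
    if "\<zeta> \<in> closure U" "cnorm n e \<le> \<eta>" for \<zeta> e
  proof (rule \<eta>'(2))
    fix i assume "i < n"
    then have "cmod (cadd n (\<phi> \<zeta>) e i - \<phi> \<zeta> i) \<le> cnorm n e"
      using component_le_cnorm[of i n e] by (simp add: cadd_def)
    then show "cmod (cadd n (\<phi> \<zeta>) e i - \<phi> \<zeta> i) < \<eta>'" using that \<eta>' \<eta> by (simp add: \<eta>_def)
  qed (use that in auto)
  obtain R0 where R0: "R0 > 0" "\<And>\<zeta>. \<zeta> \<in> closure U \<Longrightarrow> cmod \<zeta> \<le> R0"
    using compact_imp_bounded[OF ccl] unfolding bounded_pos by blast
  define \<epsilon> where "\<epsilon> = \<kappa> / R0\<^sup>2"
  have \<epsilon>: "\<epsilon> > 0" "\<And>\<zeta>. \<zeta> \<in> closure U \<Longrightarrow> \<epsilon> * (cmod \<zeta>)\<^sup>2 \<le> \<kappa>"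
  proof -
    show "\<epsilon> > 0" using \<kappa> R0 by (simp add: \<epsilon>_def)
    fix \<zeta> assume "\<zeta> \<in> closure U"
    then have "(cmod \<zeta>)\<^sup>2 \<le> R0\<^sup>2" using R0 by (intro power_mono) auto
    then show "\<epsilon> * (cmod \<zeta>)\<^sup>2 \<le> \<kappa>" using \<kappa> R0 by (simp add: \<epsilon>_def field_simps)
  qed
  \<comment> \<open>At \<open>cnorm n e = \<eta>\<close> the penalty is \<open>3 * \<kappa>\<close>,
    more than the \<open>2 * \<kappa>\<close> that can be gained; so the maximising displacement has
    norm strictly below \<open>\<eta>\<close>.\<close>
  define K where "K = 3 * \<kappa> / \<eta>\<^sup>2"
  have K: "K > 0" "K * \<eta>\<^sup>2 = 3 * \<kappa>" using \<kappa> \<eta> by (auto simp: K_def)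
  define B where "B = {e \<in> cspace n. cnorm n e \<le> \<eta>}"
  have cB: "compact B"
  proof (rule cspace_bounded_closed_compact)
    show "B \<subseteq> cspace n" by (auto simp: B_def)
    have "B = cspace n \<inter> {e. cnorm n e \<le> \<eta>}" by (auto simp: B_def)
    moreover have "closed {e. cnorm n e \<le> \<eta>}"
      by (intro closed_Collect_le continuous_on_cnorm continuous_on_id continuous_on_const)
    ultimately show "closed B" using closed_cspace by auto
    show "cmod (z i) \<le> \<eta>" if "z \<in> B" "i < n" for z i
      using component_le_cnorm[OF that(2), of z] that(1) by (simp add: B_def)
  qed
  define V where "V = (\<lambda>(\<zeta>, e). u (cadd n (\<phi> \<zeta>) e) + \<epsilon> * (cmod \<zeta>)\<^sup>2 - K * (cnorm n e)\<^sup>2)"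
  have c1: "continuous_on (closure U \<times> B) (\<lambda>p. cadd n (\<phi> (fst p)) (snd p))"
  proof (rule continuous_on_into_cspace)
    fix i assume "i < n"
    have "continuous_on (closure U \<times> B) (\<lambda>p. \<phi> (fst p) i)"
      by (rule continuous_on_compose2[OF cont[OF \<open>i < n\<close>] continuous_on_fst[OF continuous_on_id]]) auto
    moreover have "continuous_on (closure U \<times> B) (\<lambda>p. snd p i)"
      by (rule continuous_on_product_then_coordinatewise[OF continuous_on_snd[OF continuous_on_id]])
    ultimately show "continuous_on (closure U \<times> B) (\<lambda>p. cadd n (\<phi> (fst p)) (snd p) i)"
      unfolding cadd_def using \<open>i < n\<close> by (simp add: continuous_on_add)
  qed simp
  have "continuous_on (closure U \<times> B) V"
    unfolding V_def case_prod_beta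
    by (intro continuous_on_diff continuous_on_add continuous_on_mult continuous_on_const continuous_on_power
        continuous_on_norm continuous_on_fst continuous_on_id continuous_on_cnorm continuous_on_snd
        continuous_on_compose2[OF ucont c1]) (use near in \<open>auto simp: B_def\<close>)
  moreover have "compact (closure U \<times> B)" using ccl cB by (rule compact_Times)
  moreover have z1: "(\<zeta>1, czero n) \<in> closure U \<times> B"
    using \<zeta>1 closure_subset \<eta> by (auto simp: B_def)
  ultimately obtain \<zeta>0 e0 where p0: "(\<zeta>0, e0) \<in> closure U \<times> B"
    and max: "\<And>\<zeta> e. \<zeta> \<in> closure U \<Longrightarrow> e \<in> B \<Longrightarrow> V (\<zeta>, e) \<le> V (\<zeta>0, e0)"
    using continuous_attains_sup[of "closure U \<times> B" V] by (metis empty_iff mem_Sigma_iff surj_pair)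
  have cl0: "\<zeta>0 \<in> closure U" and e0: "e0 \<in> cspace n" "cnorm n e0 \<le> \<eta>" using p0 by (auto simp: B_def)
  have zB: "czero n \<in> B" using \<eta> by (simp add: B_def)
  have Vz: "V (\<zeta>, czero n) = u (\<phi> \<zeta>) + \<epsilon> * (cmod \<zeta>)\<^sup>2" if "\<zeta> \<in> closure U" for \<zeta>
    unfolding V_def using cadd_czero[OF \<phi>c[OF that]] by simp
  have V1: "M + 5 * \<kappa> \<le> V (\<zeta>0, e0)"
  proof -
    have "0 \<le> \<epsilon> * (cmod \<zeta>1)\<^sup>2" using \<epsilon> by simp
    then show ?thesis using max[of \<zeta>1 "czero n"] z1 Vz[of \<zeta>1] u1 by auto
  qed
  have V0: "V (\<zeta>0, e0) \<le> u (\<phi> \<zeta>0) + 2 * \<kappa> - K * (cnorm n e0)\<^sup>2"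
    using near[OF cl0 e0(2)] \<epsilon>(2)[OF cl0] unfolding V_def prod.case by linarith
  have "\<zeta>0 \<in> U"
  proof (rule ccontr)
    assume "\<zeta>0 \<notin> U"
    then have "\<zeta>0 \<in> frontier U" using cl0 U by (simp add: frontier_def interior_open)
    then have "u (\<phi> \<zeta>0) \<le> M" by (rule bd)
    moreover have "0 \<le> K * (cnorm n e0)\<^sup>2" using K by simp
    ultimately show False using V0 V1 \<kappa> by linarith
  qed
  have e0lt: "cnorm n e0 < \<eta>"
  proof (rule ccontr)
    assume "\<not> cnorm n e0 < \<eta>"
    then have "cnorm n e0 = \<eta>" using e0 by simp
    then have "V (\<zeta>0, e0) < u (\<phi> \<zeta>0)" using V0 K \<kappa> by simp
    moreover have "0 \<le> \<epsilon> * (cmod \<zeta>0)\<^sup>2" using \<epsilon> by simp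
    ultimately show False using max[OF cl0 zB] Vz[OF cl0] by linarith
  qed
  define b where "b = (\<lambda>i\<in>{..<n}. deriv (\<lambda>\<zeta>. \<phi> \<zeta> i) \<zeta>0)"
  define R where "R = (\<lambda>\<zeta> i. \<phi> \<zeta> i - \<phi> \<zeta>0 i - b i * (\<zeta> - \<zeta>0))"
  \<comment> \<open>Remainders of size \<open>q * \<rho>\<close> in \<open>n\<close> coordinates
    cost at most \<open>K * n * q\<^sup>2 * \<rho>\<^sup>2\<close>, which has to stay below
    \<open>\<epsilon> * \<rho>\<^sup>2\<close>. The summand 1 makes this strict and covers
    \<open>n = 0\<close>.\<close>
  define q where "q = sqrt (\<epsilon> / (K * (n + 1)))"
  have q: "q > 0" "K * n * q\<^sup>2 < \<epsilon>"
  proof -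
    have pos: "\<epsilon> / (K * (n + 1)) > 0" using K \<epsilon> by (intro divide_pos_pos mult_pos_pos) auto
    then show "q > 0" unfolding q_def by simp
    have "K * n * q\<^sup>2 = \<epsilon> * (n / (n + 1))" using pos K by (simp add: q_def)
    also have "\<dots> < \<epsilon> * 1" using \<epsilon> by (intro mult_strict_left_mono) auto
    finally show "K * n * q\<^sup>2 < \<epsilon>" by simp
  qed
  have "\<exists>d>0. \<forall>\<zeta>. cmod (\<zeta> - \<zeta>0) < d \<longrightarrow> cmod (R \<zeta> i) \<le> q * cmod (\<zeta> - \<zeta>0)" if "i < n" for i
  proof -
    have "((\<lambda>\<zeta>. \<phi> \<zeta> i) has_field_derivative b i) (at \<zeta>0)"
      unfolding b_def using that holomorphic_derivI[OF hol[OF that] U(1) \<open>\<zeta>0 \<in> U\<close>] by simp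
    then show ?thesis using q(1)
      unfolding has_field_derivative_def has_derivative_at_alt R_def by auto
  qed
  then obtain d where d: "\<And>i. i < n \<Longrightarrow> d i > 0"
    "\<And>i \<zeta>. i < n \<Longrightarrow> cmod (\<zeta> - \<zeta>0) < d i \<Longrightarrow> cmod (R \<zeta> i) \<le> q * cmod (\<zeta> - \<zeta>0)" by metis
  obtain r0 where r0: "r0 > 0" "cball \<zeta>0 r0 \<subseteq> U"
    using U(1) \<open>\<zeta>0 \<in> U\<close> unfolding open_contains_cball by blast
  \<comment> \<open>The three kinds of bounds keep the circle in \<open>U\<close>, the corrected
    displacement in \<open>B\<close>, and the remainder estimate valid in every coordinate.\<close>
  define \<rho> where "\<rho> = Min (insert r0 (insert ((\<eta> - cnorm n e0) / (n * q + 1)) ((\<lambda>i. d i / 2) ` {..<n})))"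
  have "\<rho> \<le> r0" "\<rho> \<le> (\<eta> - cnorm n e0) / (n * q + 1)"
    unfolding \<rho>_def by (rule Min_le; simp)+
  have \<rho>d: "\<rho> < d i" if "i < n" for i
  proof -
    have "\<rho> \<le> d i / 2" unfolding \<rho>_def using that by (intro Min_le) auto
    then show ?thesis using d(1)[OF that] by simp
  qed
  have nq: "n * q + 1 > 0" using q by (simp add: add_nonneg_pos)
  have \<rho>: "\<rho> > 0" unfolding \<rho>_def using r0 e0lt nq d(1) by (subst Min_gr_iff) auto
  have \<rho>e: "cnorm n e0 + n * q * \<rho> \<le> \<eta>"
  proof -
    have "\<rho> * (n * q + 1) \<le> \<eta> - cnorm n e0" using \<open>\<rho> \<le> (\<eta> - cnorm n e0) / (n * q + 1)\<close> nq by (simp add: field_simps)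
    then show ?thesis using \<rho> by (simp add: algebra_simps)
  qed
  have \<rho>U: "cball \<zeta>0 \<rho> \<subseteq> U" using r0 \<open>\<rho> \<le> r0\<close> by auto
  have Rb: "cmod (R \<zeta> i) \<le> q * \<rho>" if "i < n" "cmod (\<zeta> - \<zeta>0) \<le> \<rho>" for i \<zeta>
  proof -
    have "cmod (R \<zeta> i) \<le> q * cmod (\<zeta> - \<zeta>0)" using d(2)[OF that(1)] \<rho>d[OF that(1)] that(2) by simp
    also have "\<dots> \<le> q * \<rho>" using q that by simp
    finally show ?thesis .
  qed
  define e where "e = (\<lambda>\<zeta>. \<lambda>i\<in>{..<n}. e0 i - R \<zeta> i)"
  have eB: "e \<zeta> \<in> B" if "cmod (\<zeta> - \<zeta>0) \<le> \<rho>" for \<zeta>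
  proof -
    have "cnorm n (e \<zeta>) \<le> cnorm n e0 + (\<Sum>i<n. cmod (R \<zeta> i))" unfolding e_def by (rule cnorm_triangle_diff)
    also have "(\<Sum>i<n. cmod (R \<zeta> i)) \<le> (\<Sum>i<n. q * \<rho>)" using that by (intro sum_mono Rb) auto
    finally show ?thesis using \<rho>e by (simp add: B_def e_def algebra_simps)
  qed
  define a where "a = cadd n (\<phi> \<zeta>0) e0"
  \<comment> \<open>The affine tangent disc equals the curved disc plus the displacement
    \<open>e0 - R\<close>. Hence subharmonicity applies on one side of the identity and maximality
    of \<open>V\<close> on the other.\<close>
  have aff: "cadd n a (cscale n \<tau> b) = cadd n (\<phi> (\<zeta>0 + \<tau>)) (e (\<zeta>0 + \<tau>))" for \<tau>
    by (rule cspace_eqI[OF cspace_cadd cspace_cadd]) (simp add: a_def cadd_def cscale_def e_def R_def algebra_simps)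
  have incl: "\<zeta>0 + \<tau> \<in> closure U" if "cmod \<tau> \<le> \<rho>" for \<tau>
  proof -
    have "\<zeta>0 + \<tau> \<in> cball \<zeta>0 \<rho>" using that by (simp add: dist_norm)
    then show ?thesis using \<rho>U closure_subset by blast
  qed
  define W where "W = {\<tau>. cadd n a (cscale n \<tau> b) \<in> \<Omega>}"
  have WB: "cball 0 \<rho> \<subseteq> W"
    using incl near eB unfolding W_def aff by (auto simp: B_def)
  define h where "h = (\<lambda>\<tau>. u (cadd n a (cscale n \<tau> b)))"
  have "a \<in> cspace n" "b \<in> cspace n" by (auto simp: a_def b_def)
  then have sub: "cont_subharmonic_on W h"
    using psh unfolding cont_plurisubharmonic_on_def W_def h_def by blast
  then have h0: "h 0 \<le> 1 / (2 * pi) * integral {0..2 * pi} (\<lambda>\<theta>. h (0 + of_real \<rho> * cis \<theta>))"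
    using \<rho> WB unfolding cont_subharmonic_on_def by blast
  have hcont: "continuous_on W h" using sub unfolding cont_subharmonic_on_def by blast
  \<comment> \<open>The real part of \<open>G\<close> collects the cross terms of the squares of
    \<open>\<zeta>0 + \<tau>\<close> and \<open>e0 - R\<close>. Since \<open>G\<close> is
    holomorphic and vanishes at \<open>\<zeta>0\<close>, they have circle mean zero.\<close>
  define G where "G = (\<lambda>\<zeta>. - of_real (2 * \<epsilon>) * cnj \<zeta>0 * (\<zeta> - \<zeta>0) - of_real (2 * K) * (\<Sum>i<n. cnj (e0 i) * R \<zeta> i))"
  have Ghol: "G holomorphic_on U" unfolding G_def R_def by (intro holomorphic_intros hol) auto
  have G0: "G \<zeta>0 = 0" by (simp add: G_def R_def)
  define C1 where "C1 = - \<epsilon> * (cmod \<zeta>0)\<^sup>2 - \<epsilon> * \<rho>\<^sup>2 + K * (cnorm n e0)\<^sup>2 + K * n * q\<^sup>2 * \<rho>\<^sup>2"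
  have ub: "h (0 + of_real \<rho> * cis \<theta>) \<le> V (\<zeta>0, e0) + C1 + Re (G (\<zeta>0 + of_real \<rho> * cis \<theta>))" for \<theta>
  proof -
    define \<tau> where "\<tau> = of_real \<rho> * cis \<theta>"
    have \<tau>: "cmod \<tau> = \<rho>" using \<rho> by (simp add: \<tau>_def norm_mult)
    have "V (\<zeta>0 + \<tau>, e (\<zeta>0 + \<tau>)) \<le> V (\<zeta>0, e0)"
      using \<tau> by (intro max incl eB) auto
    then have "h \<tau> \<le> V (\<zeta>0, e0) - \<epsilon> * (cmod (\<zeta>0 + \<tau>))\<^sup>2 + K * (cnorm n (e (\<zeta>0 + \<tau>)))\<^sup>2"
      unfolding h_def aff by (simp add: V_def)
    also have "(cmod (\<zeta>0 + \<tau>))\<^sup>2 = (cmod \<zeta>0)\<^sup>2 + 2 * Re (cnj \<zeta>0 * \<tau>) + \<rho>\<^sup>2"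
      unfolding cmod_add_sq \<tau> ..
    also have "(cnorm n (e (\<zeta>0 + \<tau>)))\<^sup>2 \<le> (cnorm n e0)\<^sup>2 - 2 * (\<Sum>i<n. Re (cnj (e0 i) * R (\<zeta>0 + \<tau>) i)) + n * (q * \<rho>)\<^sup>2"
    proof -
      have "(cnorm n (e (\<zeta>0 + \<tau>)))\<^sup>2 = (\<Sum>i<n. (cmod (e0 i + - R (\<zeta>0 + \<tau>) i))\<^sup>2)"
        unfolding cnorm_sq e_def by simp
      also have "\<dots> = (\<Sum>i<n. (cmod (e0 i))\<^sup>2) - 2 * (\<Sum>i<n. Re (cnj (e0 i) * R (\<zeta>0 + \<tau>) i)) + (\<Sum>i<n. (cmod (R (\<zeta>0 + \<tau>) i))\<^sup>2)"
        unfolding cmod_add_sq by (simp add: sum.distrib sum_negf sum_subtractf sum_distrib_left)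
      also have "(\<Sum>i<n. (cmod (R (\<zeta>0 + \<tau>) i))\<^sup>2) \<le> (\<Sum>i<n. (q * \<rho>)\<^sup>2)"
        using \<tau> by (intro sum_mono power_mono Rb) auto
      finally show ?thesis by (simp add: cnorm_sq)
    qed
    finally have "h \<tau> \<le> V (\<zeta>0, e0) - \<epsilon> * ((cmod \<zeta>0)\<^sup>2 + 2 * Re (cnj \<zeta>0 * \<tau>) + \<rho>\<^sup>2) 
        + K * ((cnorm n e0)\<^sup>2 - 2 * (\<Sum>i<n. Re (cnj (e0 i) * R (\<zeta>0 + \<tau>) i)) + n * (q * \<rho>)\<^sup>2)"
      using K by simp
    moreover have "Re (G (\<zeta>0 + \<tau>)) = - 2 * \<epsilon> * Re (cnj \<zeta>0 * \<tau>) - 2 * K * (\<Sum>i<n. Re (cnj (e0 i) * R (\<zeta>0 + \<tau>) i))"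
      unfolding G_def by (simp add: Re_sum algebra_simps)
    ultimately show ?thesis unfolding C1_def \<tau>_def[symmetric] by (simp add: algebra_simps power_mult_distrib)
  qed
  have Gint: "((\<lambda>\<theta>. Re (G (\<zeta>0 + of_real \<rho> * cis \<theta>))) has_integral 0) {0..2*pi}"
    using has_integral_linear[OF holomorphic_circle_mean[OF Ghol U(1) \<rho>U \<rho>] bounded_linear_Re] G0
    by (simp add: o_def)
  have "((\<lambda>\<theta>. V (\<zeta>0, e0) + C1 + Re (G (\<zeta>0 + of_real \<rho> * cis \<theta>))) has_integral (2 * pi * (V (\<zeta>0, e0) + C1) + 0)) {0..2*pi}"
    using has_integral_const_real[of "V (\<zeta>0, e0) + C1" 0 "2*pi"] Gint by (intro has_integral_add) auto
  moreover have "(\<lambda>\<theta>. h (0 + of_real \<rho> * cis \<theta>)) integrable_on {0..2*pi}"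
  proof (rule integrable_continuous_real)
    show "continuous_on {0..2*pi} (\<lambda>\<theta>. h (0 + of_real \<rho> * cis \<theta>))"
    proof (rule continuous_on_compose2[OF hcont])
      show "continuous_on {0..2*pi} (\<lambda>\<theta>. 0 + of_real \<rho> * cis \<theta>)" by (intro continuous_intros)
      show "(\<lambda>\<theta>. 0 + of_real \<rho> * cis \<theta>) ` {0..2*pi} \<subseteq> W"
        using WB \<rho> by (auto simp: norm_mult intro!: subsetD[OF WB])
    qed
  qed
  ultimately have "integral {0..2*pi} (\<lambda>\<theta>. h (0 + of_real \<rho> * cis \<theta>)) \<le> 2 * pi * (V (\<zeta>0, e0) + C1) + 0"
    by (meson has_integral_le integrable_integral ub)
  then have "1 / (2 * pi) * integral {0..2*pi} (\<lambda>\<theta>. h (0 + of_real \<rho> * cis \<theta>)) 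
      \<le> 1 / (2 * pi) * (2 * pi * (V (\<zeta>0, e0) + C1) + 0)" by (rule mult_left_mono) simp
  also have "\<dots> = V (\<zeta>0, e0) + C1" by simp
  finally have "h 0 \<le> V (\<zeta>0, e0) + C1" using h0 by linarith
  moreover have "h 0 = V (\<zeta>0, e0) - \<epsilon> * (cmod \<zeta>0)\<^sup>2 + K * (cnorm n e0)\<^sup>2"
  proof -
    have "e \<zeta>0 = e0" using e0(1) by (intro cspace_eqI) (auto simp: e_def R_def)
    then show ?thesis unfolding h_def aff by (simp add: V_def)
  qed
  ultimately have "\<epsilon> * \<rho>\<^sup>2 \<le> K * n * q\<^sup>2 * \<rho>\<^sup>2" unfolding C1_def by linarith
  then show False using q(2) \<rho> by (simp add: mult_le_cancel_right)
qed

text \<open>The disc is blown up from the origin. The set \<open>S\<close> of factors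
  \<open>r\<close> whose whole scaled disc lies in \<open>\<Omega>\<close> contains 0; it is
  relatively open because the disc is compact, and closed because the maximum principle holds these
  discs in one compact sublevel set of the exhaustion function. Thus \<open>S\<close> is the whole
  unit interval. The factor 1 in the conclusion restricts the value to \<open>cspace n\<close>,
  since \<open>\<phi>\<close> may take arbitrary values outside \<open>{..<n}\<close>.\<close>

lemma disc_continuity_principle:
  assumes pc: "pseudoconvex n \<Omega>" and z0: "czero n \<in> \<Omega>"
    and U: "open U" "bounded U"
    and cont: "\<And>i. i < n \<Longrightarrow> continuous_on (closure U) (\<lambda>\<zeta>. \<phi> \<zeta> i)"
    and hol: "\<And>i. i < n \<Longrightarrow> (\<lambda>\<zeta>. \<phi> \<zeta> i) holomorphic_on U"
    and bd: "\<And>\<zeta> r. \<zeta> \<in> frontier U \<Longrightarrow> 0 \<le> r \<Longrightarrow> r \<le> 1 \<Longrightarrow> cscale n (of_real r) (\<phi> \<zeta>) \<in> \<Omega>"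
    and \<zeta>1: "\<zeta>1 \<in> closure U"
  shows "cscale n 1 (\<phi> \<zeta>1) \<in> \<Omega>"
proof -
  obtain u where psh: "cont_plurisubharmonic_on n \<Omega> u" and exh: "\<And>c. compactin (ctop n) {z\<in>\<Omega>. u z \<le> c}"
    and \<Omega>: "openin (ctop n) \<Omega>"
    using pc unfolding pseudoconvex_def by blast
  have \<Omega>s: "\<Omega> \<subseteq> cspace n" using openin_ctop_subset[OF \<Omega>] .
  have ucont: "continuous_on \<Omega> u"
    using psh continuous_map_ctop_iff[OF \<Omega>s] unfolding cont_plurisubharmonic_on_def by blast
  obtain B where B: "open B" "\<Omega> = cspace n \<inter> B"
    using \<Omega> unfolding ctop_eq openin_open by blast
  have ccl: "compact (closure U)" using U by simp
  define X where "X = {0..1::real} \<times> closure U"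
  define g where "g = (\<lambda>p. cscale n (of_real (fst p)) (\<phi> (snd p)))"
  have gc: "continuous_on X g"
  proof (rule continuous_on_into_cspace)
    fix i assume "i < n"
    have "continuous_on X (\<lambda>p. \<phi> (snd p) i)" unfolding X_def
      by (rule continuous_on_compose2[OF cont[OF \<open>i < n\<close>] continuous_on_snd[OF continuous_on_id]]) auto
    then show "continuous_on X (\<lambda>p. g p i)"
      unfolding g_def cscale_def using \<open>i < n\<close> by (auto intro!: continuous_intros)
  qed (simp add: g_def)
  have X: "compact X" unfolding X_def by (intro compact_Times ccl compact_Icc)
  define F where "F = {0..1::real} \<times> frontier U"
  have FX: "F \<subseteq> X" unfolding F_def X_def by (auto simp: frontier_def)
  have F: "compact F" unfolding F_def using U by (intro compact_Times compact_Icc compact_frontier_bounded)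
  have gF: "g ` F \<subseteq> \<Omega>" using bd unfolding F_def g_def by auto
  have "compact ((\<lambda>p. u (g p)) ` F)"
    by (intro compact_continuous_image F continuous_on_compose2[OF ucont continuous_on_subset[OF gc FX]] gF)
  then obtain M where M: "\<And>p. p \<in> F \<Longrightarrow> u (g p) \<le> M"
    using compact_imp_bounded bounded_real by (metis abs_le_D1 imageI)
  define L where "L = {z\<in>\<Omega>. u z \<le> M}"
  have L: "closed L" using exh[of M] unfolding L_def compactin_ctop by (simp add: compact_imp_closed)
  define S where "S = {r\<in>{0..1}. \<forall>\<zeta>\<in>closure U. g (r, \<zeta>) \<in> \<Omega>}"
  have SL: "g (r, \<zeta>) \<in> L" if r: "r \<in> S" and \<zeta>: "\<zeta> \<in> closure U" for r \<zeta>
  proof (cases "\<zeta> \<in> frontier U")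
    case True
    then show ?thesis using r M[of "(r, \<zeta>)"] \<zeta> unfolding S_def L_def F_def by auto
  next
    case False
    then have "\<zeta> \<in> U" using \<zeta> U by (simp add: frontier_def interior_open)
    have r1: "0 \<le> r" "r \<le> 1" using r by (auto simp: S_def)
    have "u (g (r, \<zeta>)) \<le> M"
    proof (rule psh_max_principle[OF psh \<Omega> U, where \<phi>="\<lambda>\<zeta>. g (r, \<zeta>)"])
      show "g (r, \<zeta>) \<in> \<Omega>" if "\<zeta> \<in> closure U" for \<zeta> using r that by (simp add: S_def)
      show "continuous_on (closure U) (\<lambda>\<zeta>. g (r, \<zeta>) i)" if "i < n" for i
        unfolding g_def cscale_def using cont[OF that] that by (auto intro!: continuous_intros)
      show "(\<lambda>\<zeta>. g (r, \<zeta>) i) holomorphic_on U" if "i < n" for i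
        unfolding g_def cscale_def using hol[OF that] that by (auto intro!: holomorphic_intros)
      show "u (g (r, \<zeta>)) \<le> M" if "\<zeta> \<in> frontier U" for \<zeta>
        using M[of "(r, \<zeta>)"] that r1 by (simp add: F_def)
    qed (rule \<open>\<zeta> \<in> U\<close>)
    then show ?thesis using r \<zeta> by (simp add: S_def L_def)
  qed
  \<comment> \<open>With the closed set \<open>L\<close> in place of the open set
    \<open>\<Omega>\<close>, \<open>S\<close> becomes an intersection of closed sets.\<close>
  have "S = {0..1} \<inter> (\<Inter>\<zeta>\<in>closure U. {0..1} \<inter> (\<lambda>r. g (r, \<zeta>)) -` L)"
    using SL by (auto simp: S_def L_def)
  moreover have "closed ({0..1} \<inter> (\<lambda>r. g (r, \<zeta>)) -` L)" if "\<zeta> \<in> closure U" for \<zeta>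
  proof (rule continuous_closed_preimage[OF _ closed_atLeastAtMost L])
    show "continuous_on {0..1} (\<lambda>r. g (r, \<zeta>))"
      by (rule continuous_on_compose2[OF gc]) (use that in \<open>auto simp: X_def intro!: continuous_intros\<close>)
  qed
  ultimately have Sc: "closed S" by (metis (no_types, lifting) closed_INT closed_Int closed_atLeastAtMost)
  \<comment> \<open>The complement of \<open>S\<close> in the unit interval, written as the
    projection of a compact set so that it is closed.\<close>
  define C where "C = fst ` (X \<inter> g -` (- B))"
  have "closed (X \<inter> g -` (- B))"
    using X B by (intro continuous_closed_preimage[OF gc]) (auto intro: compact_imp_closed)
  then have "compact (X \<inter> g -` (- B))" using X compact_Int_closed[of X "X \<inter> g -` (- B)"] by (simp add: Int_absorb1)
  then have "compact C" unfolding C_def by (intro compact_continuous_image continuous_on_fst continuous_on_id)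
  then have Cc: "closed C" by (rule compact_imp_closed)
  have gS: "g p \<in> cspace n" for p by (simp add: g_def)
  have CS: "r \<in> C \<longleftrightarrow> r \<in> {0..1} \<and> r \<notin> S" for r
  proof
    assume "r \<in> C"
    then obtain p where "p \<in> X" "g p \<notin> B" "r = fst p" unfolding C_def by blast
    then show "r \<in> {0..1} \<and> r \<notin> S" using B(2) by (cases p) (auto simp: X_def S_def)
  next
    assume "r \<in> {0..1} \<and> r \<notin> S"
    then obtain \<zeta> where "\<zeta> \<in> closure U" "g (r, \<zeta>) \<notin> \<Omega>" "r \<in> {0..1}" unfolding S_def by blast
    then have "(r, \<zeta>) \<in> X \<inter> g -` (- B)" using gS[of "(r, \<zeta>)"] unfolding B(2) X_def by auto
    then show "r \<in> C" unfolding C_def by force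
  qed
  have "g (0, \<zeta>) = czero n" for \<zeta> by (auto simp: g_def cscale_def czero_def)
  then have "0 \<in> S" using z0 by (simp add: S_def)
  have "1 \<in> S"
  proof (rule ccontr)
    assume "1 \<notin> S"
    then have "1 \<in> C" using CS by simp
    have "{0..1} \<subseteq> S \<union> C" "S \<inter> C \<inter> {0..1} = {}" using CS by blast+
    moreover have "S \<inter> {0..1} \<noteq> {}" using \<open>0 \<in> S\<close> by (intro ex_in_conv[THEN iffD1] exI[of _ 0]) simp
    moreover have "C \<inter> {0..1} \<noteq> {}" using \<open>1 \<in> C\<close> by (intro ex_in_conv[THEN iffD1] exI[of _ 1]) simp
    ultimately have "\<not> connected {0..1::real}"
      unfolding connected_closed using Sc Cc by metis
    then show False by simp
  qed
  then show ?thesis using \<zeta>1 unfolding S_def g_def by force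
qed

section \<open>Families of ellipsoids\<close>

text \<open>The argument is read only below \<open>n\<close>, so unrestricted functions can be
  inserted without being cut down to \<open>cspace n\<close>.\<close>

definition mv :: "nat \<Rightarrow> (nat \<Rightarrow> nat \<Rightarrow> complex) \<Rightarrow> (nat \<Rightarrow> complex) \<Rightarrow> nat \<Rightarrow> complex" where
  "mv n M z = (\<lambda>i\<in>{..<n}. \<Sum>j<n. M i j * z j)"

lemma mv_cspace [simp]: "mv n M z \<in> cspace n"
  by (simp add: mv_def)

lemma mv_cong: "(\<And>j. j < n \<Longrightarrow> z j = w j) \<Longrightarrow> mv n M z = mv n M w"
  unfolding mv_def by (rule restrict_ext) simp

lemma continuous_on_mv: "continuous_on S (mv n M)"
proof (rule continuous_on_into_cspace)
  show "continuous_on S (\<lambda>z. mv n M z i)" if "i < n" for i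
    using that unfolding mv_def
    by (simp, intro continuous_on_sum continuous_on_mult continuous_on_const
        continuous_on_subset[OF continuous_on_product_coordinates subset_UNIV])
qed simp

lemma cscale_mv: "cscale n c (mv n M z) = mv n M (\<lambda>j. c * z j)"
  unfolding cscale_def mv_def by (rule restrict_ext) (simp add: sum_distrib_left mult_ac)

lemma cnorm_mono: "(\<And>i. i < n \<Longrightarrow> cmod (v i) \<le> cmod (w i)) \<Longrightarrow> cnorm n v \<le> cnorm n w"
  unfolding cnorm_def by (rule L2_set_mono) auto

lemma cnorm_scale: "cnorm n (\<lambda>i. c * v i) = cmod c * cnorm n v"
  unfolding cnorm_def by (simp add: norm_mult L2_set_right_distrib)

text \<open>A three-lines argument. The factor \<open>exp (\<epsilon> * (\<xi>\<^sup>2 - 1))\<close>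
  has modulus at most 1 on the strip and decays with \<open>Im \<xi>\<close>, so the strip can be
  cut to a rectangle. The left side is covered by \<open>E0\<close>, the right side by
  \<open>E1\<close> because imaginary powers are unitary, and the horizontal sides by
  \<open>E0\<close> because the damping outweighs the growth of the exponentials. The vector
  \<open>w'\<close> undoes the damping at the point \<open>\<zeta>\<close>.\<close>

lemma ellipsoid_interpolation:
  assumes pc: "pseudoconvex n \<Omega>" and z0: "czero n \<in> \<Omega>"
    and E0: "\<And>w. cnorm n w < 1 \<Longrightarrow> mv n M w \<in> \<Omega>"
    and E1: "\<And>w. cnorm n w < 1 \<Longrightarrow> mv n M (\<lambda>j. exp (of_real (\<mu> j)) * w j) \<in> \<Omega>"
    and \<zeta>: "0 \<le> Re \<zeta>" "Re \<zeta> \<le> 1" and w: "cnorm n w < 1"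
  shows "mv n M (\<lambda>j. exp (\<zeta> * of_real (\<mu> j)) * w j) \<in> \<Omega>"
proof -
  define s where "s = cnorm n w"
  have s: "0 \<le> s" "s < 1" using w by (auto simp: s_def)
  define q where "q = \<bar>Re (\<zeta>\<^sup>2 - 1)\<bar> + 1"
  \<comment> \<open>So small that undoing the damping enlarges \<open>w\<close> by at most
    \<open>2 / (1 + s)\<close>; then \<open>w'\<close> has norm at most
    \<open>2 * s / (1 + s) < 1\<close>.\<close>
  define \<epsilon> where "\<epsilon> = ln (2 / (1 + s)) / q"
  have q: "q > 0" by (simp add: q_def)
  have l: "ln (2 / (1 + s)) > 0" using s by (intro ln_gt_zero) (simp add: field_simps)
  then have \<epsilon>: "\<epsilon> > 0" using q by (simp add: \<epsilon>_def)
  define w' where "w' = (\<lambda>j. exp (- (of_real \<epsilon> * (\<zeta>\<^sup>2 - 1))) * w j)"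
  have w': "cnorm n w' < 1"
  proof -
    have "Re (- (of_real \<epsilon> * (\<zeta>\<^sup>2 - 1))) = \<epsilon> * (- Re (\<zeta>\<^sup>2 - 1))" by (simp add: algebra_simps)
    also have "\<dots> \<le> \<epsilon> * q" using \<epsilon> by (intro mult_left_mono) (auto simp: q_def)
    also have "\<dots> = ln (2 / (1 + s))" using q by (simp add: \<epsilon>_def)
    finally have "exp (Re (- (of_real \<epsilon> * (\<zeta>\<^sup>2 - 1)))) \<le> exp (ln (2 / (1 + s)))" by (simp only: exp_le_cancel_iff)
    then have "exp (Re (- (of_real \<epsilon> * (\<zeta>\<^sup>2 - 1)))) \<le> 2 / (1 + s)" using s by simp
    then have "cnorm n w' \<le> 2 / (1 + s) * s"
      unfolding w'_def cnorm_scale norm_exp_eq_Re s_def[symmetric] by (rule mult_right_mono) (rule s)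
    also have "\<dots> < 1" using s by (simp add: field_simps)
    finally show ?thesis .
  qed
  define m where "m = (\<Sum>j<n. \<bar>\<mu> j\<bar>)"
  have m: "0 \<le> m" "\<And>j. j < n \<Longrightarrow> \<bar>\<mu> j\<bar> \<le> m" unfolding m_def by (auto intro: sum_nonneg member_le_sum)
  \<comment> \<open>High enough to enclose \<open>\<zeta>\<close> and to give
    \<open>\<epsilon> * Y\<^sup>2 \<ge> m\<close>, so that the damping on the horizontal sides beats
    every factor \<open>exp (Re \<xi> * \<mu> j)\<close>.\<close>
  define Y where "Y = \<bar>Im \<zeta>\<bar> + 1 + m / \<epsilon>"
  have Y1: "Y \<ge> 1" "Y \<ge> m / \<epsilon>" "Y > \<bar>Im \<zeta>\<bar>" using m \<epsilon> by (auto simp: Y_def add_pos_nonneg)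
  have Y: "\<epsilon> * Y\<^sup>2 \<ge> m"
  proof -
    have "m / \<epsilon> \<le> Y * 1" using Y1 by simp
    also have "\<dots> \<le> Y * Y" using Y1 by (intro mult_left_mono) auto
    finally show ?thesis using \<epsilon> by (simp add: field_simps power2_eq_square)
  qed
  define U where "U = box (Complex 0 (- Y)) (Complex 1 Y)"
  have cl: "closure U = cbox (Complex 0 (- Y)) (Complex 1 Y)"
    unfolding U_def
  proof (rule closure_box)
    have "Complex (1/2) 0 \<in> box (Complex 0 (- Y)) (Complex 1 Y)" using Y1 by (simp add: in_box_complex_iff)
    then show "box (Complex 0 (- Y)) (Complex 1 Y) \<noteq> {}" by blast
  qed
  have U: "open U" "bounded U" by (auto simp: U_def open_box bounded_box)
  define \<phi> where "\<phi> = (\<lambda>\<xi>. mv n M (\<lambda>j. exp (of_real \<epsilon> * (\<xi>\<^sup>2 - 1)) * (exp (\<xi> * of_real (\<mu> j)) * w' j)))"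
  have "cscale n 1 (\<phi> \<zeta>) \<in> \<Omega>"
  proof (rule disc_continuity_principle[OF pc z0 U])
    show "continuous_on (closure U) (\<lambda>\<xi>. \<phi> \<xi> i)" if "i < n" for i
      using that unfolding \<phi>_def mv_def by (auto intro!: continuous_intros)
    show "(\<lambda>\<xi>. \<phi> \<xi> i) holomorphic_on U" if "i < n" for i
      using that unfolding \<phi>_def mv_def by (auto intro!: holomorphic_intros)
    show "\<zeta> \<in> closure U" using \<zeta> Y1 unfolding cl by (auto simp: in_cbox_complex_iff)
  next
    fix \<xi> :: complex and r :: real assume \<xi>: "\<xi> \<in> frontier U" and r: "0 \<le> r" "r \<le> 1"
    define v where "v = (\<lambda>j. of_real r * (exp (of_real \<epsilon> * (\<xi>\<^sup>2 - 1)) * (exp (\<xi> * of_real (\<mu> j)) * w' j)))"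
    have eq: "cscale n (of_real r) (\<phi> \<xi>) = mv n M v" by (simp add: \<phi>_def cscale_mv v_def)
    have "\<xi> \<in> closure U" "\<xi> \<notin> U" using \<xi> U by (auto simp: frontier_def interior_open)
    then have b: "0 \<le> Re \<xi>" "Re \<xi> \<le> 1" "- Y \<le> Im \<xi>" "Im \<xi> \<le> Y" and
      c: "\<bar>Im \<xi>\<bar> = Y \<or> Re \<xi> = 0 \<or> Re \<xi> = 1"
      unfolding cl by (auto simp: U_def in_cbox_complex_iff in_box_complex_iff)
    have nv: "cmod (v j) = r * (exp (\<epsilon> * ((Re \<xi>)\<^sup>2 - (Im \<xi>)\<^sup>2 - 1) + Re \<xi> * \<mu> j) * cmod (w' j))" for j
      unfolding v_def norm_mult norm_exp_eq_Re exp_add using r by (simp add: power2_eq_square mult_ac)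
    have x2: "(Re \<xi>)\<^sup>2 \<le> 1" using b by (simp add: power_le_one)
    have le1: "r * (exp a * b) \<le> b" if "a \<le> 0" "0 \<le> b" for a b
    proof -
      have "r * exp a \<le> 1 * 1" using that r by (intro mult_mono) auto
      from mult_right_mono[OF this that(2)] show ?thesis by (simp add: mult_ac)
    qed
    show "cscale n (of_real r) (\<phi> \<xi>) \<in> \<Omega>"
    proof (cases "\<bar>Im \<xi>\<bar> = Y \<or> Re \<xi> = 0")
      case True
      have "cnorm n v \<le> cnorm n w'"
      proof (rule cnorm_mono)
        fix j assume j: "j < n"
        have "\<epsilon> * ((Re \<xi>)\<^sup>2 - (Im \<xi>)\<^sup>2 - 1) + Re \<xi> * \<mu> j \<le> 0"
          using True
        proof
          assume "\<bar>Im \<xi>\<bar> = Y"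
          then have "(Im \<xi>)\<^sup>2 = Y\<^sup>2" by (metis power2_abs)
          then have "\<epsilon> * ((Re \<xi>)\<^sup>2 - (Im \<xi>)\<^sup>2 - 1) \<le> \<epsilon> * (- Y\<^sup>2)" using x2 \<epsilon> by (intro mult_left_mono) auto
          moreover have "Re \<xi> * \<mu> j \<le> Re \<xi> * \<bar>\<mu> j\<bar>" using b by (intro mult_left_mono) auto
          moreover have "Re \<xi> * \<bar>\<mu> j\<bar> \<le> 1 * \<bar>\<mu> j\<bar>" using b by (intro mult_right_mono) auto
          ultimately show ?thesis using Y m(2)[OF j] by simp
        next
          assume "Re \<xi> = 0"
          moreover have "- (Im \<xi>)\<^sup>2 - 1 \<le> 0" using zero_le_power2[of "Im \<xi>"] by linarith
          ultimately show ?thesis using \<epsilon> by (simp add: mult_nonneg_nonpos)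
        qed
        then show "cmod (v j) \<le> cmod (w' j)" unfolding nv by (rule le1) simp
      qed
      then show ?thesis unfolding eq using w' by (intro E0) simp
    next
      case False
      then have "Re \<xi> = 1" using c by simp
      \<comment> \<open>On this side the imaginary part of the exponent only rotates coordinates,
        which the ball absorbs; what remains is the fixed factor
        \<open>exp (\<mu> j)\<close>.\<close>
      define v' where "v' = (\<lambda>j. of_real r * (exp (of_real \<epsilon> * (\<xi>\<^sup>2 - 1)) * (exp (\<i> * of_real (Im \<xi> * \<mu> j)) * w' j)))"
      have \<xi>eq: "\<xi> = 1 + \<i> * of_real (Im \<xi>)" using \<open>Re \<xi> = 1\<close> by (simp add: complex_eq_iff)
      have "exp (\<xi> * of_real (\<mu> j)) = exp (of_real (\<mu> j)) * exp (\<i> * of_real (Im \<xi> * \<mu> j))" for j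
        unfolding exp_add[symmetric] by (subst \<xi>eq) (simp add: algebra_simps)
      then have "v = (\<lambda>j. exp (of_real (\<mu> j)) * v' j)" by (simp add: v_def v'_def mult_ac)
      moreover have "cnorm n v' \<le> cnorm n w'"
      proof (rule cnorm_mono)
        fix j assume j: "j < n"
        have "cmod (v' j) = r * (exp (\<epsilon> * (- (Im \<xi>)\<^sup>2)) * cmod (w' j))"
          unfolding v'_def norm_mult norm_exp_eq_Re using r \<open>Re \<xi> = 1\<close> by (simp add: power2_eq_square)
        also have "\<dots> \<le> cmod (w' j)" using \<epsilon> by (intro le1) (auto simp: mult_nonneg_nonpos)
        finally show "cmod (v' j) \<le> cmod (w' j)" .
      qed
      ultimately show ?thesis unfolding eq using E1[of v'] w' by simp
    qed
  qed
  also have "cscale n 1 (\<phi> \<zeta>) = mv n M (\<lambda>j. exp (\<zeta> * of_real (\<mu> j)) * w j)"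
    unfolding \<phi>_def cscale_mv by (rule mv_cong) (simp add: w'_def exp_minus)
  finally show ?thesis .
qed

text \<open>If some point \<open>\<zeta>1\<close> of the disc is mapped into \<open>\<Omega>\<close>, multiply the disc by \<open>exp h\<close>, where \<open>Re h\<close> is
  a small Poisson-type kernel normalised to vanish at the centre: it is negative on the circle
  through \<open>\<zeta>1\<close> except near \<open>\<zeta>1\<close>, so the boundary of the new disc lies in \<open>\<Omega>\<close>.\<close>

lemma ellipsoid_touching:
  assumes pc: "pseudoconvex n \<Omega>" and z0: "czero n \<in> \<Omega>"
    and E: "\<And>\<zeta> w. 0 \<le> Re \<zeta> \<Longrightarrow> Re \<zeta> \<le> 1 \<Longrightarrow> cnorm n w < 1 \<Longrightarrow>
      mv n M (\<lambda>j. exp (\<zeta> * of_real (\<mu> j)) * w j) \<in> \<Omega>"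
    and N: "\<And>z. z \<in> cspace n \<Longrightarrow> mv n N (mv n M z) = z"
    and w: "cnorm n w = 1" and k: "k < n" "w k \<noteq> 0" "\<mu> k \<noteq> 0"
    and nodisc: "\<not> (\<exists>D. holomorphic_disc n D \<and> D \<subseteq> ctop n frontier_of \<Omega>)"
  shows "mv n M (\<lambda>j. exp (1/2 * of_real (\<mu> j)) * w j) \<in> \<Omega>"
proof (rule ccontr)
  define f where "f = (\<lambda>\<zeta>. mv n M (\<lambda>j. exp (\<zeta> * of_real (\<mu> j)) * w j))"
  assume "mv n M (\<lambda>j. exp (1/2 * of_real (\<mu> j)) * w j) \<notin> \<Omega>"
  then have f0: "f (1/2) \<notin> \<Omega>" by (simp add: f_def)
  have \<Omega>: "openin (ctop n) \<Omega>" using pc by (simp add: pseudoconvex_def)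
  obtain B where B: "open B" "\<Omega> = cspace n \<inter> B"
    using \<Omega> unfolding ctop_eq openin_open by blast
  have fc: "f \<zeta> \<in> cspace n" for \<zeta> by (simp add: f_def)
  \<comment> \<open>The open ellipsoids are balanced, so a complex factor of modulus below 1 moves
    the limiting disc into \<open>\<Omega>\<close>.\<close>
  have small: "cscale n c (f \<zeta>) \<in> \<Omega>" if "cmod c < 1" "0 \<le> Re \<zeta>" "Re \<zeta> \<le> 1" for c \<zeta>
  proof -
    have "cscale n c (f \<zeta>) = mv n M (\<lambda>j. exp (\<zeta> * of_real (\<mu> j)) * (c * w j))"
      unfolding f_def cscale_mv by (rule mv_cong) simp
    moreover have "cnorm n (\<lambda>j. c * w j) < 1" using that w by (simp add: cnorm_scale)
    ultimately show ?thesis using E[OF that(2,3)] by simp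
  qed
  have fcont: "continuous_on S (\<lambda>\<zeta>. f \<zeta> i)" if "i < n" for S i
    using that unfolding f_def mv_def by (auto intro!: continuous_intros)
  have fhol: "(\<lambda>\<zeta>. f \<zeta> i) holomorphic_on S" if "i < n" for S i
    using that unfolding f_def mv_def by (auto intro!: holomorphic_intros)
  have strip: "0 \<le> Re \<zeta> \<and> Re \<zeta> \<le> 1" if "cmod (\<zeta> - 1/2) \<le> 1/2" for \<zeta>
    using abs_Re_le_cmod[of "\<zeta> - 1/2"] that by auto
  have out: "f \<zeta>1 \<notin> \<Omega>" if \<zeta>1: "\<zeta>1 \<in> ball (1/2) (1/2)" for \<zeta>1
  proof
    assume f1: "f \<zeta>1 \<in> \<Omega>"
    define \<rho> where "\<rho> = cmod (\<zeta>1 - 1/2)"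
    have "\<zeta>1 \<noteq> 1/2" using f0 f1 by metis
    then have \<rho>: "0 < \<rho>" "\<rho> < 1/2" using \<zeta>1 by (auto simp: \<rho>_def dist_norm norm_minus_commute)
    define \<xi> where "\<xi> = (\<lambda>\<zeta>. (\<zeta> - 1/2) / (\<zeta>1 - 1/2))"
    define g where "g = (\<lambda>p. cscale n (fst p) (f (snd p)))"
    have "continuous_on UNIV g"
    proof (rule continuous_on_into_cspace)
      fix i assume "i < n"
      have "continuous_on UNIV (\<lambda>p::complex \<times> complex. f (snd p) i)"
        by (rule continuous_on_compose2[OF fcont[OF \<open>i < n\<close>, of UNIV] continuous_on_snd[OF continuous_on_id]]) auto
      then show "continuous_on UNIV (\<lambda>p. g p i)"
        unfolding g_def cscale_def using \<open>i < n\<close> by (auto intro!: continuous_intros)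
    qed (simp add: g_def)
    then have "open (g -` B)" using B(1) by (simp add: continuous_on_open_vimage)
    moreover have "(1, \<zeta>1) \<in> g -` B"
    proof -
      have "cscale n 1 (f \<zeta>1) = f \<zeta>1" unfolding f_def cscale_mv by simp
      then show ?thesis using f1 B by (simp add: g_def)
    qed
    ultimately obtain d where d: "d > 0" "ball (1, \<zeta>1) d \<subseteq> g -` B"
      unfolding open_contains_ball by blast
    have arc: "cscale n c (f \<zeta>) \<in> \<Omega>" if "cmod (c - 1) < d/2" "cmod (\<zeta> - \<zeta>1) < d/2" for c \<zeta>
    proof -
      have "dist (1, \<zeta>1) (c, \<zeta>) \<le> dist 1 c + dist \<zeta>1 \<zeta>"
        unfolding dist_prod_def by (simp add: sqrt_sum_squares_le_sum)
      then have "(c, \<zeta>) \<in> ball (1, \<zeta>1) d" using that by (simp add: dist_norm norm_minus_commute)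
      then have "g (c, \<zeta>) \<in> B" using d(2) by blast
      then show ?thesis unfolding B(2) g_def by simp
    qed
    define \<delta> where "\<delta> = min (d/2) 1"
    have \<delta>: "0 < \<delta>" "\<delta> \<le> 1" "\<delta> \<le> d/2" using d by (auto simp: \<delta>_def)
    \<comment> \<open>On the unit circle \<open>|\<xi> - 1|^2 = 2 * (1 - Re \<xi>)\<close>, so
      \<open>Re \<xi> \<ge> s\<close> forces
      \<open>|\<xi> - 1|^2 \<le> \<delta>^2 / 2\<close>.\<close>
    define s where "s = 1 - \<delta>\<^sup>2 / 4"
    have \<delta>2: "0 < \<delta>\<^sup>2" "\<delta>\<^sup>2 \<le> 1" using \<delta> by (auto simp: power_le_one)
    then have s: "0 < s" "s < 1" by (auto simp: s_def)
    have "isCont (exp :: complex \<Rightarrow> complex) 0" by simp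
    then obtain \<kappa> where \<kappa>: "\<kappa> > 0" "\<And>x. cmod x < \<kappa> \<Longrightarrow> cmod (exp x - 1) < \<delta>/2"
      unfolding continuous_at_eps_delta using \<delta>(1)
      by (metis (no_types, opaque_lifting) dist_norm diff_zero exp_zero half_gt_zero)
    \<comment> \<open>As \<open>|1 - s * \<xi>| \<ge> 1 - s\<close> on the circle, this gives
      \<open>|h| \<le> \<kappa> / 2\<close> there, and \<open>exp h\<close> stays within
      \<open>\<delta> / 2\<close> of 1.\<close>
    define \<epsilon> where "\<epsilon> = \<kappa> * (1 - s) / 2"
    have \<epsilon>: "\<epsilon> > 0" using \<kappa> s by (simp add: \<epsilon>_def)
    \<comment> \<open>For \<open>|\<xi>| = 1\<close> the real part is
      \<open>\<epsilon> * (Re \<xi> - s) / |1 - s * \<xi>|^2\<close>: nonnegative exactly on the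
      short arc around \<open>\<zeta>1\<close>.\<close>
    define h where "h = (\<lambda>\<zeta>. of_real \<epsilon> * \<xi> \<zeta> / (1 - of_real s * \<xi> \<zeta>))"
    have D: "cmod (1 - of_real s * x) \<ge> 1 - s" if "cmod x \<le> 1" for x
    proof -
      have "s * cmod x \<le> s" using s that by (simp add: mult_left_le)
      moreover have "cmod (1 - of_real s * x) \<ge> cmod 1 - cmod (of_real s * x)" by (rule norm_triangle_ineq2)
      moreover have "cmod (of_real s * x) = s * cmod x" using s by (simp add: norm_mult)
      ultimately show ?thesis by simp
    qed
    have \<xi>1: "cmod (\<xi> \<zeta>) = cmod (\<zeta> - 1/2) / \<rho>" for \<zeta> by (simp add: \<xi>_def norm_divide \<rho>_def)
    have D0: "1 - of_real s * \<xi> \<zeta> \<noteq> 0" if "\<zeta> \<in> cball (1/2) \<rho>" for \<zeta>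
    proof -
      have "cmod (\<xi> \<zeta>) \<le> 1" using that \<rho> by (simp add: \<xi>1 dist_norm norm_minus_commute)
      then show ?thesis using D[of "\<xi> \<zeta>"] s by auto
    qed
    define \<phi> where "\<phi> = (\<lambda>\<zeta>. cscale n (exp (h \<zeta>)) (f \<zeta>))"
    have clb: "closure (ball (1/2) \<rho>) = cball (1/2::complex) \<rho>" using \<rho> by simp
    have "cscale n 1 (\<phi> (1/2)) \<in> \<Omega>"
    proof (rule disc_continuity_principle[OF pc z0 open_ball bounded_ball])
      show "continuous_on (closure (ball (1/2) \<rho>)) (\<lambda>\<zeta>. \<phi> \<zeta> i)" if "i < n" for i
        using that D0 \<open>\<zeta>1 \<noteq> 1/2\<close> unfolding clb \<phi>_def cscale_def h_def \<xi>_def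
        by (auto intro!: continuous_intros fcont)
      show "(\<lambda>\<zeta>. \<phi> \<zeta> i) holomorphic_on ball (1/2) \<rho>" if "i < n" for i
        using that D0 \<open>\<zeta>1 \<noteq> 1/2\<close> unfolding \<phi>_def cscale_def h_def \<xi>_def
        by (auto intro!: holomorphic_intros fhol)
      show "1/2 \<in> closure (ball (1/2::complex) \<rho>)" using \<rho> unfolding clb by simp
    next
      fix \<zeta> :: complex and r :: real assume \<zeta>: "\<zeta> \<in> frontier (ball (1/2) \<rho>)" and r: "0 \<le> r" "r \<le> 1"
      have z\<rho>: "cmod (\<zeta> - 1/2) = \<rho>" using \<zeta> \<rho> by (simp add: dist_norm norm_minus_commute)
      then have x1: "cmod (\<xi> \<zeta>) = 1" using \<rho> by (simp add: \<xi>1)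
      have st: "0 \<le> Re \<zeta>" "Re \<zeta> \<le> 1" using strip[of \<zeta>] z\<rho> \<rho> by auto
      have eq: "cscale n (of_real r) (\<phi> \<zeta>) = cscale n (of_real r * exp (h \<zeta>)) (f \<zeta>)"
        unfolding \<phi>_def f_def cscale_mv by (rule mv_cong) simp
      show "cscale n (of_real r) (\<phi> \<zeta>) \<in> \<Omega>"
      proof (cases "cmod (of_real r * exp (h \<zeta>)) < 1")
        case True
        then show ?thesis unfolding eq by (intro small st)
      next
        case False
        have rm: "cmod (of_real r * exp (h \<zeta>)) = r * cmod (exp (h \<zeta>))" using r by (simp add: norm_mult)
        have ge: "1 \<le> r * cmod (exp (h \<zeta>))" using False unfolding rm by simp
        also have "\<dots> \<le> 1 * cmod (exp (h \<zeta>))" using r by (intro mult_right_mono) auto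
        finally have e1: "1 \<le> cmod (exp (h \<zeta>))" by simp
        then have "0 \<le> Re (h \<zeta>)" by (simp add: norm_exp_eq_Re)
        have Dpos: "cmod (1 - of_real s * \<xi> \<zeta>) > 0" using D[OF order_eq_refl[OF x1]] s by linarith
        have Rr: "Re (of_real a * z) = a * Re z" for a z by simp
        have "Re (h \<zeta>) = \<epsilon> * (Re (\<xi> \<zeta>) - s) / (cmod (1 - of_real s * \<xi> \<zeta>))\<^sup>2"
        proof -
          have "h \<zeta> = of_real \<epsilon> * (\<xi> \<zeta> * cnj (1 - of_real s * \<xi> \<zeta>)) / of_real ((cmod (1 - of_real s * \<xi> \<zeta>))\<^sup>2)"
            unfolding h_def by (subst complex_div_cnj) (simp add: mult_ac)
          then have "Re (h \<zeta>) = \<epsilon> * Re (\<xi> \<zeta> * cnj (1 - of_real s * \<xi> \<zeta>)) / (cmod (1 - of_real s * \<xi> \<zeta>))\<^sup>2"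
            by (simp only: Re_divide_of_real Rr)
          moreover have eq2: "\<xi> \<zeta> * cnj (1 - of_real s * \<xi> \<zeta>) = \<xi> \<zeta> - of_real s * of_real ((cmod (\<xi> \<zeta>))\<^sup>2)"
            by (subst complex_norm_square) (simp add: algebra_simps)
          moreover have "Re (\<xi> \<zeta> * cnj (1 - of_real s * \<xi> \<zeta>)) = Re (\<xi> \<zeta>) - s"
            unfolding eq2 x1 by simp
          ultimately show ?thesis by (simp only:)
        qed
        with \<open>0 \<le> Re (h \<zeta>)\<close> have "0 \<le> \<epsilon> * (Re (\<xi> \<zeta>) - s)" using Dpos by (simp add: zero_le_divide_iff)
        then have "s \<le> Re (\<xi> \<zeta>)" using \<epsilon> by (simp add: zero_le_mult_iff)
        have "(cmod (\<xi> \<zeta> - 1))\<^sup>2 = (cmod (\<xi> \<zeta>))\<^sup>2 - 2 * Re (\<xi> \<zeta>) + 1"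
          unfolding cmod_power2 by (simp add: power2_eq_square algebra_simps)
        also have "\<dots> \<le> \<delta>\<^sup>2 / 2" using x1 \<open>s \<le> Re (\<xi> \<zeta>)\<close> by (simp add: s_def)
        also have "\<dots> < \<delta>\<^sup>2" using \<delta>2 by simp
        finally have xd: "cmod (\<xi> \<zeta> - 1) < \<delta>" using \<delta> by (simp add: power2_less_imp_less)
        have "\<zeta> - \<zeta>1 = (\<zeta>1 - 1/2) * (\<xi> \<zeta> - 1)" using \<open>\<zeta>1 \<noteq> 1/2\<close> by (simp add: \<xi>_def field_simps)
        then have "cmod (\<zeta> - \<zeta>1) = \<rho> * cmod (\<xi> \<zeta> - 1)" by (simp add: norm_mult \<rho>_def)
        also have "\<dots> \<le> 1 * cmod (\<xi> \<zeta> - 1)" using \<rho> by (intro mult_right_mono) auto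
        finally have c2: "cmod (\<zeta> - \<zeta>1) < d/2" using xd \<delta> by simp
        have "cmod (h \<zeta>) = \<epsilon> / cmod (1 - of_real s * \<xi> \<zeta>)"
          using \<epsilon> x1 by (simp add: h_def norm_divide norm_mult)
        also have "\<dots> \<le> \<epsilon> / (1 - s)" using D[OF order_eq_refl[OF x1]] Dpos s \<epsilon> by (intro divide_left_mono mult_pos_pos) auto
        also have "\<epsilon> / (1 - s) = (\<kappa> / 2) * (1 - s) / (1 - s)" by (simp add: \<epsilon>_def)
        also have "\<dots> = \<kappa> / 2" using s by (intro nonzero_mult_div_cancel_right) simp
        also have "\<dots> < \<kappa>" using \<kappa> by simp
        finally have ed: "cmod (exp (h \<zeta>) - 1) < \<delta>/2" by (rule \<kappa>(2))
        \<comment> \<open>As \<open>r * |exp h|\<close> is at least 1, the loss through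
          \<open>r\<close> is at most \<open>|exp h| - 1\<close>; so the total factor is within
          twice \<open>|exp h - 1|\<close> of 1.\<close>
        have "cmod (of_real r * exp (h \<zeta>) - exp (h \<zeta>)) = (1 - r) * cmod (exp (h \<zeta>))"
        proof -
          have "of_real r * exp (h \<zeta>) - exp (h \<zeta>) = - (of_real (1 - r) * exp (h \<zeta>))" by (simp add: algebra_simps)
          then show ?thesis using r by (simp only: norm_minus_cancel norm_mult norm_of_real)
        qed
        also have "\<dots> \<le> cmod (exp (h \<zeta>)) - 1" using ge by (simp add: algebra_simps)
        also have "\<dots> \<le> cmod (exp (h \<zeta>) - 1)" using norm_triangle_ineq2[of "exp (h \<zeta>)" 1] by simp
        finally have "cmod (of_real r * exp (h \<zeta>) - 1) \<le> cmod (exp (h \<zeta>) - 1) + cmod (exp (h \<zeta>) - 1)"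
          using norm_triangle_ineq[of "of_real r * exp (h \<zeta>) - exp (h \<zeta>)" "exp (h \<zeta>) - 1"] by simp
        then have c1: "cmod (of_real r * exp (h \<zeta>) - 1) < d/2" using ed \<delta> by simp
        show ?thesis unfolding eq by (rule arc[OF c1 c2])
      qed
    qed
    \<comment> \<open>\<open>h\<close> vanishes at the centre, so the modified disc still passes
      through \<open>f (1/2)\<close>, which would then lie in \<open>\<Omega>\<close>.\<close>
    moreover have "cscale n 1 (\<phi> (1/2)) = f (1/2)"
      unfolding \<phi>_def f_def cscale_mv by (rule mv_cong) (simp add: h_def \<xi>_def)
    ultimately show False using f0 by simp
  qed
  have "holomorphic_disc n (f ` ball (1/2) (1/2))"
    unfolding holomorphic_disc_def
  proof (intro exI[of _ "1/2::complex"] exI[of _ "1/2::real"] exI[of _ f] conjI allI impI refl)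
    show "f \<in> ball (1/2) (1/2) \<rightarrow> cspace n" using fc by blast
    show "(\<lambda>\<zeta>. f \<zeta> i) holomorphic_on ball (1/2) (1/2)" if "i < n" for i using fhol[OF that] .
    show "\<not> f constant_on ball (1/2) (1/2)"
    proof
      assume "f constant_on ball (1/2) (1/2)"
      moreover have "1/2 \<in> ball (1/2::complex) (1/2)" by simp
      moreover have "of_real (3/4) \<in> ball (1/2::complex) (1/2)"
      proof -
        have "dist (1/2::complex) (of_real (3/4)) = cmod (of_real (- 1/4))" unfolding dist_norm by (simp del: of_real_divide of_real_minus) (simp add: complex_eq_iff)
        then show ?thesis by (simp only: mem_ball norm_of_real)
      qed
      ultimately have "f (of_real (3/4)) = f (1/2)" unfolding constant_on_def by metis
      define y where "y = (\<lambda>\<zeta>. \<lambda>j\<in>{..<n}. exp (\<zeta> * of_real (\<mu> j)) * w j)"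
      have fy: "f \<zeta> = mv n M (y \<zeta>)" for \<zeta> unfolding f_def by (rule mv_cong) (simp add: y_def)
      have "y \<zeta> \<in> cspace n" for \<zeta> by (simp add: y_def)
      then have "y \<zeta> = mv n N (f \<zeta>)" for \<zeta> unfolding fy by (rule N[symmetric])
      then have "y (of_real (3/4)) = y (1/2)"
        by (simp only: \<open>f (of_real (3/4)) = f (1/2)\<close>)
      from fun_cong[OF this, of k] have "exp (of_real (3/4) * of_real (\<mu> k)) * w k = exp (1/2 * of_real (\<mu> k)) * w k"
        unfolding y_def restrict_apply'[of k "{..<n}", OF lessThan_iff[THEN iffD2, OF k(1)]] .
      then have "exp (of_real (3/4) * of_real (\<mu> k) :: complex) = exp (1/2 * of_real (\<mu> k))" using k(2) by simp
      \<comment> \<open>Moduli at two real points are compared because the complex exponential is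
        not injective.\<close>
      then have "cmod (exp (of_real (3/4) * of_real (\<mu> k))) = cmod (exp (1/2 * of_real (\<mu> k)))" by simp
      then have "3/4 * \<mu> k = 1/2 * \<mu> k" unfolding norm_exp_eq_Re by simp
      then show False using k(3) by simp
    qed
  qed simp_all
  moreover have "f ` ball (1/2) (1/2) \<subseteq> ctop n frontier_of \<Omega>"
  proof
    fix p assume "p \<in> f ` ball (1/2) (1/2)"
    then obtain \<zeta> where \<zeta>: "\<zeta> \<in> ball (1/2) (1/2)" and p: "p = f \<zeta>" by blast
    have "cmod (\<zeta> - 1/2) \<le> 1/2" using \<zeta> by (simp add: dist_norm norm_minus_commute)
    then have st: "0 \<le> Re \<zeta>" "Re \<zeta> \<le> 1" using strip by blast+
    have "p \<in> ctop n closure_of \<Omega>"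
      unfolding in_closure_of
    proof (intro conjI allI impI)
      show "p \<in> topspace (ctop n)" unfolding p using fc[of \<zeta>] by simp
    next
      fix T assume T: "p \<in> T \<and> openin (ctop n) T"
      obtain e where e: "e > 0" "\<And>v. v \<in> cspace n \<Longrightarrow> (\<And>i. i < n \<Longrightarrow> cmod (v i - p i) < e) \<Longrightarrow> v \<in> T"
        by (rule openin_cspace_ball[OF T[THEN conjunct2] T[THEN conjunct1]]) blast
      define m where "m = (\<Sum>i<n. cmod (p i))"
      have m: "0 \<le> m" "\<And>i. i < n \<Longrightarrow> cmod (p i) \<le> m" unfolding m_def by (auto intro: sum_nonneg member_le_sum)
      \<comment> \<open>Makes both \<open>x < 1\<close> and \<open>x * m < e\<close>: the point
        moves inward, but stays in the given neighbourhood.\<close>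
      define x where "x = e / (e + m + 1)"
      have x: "0 < x" "x < 1" using e(1) m(1) by (auto simp: x_def field_simps)
      have "x * m = e * (m / (e + m + 1))" by (simp add: x_def)
      also have "\<dots> < e * 1" using e(1) m(1) by (intro mult_strict_left_mono) (auto simp: field_simps)
      finally have xm: "x * m < e" by simp
      define v where "v = cscale n (of_real (1 - x)) p"
      have "v \<in> T"
      proof (rule e(2))
        fix i assume i: "i < n"
        have "v i - p i = - (of_real x * p i)" using i by (simp add: v_def cscale_def algebra_simps)
        then have "cmod (v i - p i) = x * cmod (p i)" using x by (simp add: norm_mult)
        also have "\<dots> \<le> x * m" using m(2)[OF i] x by simp
        finally show "cmod (v i - p i) < e" using xm by simp
      qed (simp add: v_def)
      moreover have "v \<in> \<Omega>"
      proof -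
        have "cmod (of_real (1 - x)) < 1" unfolding norm_of_real using x by simp
        then show ?thesis unfolding v_def p using st by (rule small)
      qed
      ultimately show "\<exists>y. y \<in> \<Omega> \<and> y \<in> T" by blast
    qed
    moreover have "p \<notin> ctop n interior_of \<Omega>" using out[OF \<zeta>] interior_of_subset p by fastforce
    ultimately show "p \<in> ctop n frontier_of \<Omega>" by (simp add: frontier_of_def)
  qed
  ultimately show False using nodisc by blast
qed

text \<open>The directions in \<open>N\<close> are stretched by \<open>1 + \<delta>\<close> and the
  others shrunk by \<open>1 - c * \<delta>\<close>. A point of the stretched ball whose norm is at
  least 1 must have a definite part in the directions \<open>N\<close>; its normalisation then lies
  in the compact set \<open>K\<close>, around whose image \<open>\<Omega>\<close> leaves uniform
  room, and its norm exceeds 1 by at most \<open>\<delta>\<close>. By Bernoulli's inequality the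
  determinant is at least \<open>(1 + \<delta>) * (1 - \<delta> / 2) > 1\<close>.\<close>

lemma stretched_ball_inside:
  assumes \<Omega>: "openin (ctop n) \<Omega>"
    and E: "\<And>w. cnorm n w < 1 \<Longrightarrow> mv n M w \<in> \<Omega>"
    and N: "N \<subseteq> {..<n}" "N \<noteq> {}"
    and T: "\<And>w k. cnorm n w = 1 \<Longrightarrow> k \<in> N \<Longrightarrow> w k \<noteq> 0 \<Longrightarrow> mv n M w \<in> \<Omega>"
  obtains a :: "nat \<Rightarrow> real" where "\<And>j. 0 < a j" "1 < (\<Prod>j<n. a j)"
    "\<And>w. cnorm n w < 1 \<Longrightarrow> mv n M (\<lambda>j. of_real (a j) * w j) \<in> \<Omega>"
proof -
  have n: "n > 0" using N by auto
  have finN: "finite N" using N finite_subset by blast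
  \<comment> \<open>Four times \<open>4 + 6 * n\<close>: the latter bounds the part in
    \<open>N\<close> before normalisation, and normalising divides by
    \<open>t\<^sup>2 \<le> 4\<close>.\<close>
  define c1 where "c1 = 1 / (16 + 24 * real n)"
  have c1: "c1 > 0" by (simp add: c1_def add_pos_nonneg)
  define K where "K = {w \<in> cspace n. cnorm n w = 1 \<and> c1 \<le> (\<Sum>j\<in>N. (cmod (w j))\<^sup>2)}"
  have K: "compact K"
  proof (rule cspace_bounded_closed_compact)
    show "K \<subseteq> cspace n" by (auto simp: K_def)
    have "K = cspace n \<inter> ({w. cnorm n w = 1} \<inter> {w. c1 \<le> (\<Sum>j\<in>N. (cmod (w j))\<^sup>2)})" by (auto simp: K_def)
    moreover have "closed {w. cnorm n w = 1}"
      by (intro closed_Collect_eq continuous_on_cnorm continuous_on_id continuous_on_const)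
    moreover have "closed {w::nat\<Rightarrow>complex. c1 \<le> (\<Sum>j\<in>N. (cmod (w j))\<^sup>2)}"
      by (intro closed_Collect_le continuous_on_const continuous_on_sum continuous_on_power continuous_on_norm
          continuous_on_product_coordinates)
    ultimately show "closed K" using closed_cspace by (metis closed_Int)
    show "cmod (z i) \<le> 1" if "z \<in> K" "i < n" for z i
      using component_le_cnorm[OF that(2), of z] that(1) by (simp add: K_def)
  qed
  have cK: "compact (mv n M ` K)" by (rule compact_continuous_image[OF continuous_on_mv K])
  have sK: "mv n M ` K \<subseteq> cspace n" using mv_cspace by blast
  obtain e where e: "e > 0" "\<And>z v. z \<in> mv n M ` K \<Longrightarrow> v \<in> cspace n \<Longrightarrow>
      (\<And>i. i < n \<Longrightarrow> cmod (v i - z i) < e) \<Longrightarrow> v \<in> \<Omega>"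
  proof (rule compact_uniform_nbhd[OF cK sK, of "\<lambda>z v. v \<in> \<Omega>"])
    fix z assume "z \<in> mv n M ` K"
    then obtain w where w: "w \<in> K" "z = mv n M w" by blast
    have "\<exists>k\<in>N. w k \<noteq> 0"
    proof (rule ccontr)
      assume "\<not> (\<exists>k\<in>N. w k \<noteq> 0)"
      then have "(\<Sum>j\<in>N. (cmod (w j))\<^sup>2) = 0" by (intro sum.neutral) auto
      then show False using w c1 by (simp add: K_def)
    qed
    then have "z \<in> \<Omega>" using T w by (auto simp: K_def)
    then obtain e where "e > 0" "\<And>v. v \<in> cspace n \<Longrightarrow> (\<And>i. i < n \<Longrightarrow> cmod (v i - z i) < e) \<Longrightarrow> v \<in> \<Omega>"
      by (rule openin_cspace_ball[OF \<Omega>]) blast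
    then show "\<exists>e>0. \<forall>v\<in>cspace n. \<forall>w\<in>cspace n. (\<forall>i<n. cmod (v i - z i) < e) \<longrightarrow>
        (\<forall>i<n. cmod (w i - z i) < e) \<longrightarrow> w \<in> \<Omega>" by blast
  qed blast
  define m where "m = (\<Sum>i<n. \<Sum>j<n. cmod (M i j))"
  have m0: "0 \<le> m" by (simp add: m_def sum_nonneg)
  have m: "cmod (mv n M w i) \<le> m" if "cnorm n w = 1" "i < n" for w i
  proof -
    have "cmod (mv n M w i) \<le> (\<Sum>j<n. cmod (M i j * w j))" using that by (simp add: mv_def norm_sum)
    also have "\<dots> \<le> (\<Sum>j<n. cmod (M i j))"
    proof (rule sum_mono)
      fix j assume "j \<in> {..<n}"
      then have "cmod (w j) \<le> 1" using component_le_cnorm[of j n w] that by simp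
      then show "cmod (M i j * w j) \<le> cmod (M i j)" by (simp add: norm_mult mult_left_le)
    qed
    also have "\<dots> \<le> m" unfolding m_def using that
      by (intro member_le_sum[of i "{..<n}" "\<lambda>i. \<Sum>j<n. cmod (M i j)"]) (auto intro: sum_nonneg)
    finally show ?thesis .
  qed
  define \<delta> where "\<delta> = min (1/2) (e / (m + 1) / 2)"
  have "e / (m + 1) / 2 > 0" using e m0 by (intro divide_pos_pos) auto
  then have \<delta>: "0 < \<delta>" "\<delta> \<le> 1/2" unfolding \<delta>_def by linarith+
  have \<delta>m: "\<delta> * m < e"
  proof -
    have "\<delta> \<le> e / (m + 1) / 2" by (simp add: \<delta>_def)
    then have "\<delta> * m \<le> e / (m + 1) / 2 * m" using m0 by (rule mult_right_mono)
    also have "\<dots> = e * (m / (m + 1)) / 2" by simp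
    also have "\<dots> \<le> e * 1 / 2" using e m0 by (intro divide_right_mono mult_left_mono) auto
    also have "\<dots> < e" using e by simp
    finally show ?thesis .
  qed
  \<comment> \<open>At most \<open>n - 1\<close> directions are shrunk, losing at most
    \<open>\<delta> / 2\<close> altogether to first order, against a gain of \<open>\<delta>\<close>
    in at least one direction.\<close>
  define c where "c = 1 / (2 * real n)"
  have c: "0 < c" "c \<le> 1/2" "c * n = 1/2" using n by (auto simp: c_def field_simps)
  define a where "a j = (if j \<in> N then 1 + \<delta> else 1 - c * \<delta>)" for j
  have cd: "0 < c * \<delta>" "c * \<delta> \<le> 1/4" using c \<delta> mult_mono[of c "1/2" \<delta> "1/2"] by auto
  have a: "0 < a j" for j using \<delta> cd by (auto simp: a_def)
  have a1: "a j \<le> 1 + \<delta>" for j using \<delta> cd by (auto simp: a_def)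
  have prod: "1 < (\<Prod>j<n. a j)"
  proof -
    obtain k where k: "k \<in> N" "k < n" using N by auto
    have "1 < (1 + \<delta>) * (1 - \<delta> / 2)" using \<delta> mult_strict_left_mono[of \<delta> 1 \<delta>] by (simp add: algebra_simps)
    also have "1 - \<delta> / 2 \<le> 1 + real (n - 1) * (- (c * \<delta>))"
    proof -
      have "real (n - 1) * (c * \<delta>) \<le> real n * (c * \<delta>)" using cd by (intro mult_right_mono) auto
      also have "\<dots> = \<delta> / 2" using c(3) by (metis mult.assoc mult.commute mult_1 times_divide_eq_left)
      finally show ?thesis by simp
    qed
    also have "\<dots> \<le> (1 + - (c * \<delta>)) ^ (n - 1)" using cd by (intro Bernoulli_inequality) auto
    also have "(1 + - (c * \<delta>)) ^ (n - 1) = (\<Prod>j\<in>{..<n} - {k}. 1 - c * \<delta>)" using k by simp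
    also have "\<dots> \<le> (\<Prod>j\<in>{..<n} - {k}. a j)"
      using cd \<delta> by (intro prod_mono) (auto simp: a_def)
    finally have "1 < (1 + \<delta>) * (\<Prod>j\<in>{..<n} - {k}. a j)" using \<delta> by simp
    also have "\<dots> = (\<Prod>j<n. a j)" using k by (subst prod.remove[of "{..<n}" k]) (auto simp: a_def)
    finally show ?thesis .
  qed
  have "mv n M (\<lambda>j. of_real (a j) * w j) \<in> \<Omega>" if w: "cnorm n w < 1" for w
  proof -
    define v where "v = (\<lambda>j. of_real (a j) * w j)"
    define t where "t = cnorm n v"
    have nv: "cmod (v j) = a j * cmod (w j)" for j using a[of j] by (simp add: v_def norm_mult)
    have "t \<le> cnorm n (\<lambda>j. of_real (1 + \<delta>) * w j)" unfolding t_def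
    proof (rule cnorm_mono)
      fix j show "cmod (v j) \<le> cmod (of_real (1 + \<delta>) * w j)"
        unfolding nv norm_mult norm_of_real using a1[of j] \<delta> by (intro mult_right_mono) auto
    qed
    also have "\<dots> = (1 + \<delta>) * cnorm n w" unfolding cnorm_scale norm_of_real using \<delta> by simp
    also have "\<dots> \<le> (1 + \<delta>) * 1" using w \<delta> by (intro mult_left_mono) auto
    finally have t1: "t \<le> 1 + \<delta>" by simp
    show ?thesis
    proof (cases "t < 1")
      case True
      then show ?thesis using E[of v] by (simp add: t_def v_def)
    next
      case False
      then have t: "1 \<le> t" by simp
      define WN where "WN = (\<Sum>j\<in>N. (cmod (w j))\<^sup>2)"
      define WZ where "WZ = (\<Sum>j\<in>{..<n} - N. (cmod (w j))\<^sup>2)"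
      have W0: "0 \<le> WN" "0 \<le> WZ" by (auto simp: WN_def WZ_def sum_nonneg)
      have split: "(\<Sum>j<n. g j) = (\<Sum>j\<in>N. g j) + (\<Sum>j\<in>{..<n} - N. g j)" for g :: "nat \<Rightarrow> real"
        using sum.subset_diff[OF N(1), of g] by simp
      have "WN + WZ = (cnorm n w)\<^sup>2" unfolding WN_def WZ_def cnorm_sq split ..
      also have "\<dots> \<le> 1" using w by (simp add: power_le_one)
      finally have W1: "WN + WZ \<le> 1" .
      have vN: "(\<Sum>j\<in>N. (cmod (v j))\<^sup>2) = (1 + \<delta>)\<^sup>2 * WN"
        unfolding nv WN_def sum_distrib_left by (rule sum.cong) (auto simp: a_def power_mult_distrib)
      have vZ: "(\<Sum>j\<in>{..<n} - N. (cmod (v j))\<^sup>2) = (1 - c * \<delta>)\<^sup>2 * WZ"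
        unfolding nv WZ_def sum_distrib_left by (rule sum.cong) (auto simp: a_def power_mult_distrib)
      have t2: "t\<^sup>2 = (1 + \<delta>)\<^sup>2 * WN + (1 - c * \<delta>)\<^sup>2 * WZ"
        unfolding t_def cnorm_sq split vN vZ ..
      have "1 \<le> t\<^sup>2" using t by simp
      have d2: "(1 + \<delta>)\<^sup>2 \<le> 1 + 3 * \<delta>" using \<delta> mult_left_mono[of \<delta> 1 \<delta>] by (simp add: power2_eq_square algebra_simps)
      have z2: "(1 - c * \<delta>)\<^sup>2 \<le> 1 - c * \<delta>" using cd mult_left_mono[of "c*\<delta>" 1 "c*\<delta>"] by (simp add: power2_eq_square algebra_simps)
      have "1 \<le> (1 + 3 * \<delta>) * WN + (1 - c * \<delta>) * WZ"
        using \<open>1 \<le> t\<^sup>2\<close> mult_right_mono[OF d2 W0(1)] mult_right_mono[OF z2 W0(2)] unfolding t2 by linarith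
      \<comment> \<open>Norm at least 1 is possible only if the gain in \<open>N\<close> makes up
        for the loss outside, so \<open>WZ\<close> is bounded by a multiple of
        \<open>WN\<close>.\<close>
      then have A: "\<delta> * (c * WZ) \<le> \<delta> * (3 * WN)" using W1 by (simp add: algebra_simps)
      then have "c * WZ \<le> 3 * WN" using \<delta> by simp
      then have Zb: "WZ \<le> 6 * n * WN" using n by (simp add: c_def field_simps)
      have "1 \<le> (1 + 3 * \<delta>) * WN + WZ"
        using \<open>1 \<le> (1 + 3 * \<delta>) * WN + (1 - c * \<delta>) * WZ\<close> mult_right_mono[of "1 - c * \<delta>" 1 WZ] cd W0 by linarith
      moreover have "(1 + 3 * \<delta>) * WN \<le> 4 * WN" using \<delta> W0 by (intro mult_right_mono) auto
      ultimately have "1 \<le> (4 + 6 * n) * WN" using Zb by (simp add: algebra_simps)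
      also have "\<dots> \<le> (4 + 6 * n) * ((1 + \<delta>)\<^sup>2 * WN)"
        using \<delta> W0 mult_right_mono[of 1 "(1 + \<delta>)\<^sup>2" WN] by (intro mult_left_mono) auto
      finally have NB: "1 / (4 + 6 * n) \<le> (1 + \<delta>)\<^sup>2 * WN" by (simp add: field_simps)
      define w' where "w' = (\<lambda>j\<in>{..<n}. of_real (1 / t) * v j)"
      have w'n: "cnorm n w' = 1"
      proof -
        have "cnorm n w' = cnorm n (\<lambda>j. of_real (1 / t) * v j)" unfolding cnorm_def w'_def by (rule L2_set_cong) auto
        also have "\<dots> = 1" unfolding cnorm_scale norm_of_real using t by (simp add: t_def[symmetric])
        finally show ?thesis .
      qed
      have "w' \<in> K" unfolding K_def
      proof (intro CollectI conjI w'n)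
        show "w' \<in> cspace n" by (simp add: w'_def)
        have "(\<Sum>j\<in>N. (cmod (w' j))\<^sup>2) = (\<Sum>j\<in>N. (1 / t)\<^sup>2 * (cmod (v j))\<^sup>2)"
        proof (rule sum.cong[OF refl])
          fix j assume "j \<in> N"
          then have "j < n" using N by auto
          then show "(cmod (w' j))\<^sup>2 = (1 / t)\<^sup>2 * (cmod (v j))\<^sup>2"
            unfolding w'_def by (simp add: norm_mult norm_divide power_mult_distrib power_divide)
        qed
        also have "\<dots> = (1 + \<delta>)\<^sup>2 * WN / t\<^sup>2" unfolding sum_distrib_left[symmetric] vN by (simp add: power_divide)
        finally have s: "(\<Sum>j\<in>N. (cmod (w' j))\<^sup>2) = (1 + \<delta>)\<^sup>2 * WN / t\<^sup>2" .
        have "t\<^sup>2 \<le> 2\<^sup>2" using t t1 \<delta> by (intro power_mono) auto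
        have "c1 \<le> 1 / (4 + 6 * n) / 4" by (simp add: c1_def)
        also have "\<dots> \<le> ((1 + \<delta>)\<^sup>2 * WN) / t\<^sup>2"
          using NB \<open>t\<^sup>2 \<le> 2\<^sup>2\<close> t W0 by (intro frac_le) auto
        finally show "c1 \<le> (\<Sum>j\<in>N. (cmod (w' j))\<^sup>2)" unfolding s .
      qed
      have eq: "mv n M v i = of_real t * mv n M w' i" if "i < n" for i
        using that t unfolding mv_def w'_def by (simp add: sum_distrib_left)
      have "mv n M v \<in> \<Omega>"
      proof (rule e(2)[OF imageI[OF \<open>w' \<in> K\<close>] mv_cspace])
        fix i assume i: "i < n"
        have "mv n M v i - mv n M w' i = of_real (t - 1) * mv n M w' i"
          unfolding eq[OF i] by (simp add: algebra_simps)
        then have "cmod (mv n M v i - mv n M w' i) = (t - 1) * cmod (mv n M w' i)"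
          using t by (simp only: norm_mult norm_of_real)
        also have "\<dots> \<le> \<delta> * m" using t t1 m[OF w'n i] \<delta> by (intro mult_mono) auto
        finally show "cmod (mv n M v i - mv n M w' i) < e" using \<delta>m by simp
      qed
      then show ?thesis by (simp add: v_def)
    qed
  qed
  with a prod show thesis using that by blast
qed

section \<open>Determinants and singular values\<close>

text \<open>Matrices are kept as index functions, for which continuity in the entries is plain; this
  is the passage to the type that carries the determinant.\<close>

definition jmat :: "nat \<Rightarrow> (nat \<Rightarrow> nat \<Rightarrow> complex) \<Rightarrow> complex Matrix.mat" where
  "jmat n A = Matrix.mat n n (\<lambda>(i, j). A i j)"

definition cdet :: "nat \<Rightarrow> (nat \<Rightarrow> nat \<Rightarrow> complex) \<Rightarrow> complex" where
  "cdet n A = Determinant.det (jmat n A)"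

definition mm :: "nat \<Rightarrow> (nat \<Rightarrow> nat \<Rightarrow> complex) \<Rightarrow> (nat \<Rightarrow> nat \<Rightarrow> complex) \<Rightarrow> nat \<Rightarrow> nat \<Rightarrow> complex" where
  "mm n A B = (\<lambda>i j. \<Sum>k<n. A i k * B k j)"

definition dgm :: "(nat \<Rightarrow> complex) \<Rightarrow> nat \<Rightarrow> nat \<Rightarrow> complex" where
  "dgm d = (\<lambda>i j. if i = j then d i else 0)"

lemma jmat_carrier [simp]: "jmat n A \<in> carrier_mat n n"
  by (simp add: jmat_def)

lemma jmat_mm: "jmat n (mm n A B) = jmat n A * jmat n B"
  by (rule eq_matI) (auto simp: jmat_def mm_def scalar_prod_def atLeast0LessThan)

lemma jmat_cong: "(\<And>i j. i < n \<Longrightarrow> j < n \<Longrightarrow> A i j = B i j) \<Longrightarrow> jmat n A = jmat n B"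
  by (rule eq_matI) (auto simp: jmat_def)

lemma cdet_mm: "cdet n (mm n A B) = cdet n A * cdet n B"
  by (simp add: cdet_def jmat_mm det_mult[of _ n])

text \<open>The Leibniz formula shows continuity in the entries, vanishing for a zero row, and the
  explicit form for \<open>n = 2\<close>.\<close>

lemma cdet_sum_perms:
  "cdet n A = (\<Sum>p | p permutes {0..<n}. signof p * (\<Prod>i = 0..<n. A i (p i)))"
proof -
  have "(\<Prod>i = 0..<n. jmat n A $$ (i, p i)) = (\<Prod>i = 0..<n. A i (p i))" if "p permutes {0..<n}" for p
    using permutes_in_image[OF that] by (intro prod.cong) (auto simp: jmat_def)
  then show ?thesis unfolding cdet_def det_def'[OF jmat_carrier]
    by (intro sum.cong) auto
qed

lemma cdet_dgm: "cdet n (dgm d) = (\<Prod>i<n. d i)"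
proof -
  have "Determinant.det (jmat n (dgm d)) = prod_list (diag_mat (jmat n (dgm d)))"
    by (rule det_upper_triangular[of _ n]) (auto simp: upper_triangular_def jmat_def dgm_def)
  also have "\<dots> = (\<Prod>i<n. d i)"
    by (simp add: prod_list_diag_prod jmat_def dgm_def atLeast0LessThan)
  finally show ?thesis by (simp add: cdet_def)
qed

lemma mv_mm: "mv n (mm n A B) z = mv n A (mv n B z)"
  unfolding mv_def
proof (rule restrict_ext)
  fix i assume "i \<in> {..<n}"
  have "(\<Sum>j<n. mm n A B i j * z j) = (\<Sum>j<n. \<Sum>k<n. A i k * B k j * z j)"
    by (simp add: mm_def sum_distrib_right)
  also have "\<dots> = (\<Sum>k<n. \<Sum>j<n. A i k * B k j * z j)" by (rule sum.swap)
  finally show "(\<Sum>j<n. mm n A B i j * z j) = (\<Sum>j<n. A i j * (\<lambda>i\<in>{..<n}. \<Sum>j<n. B i j * z j) j)"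
    by (simp add: sum_distrib_left mult.assoc)
qed

lemma mv_dgm: "mv n (dgm d) z = (\<lambda>i\<in>{..<n}. d i * z i)"
  unfolding mv_def by (rule restrict_ext) (simp add: dgm_def if_distrib[of "\<lambda>x. x * _"] cong: if_cong)

lemma mv_dgm_inverse:
  assumes "\<And>j. d j \<noteq> 0" "z \<in> cspace n"
  shows "mv n (dgm (\<lambda>j. 1 / d j)) (mv n (dgm d) z) = z" "mv n (dgm d) (mv n (dgm (\<lambda>j. 1 / d j)) z) = z"
  unfolding mv_dgm by (rule cspace_eqI[OF _ assms(2)], use assms(1) in simp, use assms(1) in simp)+

lemma mv_mat_cong: "(\<And>i j. i < n \<Longrightarrow> j < n \<Longrightarrow> A i j = B i j) \<Longrightarrow> mv n A z = mv n B z"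
  unfolding mv_def by (rule restrict_ext) simp

lemma mv_one: "z \<in> cspace n \<Longrightarrow> mv n (dgm (\<lambda>_. 1)) z = z"
  unfolding mv_dgm by (rule cspace_eqI) auto

lemma mv_id_of_jmat_one:
  assumes "jmat n A * jmat n B = 1\<^sub>m n" "z \<in> cspace n"
  shows "mv n A (mv n B z) = z"
proof -
  have "mm n A B i j = dgm (\<lambda>_. 1) i j" if "i < n" "j < n" for i j
  proof -
    have "jmat n (mm n A B) $$ (i, j) = 1\<^sub>m n $$ (i, j)" using assms(1) by (simp add: jmat_mm)
    then show ?thesis using that by (simp add: jmat_def dgm_def)
  qed
  then have "mv n (mm n A B) z = mv n (dgm (\<lambda>_. 1)) z" by (rule mv_mat_cong)
  then show ?thesis using mv_one[OF assms(2)] by (simp add: mv_mm)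
qed

lemma cdet_inverse:
  assumes "cdet n A \<noteq> 0"
  obtains B where "\<And>z. z \<in> cspace n \<Longrightarrow> mv n A (mv n B z) = z" "\<And>z. z \<in> cspace n \<Longrightarrow> mv n B (mv n A z) = z"
    "cdet n A * cdet n B = 1"
proof -
  have "jmat n A \<in> Units (ring_mat TYPE(complex) n ())"
    using det_non_zero_imp_unit[OF jmat_carrier] assms by (simp add: cdet_def)
  then obtain C where C: "C \<in> carrier_mat n n" "C * jmat n A = 1\<^sub>m n" "jmat n A * C = 1\<^sub>m n"
    unfolding Units_def by (auto simp: ring_mat_simps)
  define B where "B = (\<lambda>i j. C $$ (i, j))"
  have "jmat n B = C" unfolding B_def by (rule eq_matI) (use C(1) in \<open>auto simp: jmat_def\<close>)
  moreover have "cdet n A * cdet n B = 1"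
    unfolding cdet_def \<open>jmat n B = C\<close> using det_mult[OF jmat_carrier C(1), of A] C(3) by simp
  ultimately show thesis using that[of B] C mv_id_of_jmat_one by metis
qed

lemma cdet_zero_kernel:
  assumes "cdet n A = 0"
  obtains z where "z \<in> cspace n" "z \<noteq> czero n" "\<And>i. i < n \<Longrightarrow> (\<Sum>j<n. A i j * z j) = 0"
proof -
  obtain v where v: "v \<in> carrier_vec n" "v \<noteq> 0\<^sub>v n" "jmat n A *\<^sub>v v = 0\<^sub>v n"
    using assms det_0_iff_vec_prod_zero_field[OF jmat_carrier] unfolding cdet_def by blast
  define z where "z = (\<lambda>i\<in>{..<n}. vec_index v i)"
  have "z \<in> cspace n" by (simp add: z_def)
  moreover have "z \<noteq> czero n"
  proof
    assume "z = czero n"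
    have "vec_index v i = 0" if "i < n" for i
      using fun_cong[OF \<open>z = czero n\<close>, of i] that by (simp add: z_def czero_def)
    then have "v = 0\<^sub>v n" using v(1) by (intro eq_vecI) auto
    then show False using v(2) by simp
  qed
  moreover have "(\<Sum>j<n. A i j * z j) = 0" if i: "i < n" for i
  proof -
    have "vec_index (jmat n A *\<^sub>v v) i = 0" using v(3) i by simp
    then show ?thesis using i v(1)
      by (simp add: jmat_def scalar_prod_def z_def atLeast0LessThan)
  qed
  ultimately show thesis using that by blast
qed

lemma mv_czero: "mv n A (czero n) = czero n"
  unfolding mv_def czero_def by (rule restrict_ext) simp

lemma cdet_nonzeroI:
  assumes "inj_on (mv n A) (cspace n)"
  shows "cdet n A \<noteq> 0"
proof
  assume "cdet n A = 0"
  then obtain z where z: "z \<in> cspace n" "z \<noteq> czero n" "\<And>i. i < n \<Longrightarrow> (\<Sum>j<n. A i j * z j) = 0"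
    by (rule cdet_zero_kernel) blast
  have "mv n A z = mv n A (czero n)" unfolding mv_czero unfolding mv_def czero_def using z(3) by (intro restrict_ext) simp
  from inj_onD[OF assms this z(1) cspace_czero] z(2) show False by contradiction
qed

text \<open>Padding the system with zero rows gives a square matrix whose row \<open>k\<close>
  vanishes, hence a singular one.\<close>

lemma underdetermined_kernel:
  assumes "k < n"
  obtains z where "z \<in> cspace n" "z \<noteq> czero n" "\<And>i. i < k \<Longrightarrow> (\<Sum>j<n. A i j * z j) = 0"
proof -
  define B where "B = (\<lambda>i j. if i < k then A i j else 0)"
  have "(\<Prod>i = 0..<n. B i (p i)) = 0" for p
    by (rule prod_zero) (use assms in \<open>auto simp: B_def intro!: bexI[of _ k]\<close>)
  then have "cdet n B = 0" unfolding cdet_sum_perms by (simp only: mult_zero_right sum.neutral_const)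
  then obtain z where z: "z \<in> cspace n" "z \<noteq> czero n" "\<And>i. i < n \<Longrightarrow> (\<Sum>j<n. B i j * z j) = 0"
    by (rule cdet_zero_kernel) blast
  have "(\<Sum>j<n. A i j * z j) = 0" if "i < k" for i
    using z(3)[of i] that assms by (simp add: B_def)
  with z(1,2) show thesis using that by blast
qed

section \<open>Hermitian inner product and unitary matrices\<close>

definition ip :: "nat \<Rightarrow> (nat \<Rightarrow> complex) \<Rightarrow> (nat \<Rightarrow> complex) \<Rightarrow> complex" where
  "ip n z w = (\<Sum>i<n. z i * cnj (w i))"

lemma ip_self: "ip n z z = of_real ((cnorm n z)\<^sup>2)"
  unfolding ip_def cnorm_sq of_real_sum by (simp only: complex_norm_square)

lemma cnj_ip: "cnj (ip n z w) = ip n w z"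
  by (simp add: ip_def mult.commute)

lemma cnorm_eq_0_iff: "z \<in> cspace n \<Longrightarrow> cnorm n z = 0 \<longleftrightarrow> z = czero n"
proof
  assume z: "z \<in> cspace n" "cnorm n z = 0"
  then have "cmod (z i) = 0" if "i < n" for i
    using component_le_cnorm[OF that, of z] by (simp add: antisym)
  then show "z = czero n" using z by (intro cspace_eqI) (auto simp: czero_def)
qed simp

lemma cnorm_add_sq:
  "(cnorm n (\<lambda>i. z i + c * w i))\<^sup>2 = (cnorm n z)\<^sup>2 + 2 * Re (cnj c * ip n z w) + (cmod c)\<^sup>2 * (cnorm n w)\<^sup>2"
proof -
  have "(cmod (z i + c * w i))\<^sup>2 = (cmod (z i))\<^sup>2 + 2 * Re (cnj c * (z i * cnj (w i))) + (cmod c)\<^sup>2 * (cmod (w i))\<^sup>2" for i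
    unfolding cmod_add_sq norm_mult by (simp add: power_mult_distrib algebra_simps)
  then have "(cnorm n (\<lambda>i. z i + c * w i))\<^sup>2 =
      (\<Sum>i<n. (cmod (z i))\<^sup>2 + 2 * Re (cnj c * (z i * cnj (w i))) + (cmod c)\<^sup>2 * (cmod (w i))\<^sup>2)"
    unfolding cnorm_sq by (simp only:)
  also have "\<dots> = (cnorm n z)\<^sup>2 + 2 * (\<Sum>i<n. Re (cnj c * (z i * cnj (w i)))) + (cmod c)\<^sup>2 * (cnorm n w)\<^sup>2"
    unfolding cnorm_sq sum.distrib sum_distrib_left ..
  also have "(\<Sum>i<n. Re (cnj c * (z i * cnj (w i)))) = Re (cnj c * ip n z w)"
    unfolding ip_def sum_distrib_left Re_sum ..
  finally show ?thesis .
qed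

definition unitary :: "nat \<Rightarrow> (nat \<Rightarrow> nat \<Rightarrow> complex) \<Rightarrow> bool" where
  "unitary n U \<longleftrightarrow> (\<forall>i<n. \<forall>j<n. (\<Sum>k<n. cnj (U k i) * U k j) = (if i = j then 1 else 0))"

lemma unitary_cdet:
  assumes "unitary n U" shows "cmod (cdet n U) = 1"
proof -
  define V where "V = (\<lambda>i j. cnj (U j i))"
  interpret cnj: comm_ring_hom cnj by unfold_locales simp_all
  have "jmat n V = map_mat cnj (transpose_mat (jmat n U))"
    by (rule eq_matI) (auto simp: jmat_def V_def)
  then have "cdet n V = cnj (cdet n U)"
    unfolding cdet_def by (simp add: det_transpose[OF jmat_carrier])
  moreover have "cdet n (mm n V U) = cdet n (dgm (\<lambda>_. 1))"
    unfolding cdet_def by (rule arg_cong[of _ _ Determinant.det], rule jmat_cong)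
      (use assms in \<open>auto simp: unitary_def mm_def V_def dgm_def\<close>)
  ultimately have "cdet n U * cnj (cdet n U) = 1" by (simp add: cdet_mm cdet_dgm mult.commute)
  then have "of_real ((cmod (cdet n U))\<^sup>2) = (1::complex)" by (simp only: complex_norm_square)
  then have "(cmod (cdet n U))\<^sup>2 = 1" by (simp only: of_real_eq_1_iff)
  then show ?thesis by (simp add: power2_eq_1_iff) (metis norm_ge_zero not_one_le_zero neg_0_le_iff_le)
qed

lemma unitary_cnorm:
  assumes "unitary n U" shows "cnorm n (mv n U z) = cnorm n z"
proof -
  have "ip n (mv n U z) (mv n U z) = (\<Sum>k<n. \<Sum>j<n. \<Sum>i<n. (U k j * z j) * cnj (U k i * z i))"
    unfolding ip_def mv_def by (simp add: cnj_sum sum_product)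
  also have "\<dots> = (\<Sum>j<n. \<Sum>i<n. \<Sum>k<n. (U k j * z j) * cnj (U k i * z i))"
    by (subst sum.swap, rule sum.cong[OF refl], rule sum.swap)
  also have "\<dots> = (\<Sum>j<n. \<Sum>i<n. (\<Sum>k<n. cnj (U k i) * U k j) * (z j * cnj (z i)))"
    unfolding sum_distrib_right by (intro sum.cong refl) (simp add: mult_ac)
  also have "\<dots> = (\<Sum>j<n. \<Sum>i<n. (if i = j then z j * cnj (z i) else 0))"
    by (intro sum.cong refl) (use assms in \<open>auto simp: unitary_def\<close>)
  also have "\<dots> = ip n z z" by (simp add: ip_def)
  finally have "(cnorm n (mv n U z))\<^sup>2 = (cnorm n z)\<^sup>2" unfolding ip_self by (simp only: of_real_eq_iff)
  then show ?thesis by (simp add: power2_eq_iff_nonneg)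
qed

text \<open>First variation at a maximum: \<open>p\<close> is the image of a norm-maximising unit
  vector and \<open>q\<close> that of a vector of squared norm \<open>s\<close> orthogonal to it. If
  \<open>ip n p q\<close> were nonzero, a small multiple of it as \<open>c\<close> would raise the
  left side to first order but the bound only to second order.\<close>

lemma norm_attaining_orthogonal:
  assumes max: "\<And>c. (cnorm n (\<lambda>i. p i + c * q i))\<^sup>2 \<le> (cnorm n p)\<^sup>2 * (1 + (cmod c)\<^sup>2 * s)"
    and s: "0 \<le> s"
  shows "ip n p q = 0"
proof (rule ccontr)
  assume "ip n p q \<noteq> 0"
  define a where "a = ip n p q"
  have a: "(cmod a)\<^sup>2 > 0" using \<open>ip n p q \<noteq> 0\<close> by (simp add: a_def)
  define L where "L = (cnorm n p)\<^sup>2 * s"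
  have L: "0 \<le> L" using s by (simp add: L_def)
  define t where "t = 1 / (L + 1)"
  have t: "0 < t" "t * L < 1" using L by (auto simp: t_def field_simps)
  have "Re (cnj (of_real t * a) * a) = t * (cmod a)\<^sup>2"
    unfolding cmod_power2 by (simp add: power2_eq_square algebra_simps)
  moreover have "(cmod (of_real t * a))\<^sup>2 = t\<^sup>2 * (cmod a)\<^sup>2"
    by (simp add: norm_mult power_mult_distrib)
  ultimately have "2 * (t * (cmod a)\<^sup>2) + t\<^sup>2 * (cmod a)\<^sup>2 * (cnorm n q)\<^sup>2 \<le> L * (t\<^sup>2 * (cmod a)\<^sup>2)"
    using max[of "of_real t * a"] unfolding cnorm_add_sq a_def[symmetric] L_def
    by (simp add: algebra_simps)
  moreover have "0 \<le> t\<^sup>2 * (cmod a)\<^sup>2 * (cnorm n q)\<^sup>2" by simp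
  ultimately have "2 * (t * (cmod a)\<^sup>2) \<le> (t * L) * (t * (cmod a)\<^sup>2)"
    by (simp add: power2_eq_square algebra_simps)
  also have "\<dots> \<le> 1 * (t * (cmod a)\<^sup>2)" using t a by (intro mult_right_mono) auto
  finally show False using t a by simp
qed

text \<open>Right singular vectors, chosen greedily: each one maximises the norm of its image among the
  unit vectors orthogonal to its predecessors.\<close>

lemma greedy_singular_vectors:
  assumes "k \<le> n"
  shows "\<exists>v. (\<forall>i<k. v i \<in> cspace n) \<and> (\<forall>i<k. \<forall>j<k. ip n (v i) (v j) = (if i = j then 1 else 0)) \<and>
    (\<forall>i<k. \<forall>w\<in>cspace n. (\<forall>j\<le>i. ip n w (v j) = 0) \<longrightarrow> ip n (mv n T (v i)) (mv n T w) = 0)"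
  using assms
proof (induction k)
  case 0
  then show ?case by simp
next
  case (Suc k)
  from Suc.IH[OF Suc_leD[OF Suc.prems]] obtain v where v0: "\<forall>i<k. v i \<in> cspace n"
    "\<forall>i<k. \<forall>j<k. ip n (v i) (v j) = (if i = j then 1 else 0)"
    "\<forall>i<k. \<forall>w\<in>cspace n. (\<forall>j\<le>i. ip n w (v j) = 0) \<longrightarrow> ip n (mv n T (v i)) (mv n T w) = 0"
    by (elim exE conjE)
  note v = v0[rule_format]
  have k: "k < n" using Suc by simp
  define S where "S = {z \<in> cspace n. cnorm n z = 1 \<and> (\<forall>i<k. ip n z (v i) = 0)}"
  have normalise: "cscale n (of_real (1 / cnorm n z)) z \<in> S"
    if z: "z \<in> cspace n" "cnorm n z \<noteq> 0" "\<And>i. i < k \<Longrightarrow> ip n z (v i) = 0" for z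
  proof -
    have eq: "ip n (cscale n c z) y = c * ip n z y" for c y
      unfolding ip_def cscale_def by (simp add: sum_distrib_left mult.assoc)
    have "cnorm n (cscale n (of_real (1 / cnorm n z)) z) = cnorm n (\<lambda>i. of_real (1 / cnorm n z) * z i)"
      unfolding cnorm_def cscale_def by (rule L2_set_cong) auto
    also have "\<dots> = 1" unfolding cnorm_scale norm_of_real using z(2) by simp
    finally show ?thesis using z(3) by (simp add: S_def eq)
  qed
  \<comment> \<open>Orthogonality to the \<open>k\<close> predecessors is a system of
    \<open>k < n\<close> linear equations.\<close>
  have "S \<noteq> {}"
  proof -
    obtain z where z: "z \<in> cspace n" "z \<noteq> czero n" "\<And>i. i < k \<Longrightarrow> (\<Sum>j<n. cnj (v i j) * z j) = 0"
      using underdetermined_kernel[OF k, of "\<lambda>i j. cnj (v i j)"] by metis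
    have "cnorm n z \<noteq> 0" using z by (simp add: cnorm_eq_0_iff)
    moreover have "ip n z (v i) = 0" if "i < k" for i
      using z(3)[OF that] by (simp add: ip_def mult.commute)
    ultimately show ?thesis using normalise[OF z(1)] by blast
  qed
  have "compact S"
  proof (rule cspace_bounded_closed_compact)
    show "S \<subseteq> cspace n" by (auto simp: S_def)
    have eq: "S = cspace n \<inter> ({z. cnorm n z = 1} \<inter> (\<Inter>i\<in>{..<k}. {z. ip n z (v i) = 0}))"
      unfolding S_def by blast
    have "closed {z. cnorm n z = 1}"
      by (intro closed_Collect_eq continuous_on_cnorm continuous_on_id continuous_on_const)
    moreover have c: "closed {z. ip n z (v i) = 0}" for i
      unfolding ip_def
      by (intro closed_Collect_eq continuous_on_const continuous_on_sum continuous_on_mult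
          continuous_on_product_coordinates)
    have "closed (\<Inter>i\<in>{..<k}. {z. ip n z (v i) = 0})" by (intro closed_INT ballI c)
    ultimately show "closed S" unfolding eq by (intro closed_Int closed_cspace)
    show "cmod (z i) \<le> 1" if "z \<in> S" "i < n" for z i
      using component_le_cnorm[OF that(2), of z] that(1) by (simp add: S_def)
  qed
  moreover have "continuous_on S (\<lambda>z. cnorm n (mv n T z))"
    by (rule continuous_on_cnorm[OF continuous_on_mv])
  ultimately obtain x where x: "x \<in> S" and max: "\<And>y. y \<in> S \<Longrightarrow> cnorm n (mv n T y) \<le> cnorm n (mv n T x)"
    using continuous_attains_sup[OF _ \<open>S \<noteq> {}\<close>] by blast
  have xs: "x \<in> cspace n" "cnorm n x = 1" "\<And>i. i < k \<Longrightarrow> ip n x (v i) = 0" using x by (auto simp: S_def)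
  have xT: "ip n (mv n T x) (mv n T w) = 0"
    if w: "w \<in> cspace n" "ip n w x = 0" "\<And>j. j < k \<Longrightarrow> ip n w (v j) = 0" for w
  proof (rule norm_attaining_orthogonal)
    show "0 \<le> (cnorm n w)\<^sup>2" by simp
    fix c
    \<comment> \<open>This vector is again orthogonal to the predecessors, so after normalisation it
      competes with \<open>x\<close>; its squared norm follows from the orthogonality of
      \<open>x\<close> and \<open>w\<close>.\<close>
    define y where "y = (\<lambda>i\<in>{..<n}. x i + c * w i)"
    have Ty: "mv n T y i = mv n T x i + c * mv n T w i" if "i < n" for i
      using that unfolding mv_def y_def by (simp add: sum.distrib sum_distrib_left algebra_simps)
    have ny: "(cnorm n y)\<^sup>2 = 1 + (cmod c)\<^sup>2 * (cnorm n w)\<^sup>2"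
    proof -
      have "cnorm n y = cnorm n (\<lambda>i. x i + c * w i)"
        unfolding cnorm_def y_def by (rule L2_set_cong) auto
      moreover have "ip n x w = 0" using cnj_ip[of n w x] w(2) by simp
      ultimately show ?thesis by (simp add: cnorm_add_sq xs(2))
    qed
    then have "(cnorm n y)\<^sup>2 \<noteq> 0" by (smt (verit) mult_nonneg_nonneg zero_le_power2)
    then have y0: "cnorm n y \<noteq> 0" by simp
    have "ip n y (v i) = 0" if "i < k" for i
    proof -
      have "ip n y (v i) = ip n x (v i) + c * ip n w (v i)"
        unfolding ip_def y_def by (simp add: sum.distrib sum_distrib_left algebra_simps)
      then show ?thesis using xs(3)[OF that] w(3)[OF that] by simp
    qed
    then have "cscale n (of_real (1 / cnorm n y)) y \<in> S" using y0 by (intro normalise) (auto simp: y_def)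
    then have "cnorm n (mv n T (cscale n (of_real (1 / cnorm n y)) y)) \<le> cnorm n (mv n T x)" by (rule max)
    moreover have "cnorm n (mv n T (cscale n (of_real (1 / cnorm n y)) y)) = 1 / cnorm n y * cnorm n (mv n T y)"
    proof -
      have "mv n T (cscale n (of_real (1 / cnorm n y)) y) = cscale n (of_real (1 / cnorm n y)) (mv n T y)"
        unfolding cscale_mv by (rule mv_cong) (simp add: cscale_def)
      moreover have "cnorm n (cscale n (of_real (1 / cnorm n y)) (mv n T y)) = cnorm n (\<lambda>i. of_real (1 / cnorm n y) * mv n T y i)"
        unfolding cnorm_def cscale_def by (rule L2_set_cong) auto
      ultimately show ?thesis unfolding cnorm_scale norm_of_real by simp
    qed
    ultimately have "1 / cnorm n y * cnorm n (mv n T y) \<le> cnorm n (mv n T x)" by (simp only:)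
    moreover have "cnorm n y > 0" using y0 cnorm_nonneg[of n y] by linarith
    ultimately have "cnorm n (mv n T y) \<le> cnorm n (mv n T x) * cnorm n y" by (simp add: pos_divide_le_eq)
    then have "(cnorm n (mv n T y))\<^sup>2 \<le> (cnorm n (mv n T x) * cnorm n y)\<^sup>2" by (intro power_mono) auto
    moreover have "cnorm n (mv n T y) = cnorm n (\<lambda>i. mv n T x i + c * mv n T w i)"
      unfolding cnorm_def by (rule L2_set_cong) (auto simp: Ty)
    ultimately show "(cnorm n (\<lambda>i. mv n T x i + c * mv n T w i))\<^sup>2
        \<le> (cnorm n (mv n T x))\<^sup>2 * (1 + (cmod c)\<^sup>2 * (cnorm n w)\<^sup>2)"
      by (simp add: power_mult_distrib ny)
  qed
  define v' where "v' = v(k := x)"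
  have v'k: "v' k = x" and v'l: "\<And>i. i < k \<Longrightarrow> v' i = v i" by (auto simp: v'_def)
  show ?case
  proof (intro exI[of _ v'] conjI allI impI ballI)
    show "v' i \<in> cspace n" if "i < Suc k" for i
      using that v(1) xs(1) by (cases "i = k") (auto simp: v'k v'l)
    show "ip n (v' i) (v' j) = (if i = j then 1 else 0)" if "i < Suc k" "j < Suc k" for i j
    proof -
      have "ip n x x = 1" by (simp add: ip_self xs(2))
      moreover have "ip n (v i) x = 0" if "i < k" for i using cnj_ip[of n x "v i"] xs(3)[OF that] by simp
      ultimately show ?thesis using that v(2) xs(3)
        by (cases "i = k"; cases "j = k") (auto simp: v'k v'l)
    qed
    fix i w assume i: "i < Suc k" and w: "w \<in> cspace n" "\<forall>j\<le>i. ip n w (v' j) = 0"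
    show "ip n (mv n T (v' i)) (mv n T w) = 0"
    proof (cases "i = k")
      case True
      then have "ip n w x = 0" "ip n w (v j) = 0" if "j < k" for j
        using w(2) v'k v'l that by (metis order_refl, metis less_imp_le)
      moreover have "ip n w x = 0" using w(2) True v'k by auto
      ultimately show ?thesis using xT[OF w(1)] True by (simp add: v'k)
    next
      case False
      then have "i < k" using i by simp
      then have "\<forall>j\<le>i. ip n w (v j) = 0" using w(2) v'l by (metis le_less_trans)
      then show ?thesis using v(3)[OF \<open>i < k\<close> w(1)] \<open>i < k\<close> by (simp add: v'l)
    qed
  qed
qed

text \<open>The greedy vectors are orthonormal and so are their images up to length: of any two, the
  later one is orthogonal to the earlier one and its predecessors, so maximality of the earlier one
  applies. They form the columns of \<open>U\<close>, their normalised images those of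
  \<open>W\<close>, and the lengths of the images are \<open>d\<close>.\<close>

lemma singular_value_decomposition:
  assumes T: "cdet n T \<noteq> 0"
  obtains U W d where "unitary n U" "unitary n W" "\<And>j. 0 < (d j :: real)"
    "cmod (cdet n T) = (\<Prod>j<n. d j)"
    "\<And>z. mv n T (mv n U z) = mv n W (\<lambda>j. of_real (d j) * z j)"
proof -
  obtain v where v0: "\<forall>i<n. v i \<in> cspace n"
    "\<forall>i<n. \<forall>j<n. ip n (v i) (v j) = (if i = j then 1 else 0)"
    "\<forall>i<n. \<forall>w\<in>cspace n. (\<forall>j\<le>i. ip n w (v j) = 0) \<longrightarrow> ip n (mv n T (v i)) (mv n T w) = 0"
    using greedy_singular_vectors[OF order_refl, of n T] by (elim exE conjE)
  note v = v0[rule_format]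
  have orth: "ip n (mv n T (v i)) (mv n T (v j)) = 0" if "i < n" "j < n" "i \<noteq> j" for i j
  proof -
    have *: "ip n (mv n T (v i)) (mv n T (v j)) = 0" if "i < j" "j < n" for i j
      using that v(2) by (intro v(3) v(1)) auto
    show ?thesis
      using *[of i j] *[of j i] cnj_ip[of n "mv n T (v j)" "mv n T (v i)"] that by (cases "i < j") auto
  qed
  define U where "U = (\<lambda>i j. v j i)"
  \<comment> \<open>The value 1 from \<open>n\<close> on makes \<open>d\<close> positive at every
    index.\<close>
  define d where "d = (\<lambda>j. if j < n then cnorm n (mv n T (v j)) else 1)"
  have d: "0 < d j" for j
  proof (cases "j < n")
    case True
    obtain B where B: "\<And>z. z \<in> cspace n \<Longrightarrow> mv n B (mv n T z) = z" using cdet_inverse[OF T] by metis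
    have "cnorm n (mv n T (v j)) \<noteq> 0"
    proof
      assume "cnorm n (mv n T (v j)) = 0"
      then have "mv n T (v j) = czero n" by (simp add: cnorm_eq_0_iff)
      then have "v j = czero n" using B[OF v(1)[OF True]] mv_czero by metis
      then have "ip n (v j) (v j) = 0" by (simp add: ip_self)
      then show False using v(2)[OF True True] by simp
    qed
    then show ?thesis using True by (simp add: d_def less_le)
  qed (simp add: d_def)
  define W where "W = (\<lambda>i j. mv n T (v j) i / of_real (d j))"
  have "unitary n U"
    unfolding unitary_def
  proof (intro allI impI)
    fix i j assume ij: "i < n" "j < n"
    have "(\<Sum>k<n. cnj (U k i) * U k j) = ip n (v j) (v i)" by (simp add: U_def ip_def mult.commute)
    then show "(\<Sum>k<n. cnj (U k i) * U k j) = (if i = j then 1 else 0)" using v(2)[OF ij(2,1)] by auto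
  qed
  moreover have "unitary n W"
    unfolding unitary_def
  proof (intro allI impI)
    fix i j assume ij: "i < n" "j < n"
    have eq: "(\<Sum>k<n. cnj (W k i) * W k j) = ip n (mv n T (v j)) (mv n T (v i)) / (of_real (d i) * of_real (d j))"
      by (simp add: W_def ip_def sum_divide_distrib mult.commute)
    show "(\<Sum>k<n. cnj (W k i) * W k j) = (if i = j then 1 else 0)"
    proof (cases "i = j")
      case True
      have "ip n (mv n T (v i)) (mv n T (v i)) = of_real (d i) * of_real (d i)"
        using ij by (simp add: ip_self d_def power2_eq_square)
      then show ?thesis using d[of i] True unfolding eq by simp
    next
      case False
      then show ?thesis using orth[OF ij(2,1)] unfolding eq by simp
    qed
  qed
  moreover have ent: "mm n T U i j = mm n W (dgm (\<lambda>j. of_real (d j))) i j" if "i < n" "j < n" for i j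
  proof -
    have "mm n W (dgm (\<lambda>j. of_real (d j))) i j = W i j * of_real (d j)"
      unfolding mm_def dgm_def using that by (simp add: if_distrib cong: if_cong)
    also have "\<dots> = mv n T (v j) i" using d[of j] by (simp add: W_def)
    also have "\<dots> = mm n T U i j" using that by (simp add: mv_def mm_def U_def)
    finally show ?thesis by simp
  qed
  moreover have "mv n T (mv n U z) = mv n W (\<lambda>j. of_real (d j) * z j)" for z
  proof -
    have "mv n (mm n T U) z = mv n (mm n W (dgm (\<lambda>j. of_real (d j)))) z" by (rule mv_mat_cong[OF ent])
    moreover have "mv n W (mv n (dgm (\<lambda>j. of_real (d j))) z) = mv n W (\<lambda>j. of_real (d j) * z j)"
      by (rule mv_cong) (simp add: mv_dgm)
    ultimately show ?thesis by (simp only: mv_mm)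
  qed
  moreover have "cmod (cdet n T) = (\<Prod>j<n. d j)"
  proof -
    have "cdet n (mm n T U) = cdet n (mm n W (dgm (\<lambda>j. of_real (d j))))"
      unfolding cdet_def by (simp only: jmat_cong[OF ent])
    then have "cmod (cdet n T) * cmod (cdet n U) = cmod (cdet n W) * cmod (\<Prod>j<n. of_real (d j))"
      unfolding cdet_mm cdet_dgm by (simp only: norm_mult[symmetric])
    also have "cmod (\<Prod>j<n. of_real (d j)) = (\<Prod>j<n. d j)"
      using d by (simp add: prod_norm[symmetric] less_imp_le)
    finally show ?thesis using unitary_cdet \<open>unitary n U\<close> \<open>unitary n W\<close> by simp
  qed
  ultimately show thesis using that d by blast
qed

section \<open>Volume of ellipsoids\<close>

lemma psf_lborel: "product_sigma_finite (\<lambda>_::nat. lborel :: complex measure)"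
  by standard

lemma sigma_finite_cleb: "sigma_finite_measure (cleb n)"
proof -
  interpret product_sigma_finite "\<lambda>_::nat. lborel :: complex measure" by (rule psf_lborel)
  show ?thesis by (rule sigma_finite) simp
qed

lemma space_cleb: "space (cleb n) = cspace n"
  by (simp add: space_PiM)

lemma emeasure_cleb_PiE:
  "(\<And>i. i < n \<Longrightarrow> A i \<in> sets borel) \<Longrightarrow> emeasure (cleb n) (PiE {..<n} A) = (\<Prod>i<n. emeasure lborel (A i))"
  using product_sigma_finite.emeasure_PiM[OF psf_lborel, of "{..<n}" A] by simp

lemma measurable_cleb_coord: "i < n \<Longrightarrow> (\<lambda>x. x i) \<in> borel_measurable (cleb n)"
  using measurable_component_singleton[of i "{..<n}" "\<lambda>_. lborel :: complex measure"] by simp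

lemma measurable_mv: "mv n M \<in> measurable (cleb n) (cleb n)"
  unfolding mv_def
proof (rule measurable_restrict)
  fix i
  show "(\<lambda>z. \<Sum>j<n. M i j * z j) \<in> measurable (cleb n) lborel"
    unfolding measurable_lborel1
    by (intro borel_measurable_sum borel_measurable_times borel_measurable_const measurable_cleb_coord) simp
qed

lemma measurable_cadd:
  assumes f: "f \<in> measurable M (cleb n)" and g: "g \<in> measurable M (cleb n)"
  shows "(\<lambda>x. cadd n (f x) (g x)) \<in> measurable M (cleb n)"
  unfolding cadd_def
proof (rule measurable_restrict)
  fix i assume "i \<in> {..<n}"
  then have i: "i < n" by simp
  show "(\<lambda>x. f x i + g x i) \<in> measurable M lborel"
    unfolding measurable_lborel1
    using measurable_compose[OF f measurable_cleb_coord[OF i]] measurable_compose[OF g measurable_cleb_coord[OF i]]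
    by (rule borel_measurable_add)
qed

lemma measurable_cscale:
  assumes f: "f \<in> measurable M (cleb n)"
  shows "(\<lambda>x. cscale n c (f x)) \<in> measurable M (cleb n)"
  unfolding cscale_def
proof (rule measurable_restrict)
  fix i assume "i \<in> {..<n}"
  then have i: "i < n" by simp
  show "(\<lambda>x. c * f x i) \<in> measurable M lborel"
    unfolding measurable_lborel1
    using measurable_compose[OF f measurable_cleb_coord[OF i]]
    by (intro borel_measurable_times borel_measurable_const)
qed

section \<open>Translation invariance and volumes of linear images\<close>

lemma cleb_translate:
  "distr (cleb n) (cleb n) (\<lambda>x. cadd n x a) = cleb n"
proof (rule product_sigma_finite.PiM_eqI[OF psf_lborel])
  have m: "(\<lambda>x. cadd n x a) \<in> measurable (cleb n) (cleb n)"
    unfolding cadd_def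
  proof (rule measurable_restrict)
    fix i assume "i \<in> {..<n}"
    then show "(\<lambda>x. x i + a i) \<in> measurable (cleb n) lborel"
      unfolding measurable_lborel1
      by (intro borel_measurable_add borel_measurable_const measurable_cleb_coord) simp
  qed
  fix A :: "nat \<Rightarrow> complex set" assume A: "\<And>i. i \<in> {..<n} \<Longrightarrow> A i \<in> sets lborel"
  have eq: "(\<lambda>x. cadd n x a) -` PiE {..<n} A \<inter> space (cleb n) = PiE {..<n} (\<lambda>i. (\<lambda>x. a i + x) -` A i)"
  proof (intro subset_antisym subsetI)
    fix x assume "x \<in> (\<lambda>x. cadd n x a) -` PiE {..<n} A \<inter> space (cleb n)"
    then have x: "cadd n x a \<in> PiE {..<n} A" "x \<in> cspace n" by (simp_all add: space_cleb)
    show "x \<in> PiE {..<n} (\<lambda>i. (\<lambda>x. a i + x) -` A i)"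
    proof (rule PiE_I)
      show "x i \<in> (\<lambda>x. a i + x) -` A i" if "i \<in> {..<n}" for i
        using PiE_mem[OF x(1) that] that by (simp add: cadd_def add.commute)
      show "x i = undefined" if "i \<notin> {..<n}" for i using PiE_arb[OF x(2) that] .
    qed
  next
    fix x assume x: "x \<in> PiE {..<n} (\<lambda>i. (\<lambda>x. a i + x) -` A i)"
    have "cadd n x a \<in> PiE {..<n} A"
    proof (rule PiE_I)
      show "cadd n x a i \<in> A i" if "i \<in> {..<n}" for i
        using PiE_mem[OF x that] that by (simp add: cadd_def add.commute)
    qed (simp add: cadd_def)
    moreover have "x \<in> cspace n" using x by (simp add: PiE_def)
    ultimately show "x \<in> (\<lambda>x. cadd n x a) -` PiE {..<n} A \<inter> space (cleb n)" by (simp add: space_cleb)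
  qed
  have "emeasure (distr (cleb n) (cleb n) (\<lambda>x. cadd n x a)) (PiE {..<n} A)
      = emeasure (cleb n) (PiE {..<n} (\<lambda>i. (\<lambda>x. a i + x) -` A i))"
    unfolding eq[symmetric] by (rule emeasure_distr[OF m]) (rule sets_PiM_I_finite, use A in auto)
  also have "\<dots> = (\<Prod>i<n. emeasure lborel ((\<lambda>x. a i + x) -` A i))"
  proof (rule emeasure_cleb_PiE)
    fix i assume "i < n"
    then have "A i \<in> sets borel" using A by simp
    then show "(\<lambda>x. a i + x) -` A i \<in> sets borel" 
      using measurable_sets[of "\<lambda>x. a i + x" borel borel "A i"] by simp
  qed
  also have "\<dots> = (\<Prod>i<n. emeasure lborel (A i))"
  proof (rule prod.cong[OF refl])
    fix i assume i: "i \<in> {..<n}"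
    have "emeasure (distr lborel borel (\<lambda>x. a i + x)) (A i) = emeasure lborel ((\<lambda>x. a i + x) -` A i \<inter> space lborel)"
      using A[OF i] by (intro emeasure_distr) auto
    then show "emeasure lborel ((\<lambda>x. a i + x) -` A i) = emeasure lborel (A i)"
      by (simp add: lborel_distr_plus)
  qed
  finally show "emeasure (distr (cleb n) (cleb n) (\<lambda>x. cadd n x a)) (PiE {..<n} A) = (\<Prod>i<n. emeasure lborel (A i))" .
qed auto

lemma measurable_cadd_const: "a \<in> cspace n \<Longrightarrow> (\<lambda>x. cadd n x a) \<in> measurable (cleb n) (cleb n)"
  by (intro measurable_cadd measurable_const measurable_ident_sets) (auto simp: space_cleb)

lemma nn_integral_cleb_translate:
  assumes "f \<in> borel_measurable (cleb n)" "a \<in> cspace n"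
  shows "(\<integral>\<^sup>+x. f (cadd n x a) \<partial>cleb n) = (\<integral>\<^sup>+x. f x \<partial>cleb n)"
  using nn_integral_distr[OF measurable_cadd_const[OF assms(2)], of f] assms(1) by (simp add: cleb_translate)

text \<open>As a preimage under the inverse map, the image is seen to be measurable.\<close>

lemma inj_image_eq_preimage:
  assumes "\<And>z. z \<in> cspace n \<Longrightarrow> mv n N (mv n T z) = z" "\<And>z. z \<in> cspace n \<Longrightarrow> mv n T (mv n N z) = z"
    "X \<subseteq> cspace n"
  shows "mv n T ` X = mv n N -` X \<inter> cspace n"
proof
  show "mv n T ` X \<subseteq> mv n N -` X \<inter> cspace n"
  proof
    fix y assume "y \<in> mv n T ` X"
    then obtain x where x: "x \<in> X" "y = mv n T x" by blast
    then have "mv n N y = x" using assms(1,3) by blast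
    then show "y \<in> mv n N -` X \<inter> cspace n" using x mv_cspace by simp
  qed
  show "mv n N -` X \<inter> cspace n \<subseteq> mv n T ` X"
  proof
    fix y assume y: "y \<in> mv n N -` X \<inter> cspace n"
    then have "mv n T (mv n N y) = y" using assms(2) by blast
    then show "y \<in> mv n T ` X" using y by (metis IntD1 imageI vimageD)
  qed
qed

lemma mv_cadd: "mv n T (cadd n z w) = cadd n (mv n T z) (mv n T w)"
  unfolding mv_def cadd_def by (rule restrict_ext) (simp add: sum.distrib algebra_simps)

text \<open>The uniqueness argument for Haar measure: integrate the indicator of a product set over
  \<open>\<complex>\<^sup>n \<times> \<complex>\<^sup>n\<close> and shear in each of the two variables.\<close>

lemma linear_image_volume:
  assumes inv: "\<And>z. z \<in> cspace n \<Longrightarrow> mv n N (mv n T z) = z" "\<And>z. z \<in> cspace n \<Longrightarrow> mv n T (mv n N z) = z"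
    and A: "A \<in> sets (cleb n)" and X: "X \<in> sets (cleb n)"
    and sym: "\<And>z. z \<in> A \<Longrightarrow> cscale n (-1) z \<in> A"
  shows "emeasure (cleb n) (mv n T ` X) * emeasure (cleb n) A = emeasure (cleb n) X * emeasure (cleb n) (mv n T ` A)"
proof -
  interpret sigma_finite_measure "cleb n" by (rule sigma_finite_cleb)
  interpret P: pair_sigma_finite "cleb n" "cleb n" ..
  let ?\<mu> = "cleb n"
  have sub: "A \<subseteq> cspace n" "X \<subseteq> cspace n" using A X sets.sets_into_space space_cleb by blast+
  have img: "emeasure ?\<mu> (mv n T ` Y) = (\<integral>\<^sup>+x. indicator Y (mv n N x) \<partial>?\<mu>)" if Y: "Y \<in> sets ?\<mu>" for Y
  proof -
    have "Y \<subseteq> cspace n" using Y sets.sets_into_space space_cleb by blast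
    then have "mv n T ` Y = mv n N -` Y \<inter> space ?\<mu>" unfolding space_cleb by (intro inj_image_eq_preimage inv)
    moreover have "mv n N -` Y \<inter> space ?\<mu> \<in> sets ?\<mu>" using measurable_mv Y by (rule measurable_sets)
    ultimately have "emeasure ?\<mu> (mv n T ` Y) = (\<integral>\<^sup>+x. indicator (mv n N -` Y \<inter> space ?\<mu>) x \<partial>?\<mu>)" by simp
    also have "\<dots> = (\<integral>\<^sup>+x. indicator Y (mv n N x) \<partial>?\<mu>)"
      by (rule nn_integral_cong) (auto simp: indicator_def)
    finally show ?thesis .
  qed
  have symA: "indicator A (cscale n (-1) z) = (indicator A z :: ennreal)" if "z \<in> cspace n" for z
  proof -
    have "cscale n (-1) (cscale n (-1) z) = z"
      by (rule cspace_eqI) (use that in \<open>auto simp: cscale_def\<close>)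
    then show ?thesis using sym[of z] sym[of "cscale n (-1) z"] by (auto simp: indicator_def)
  qed
  have mX: "indicator X \<in> borel_measurable ?\<mu>" and mA: "indicator A \<in> borel_measurable ?\<mu>"
    using X A by simp_all
  have "emeasure ?\<mu> (mv n T ` A) * emeasure ?\<mu> X
      = (\<integral>\<^sup>+x. indicator A (mv n N x) * emeasure ?\<mu> X \<partial>?\<mu>)"
    unfolding img[OF A] by (rule nn_integral_multc[symmetric]) (rule measurable_compose[OF measurable_mv mA])
  also have "\<dots> = (\<integral>\<^sup>+x. (\<integral>\<^sup>+y. indicator A (mv n N x) * indicator X y \<partial>?\<mu>) \<partial>?\<mu>)"
    by (intro nn_integral_cong nn_integral_cmult_indicator[symmetric] X)
  \<comment> \<open>For fixed \<open>x\<close>, \<open>y\<close> is translated by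
    \<open>mv n N x\<close>.\<close>
  also have "\<dots> = (\<integral>\<^sup>+x. (\<integral>\<^sup>+y. indicator A (mv n N x) * indicator X (cadd n y (mv n N x)) \<partial>?\<mu>) \<partial>?\<mu>)"
    by (rule nn_integral_cong)
       (rule nn_integral_cleb_translate[OF borel_measurable_times_ennreal[OF borel_measurable_const mX] mv_cspace, symmetric])
  also have "\<dots> = (\<integral>\<^sup>+y. (\<integral>\<^sup>+x. indicator A (mv n N x) * indicator X (cadd n y (mv n N x)) \<partial>?\<mu>) \<partial>?\<mu>)"
  proof (rule P.Fubini'[symmetric])
    have "(\<lambda>p. indicator A (mv n N (fst p)) * indicator X (cadd n (snd p) (mv n N (fst p))) :: ennreal)
       \<in> borel_measurable (?\<mu> \<Otimes>\<^sub>M ?\<mu>)"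
      by (intro borel_measurable_times_ennreal measurable_compose[OF _ mX] measurable_compose[OF _ mA]
          measurable_cadd measurable_compose[OF _ measurable_mv] measurable_fst measurable_snd)
    then show "case_prod (\<lambda>x y. indicator A (mv n N x) * indicator X (cadd n y (mv n N x)) :: ennreal)
       \<in> borel_measurable (?\<mu> \<Otimes>\<^sub>M ?\<mu>)" by (simp only: case_prod_beta')
  qed
  also have "\<dots> = (\<integral>\<^sup>+y. (\<integral>\<^sup>+x. indicator X (mv n N x) * indicator A (cadd n y (cscale n (-1) (mv n N x))) \<partial>?\<mu>) \<partial>?\<mu>)"
  proof (rule nn_integral_cong)
    fix y assume "y \<in> space ?\<mu>"
    then have y: "y \<in> cspace n" by (simp add: space_cleb)
    \<comment> \<open>Translating \<open>x\<close> by \<open>b\<close> replaces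
      \<open>mv n N x\<close> by its difference with \<open>y\<close>; this exchanges the roles of
      the two indicators up to a sign, which the symmetry of \<open>A\<close> removes.\<close>
    define b where "b = mv n T (cscale n (-1) y)"
    have cy: "(\<lambda>x. cadd n y (mv n N x)) \<in> measurable ?\<mu> ?\<mu>"
      by (intro measurable_cadd measurable_const measurable_mv) (use y in \<open>simp add: space_cleb\<close>)
    have "(\<integral>\<^sup>+x. indicator A (mv n N x) * indicator X (cadd n y (mv n N x)) \<partial>?\<mu>)
      = (\<integral>\<^sup>+x. indicator A (mv n N (cadd n x b)) * indicator X (cadd n y (mv n N (cadd n x b))) \<partial>?\<mu>)"
    proof (rule nn_integral_cleb_translate[symmetric])
      show "(\<lambda>x. indicator A (mv n N x) * indicator X (cadd n y (mv n N x)) :: ennreal) \<in> borel_measurable ?\<mu>"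
        by (intro borel_measurable_times_ennreal measurable_compose[OF cy mX] measurable_compose[OF measurable_mv mA])
    qed (simp add: b_def)
    also have "\<dots> = (\<integral>\<^sup>+x. indicator X (mv n N x) * indicator A (cadd n y (cscale n (-1) (mv n N x))) \<partial>?\<mu>)"
    proof (rule nn_integral_cong)
      fix x
      have "mv n N (cadd n x b) = cadd n (mv n N x) (cscale n (-1) y)"
        unfolding mv_cadd b_def by (simp add: inv(1))
      moreover have "cadd n (mv n N x) (cscale n (-1) y) = cscale n (-1) (cadd n y (cscale n (-1) (mv n N x)))"
        by (rule cspace_eqI[OF cspace_cadd cspace_cscale]) (simp add: cadd_def cscale_def)
      moreover have "cadd n y (cadd n (mv n N x) (cscale n (-1) y)) = mv n N x"
        by (rule cspace_eqI[OF cspace_cadd mv_cspace]) (simp add: cadd_def cscale_def)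
      ultimately show "(indicator A (mv n N (cadd n x b)) * indicator X (cadd n y (mv n N (cadd n x b))) :: ennreal)
        = indicator X (mv n N x) * indicator A (cadd n y (cscale n (-1) (mv n N x)))"
        by (metis symA cspace_cadd mult.commute)
    qed
    finally show "(\<integral>\<^sup>+x. indicator A (mv n N x) * indicator X (cadd n y (mv n N x)) \<partial>?\<mu>)
      = (\<integral>\<^sup>+x. indicator X (mv n N x) * indicator A (cadd n y (cscale n (-1) (mv n N x))) \<partial>?\<mu>)" .
  qed
  also have "\<dots> = (\<integral>\<^sup>+x. (\<integral>\<^sup>+y. indicator X (mv n N x) * indicator A (cadd n y (cscale n (-1) (mv n N x))) \<partial>?\<mu>) \<partial>?\<mu>)"
  proof (rule P.Fubini')
    have "(\<lambda>p. indicator X (mv n N (fst p)) * indicator A (cadd n (snd p) (cscale n (-1) (mv n N (fst p)))) :: ennreal)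
       \<in> borel_measurable (?\<mu> \<Otimes>\<^sub>M ?\<mu>)"
      by (intro borel_measurable_times_ennreal measurable_compose[OF _ mX] measurable_compose[OF _ mA]
          measurable_cadd measurable_cscale measurable_compose[OF _ measurable_mv] measurable_fst measurable_snd)
    then show "case_prod (\<lambda>x y. indicator X (mv n N x) * indicator A (cadd n y (cscale n (-1) (mv n N x))) :: ennreal)
       \<in> borel_measurable (?\<mu> \<Otimes>\<^sub>M ?\<mu>)" by (simp only: case_prod_beta')
  qed
  \<comment> \<open>For fixed \<open>x\<close>, \<open>y\<close> is translated by
    \<open>- mv n N x\<close>, which separates the variables again.\<close>
  also have "\<dots> = (\<integral>\<^sup>+x. (\<integral>\<^sup>+y. indicator X (mv n N x) * indicator A y \<partial>?\<mu>) \<partial>?\<mu>)"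
    by (rule nn_integral_cong)
       (rule nn_integral_cleb_translate[OF borel_measurable_times_ennreal[OF borel_measurable_const mA] cspace_cscale])
  also have "\<dots> = (\<integral>\<^sup>+x. indicator X (mv n N x) * emeasure ?\<mu> A \<partial>?\<mu>)"
    by (intro nn_integral_cong nn_integral_cmult_indicator A)
  also have "\<dots> = emeasure ?\<mu> (mv n T ` X) * emeasure ?\<mu> A"
    unfolding img[OF X] by (rule nn_integral_multc) (rule measurable_compose[OF measurable_mv mX])
  finally show ?thesis by (simp only: mult.commute)
qed

lemma cunit_ball_sets: "cunit_ball n \<in> sets (cleb n)"
proof -
  define f where "f = (\<lambda>z::nat \<Rightarrow> complex. \<Sum>i<n. (cmod (z i))\<^sup>2)"
  have "f \<in> borel_measurable (cleb n)"
    unfolding f_def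
    by (intro borel_measurable_sum borel_measurable_power borel_measurable_norm measurable_cleb_coord) simp
  then have "f -` {..<1} \<inter> space (cleb n) \<in> sets (cleb n)" by (rule measurable_sets) simp
  moreover have "cnorm n z < 1 \<longleftrightarrow> f z < 1" for z by (simp add: cnorm_def L2_set_def f_def)
  then have "f -` {..<1} \<inter> space (cleb n) = cunit_ball n"
    unfolding space_cleb cunit_ball_def by blast
  ultimately show ?thesis by simp
qed

lemma emeasure_polydisc:
  assumes "\<And>i. i < n \<Longrightarrow> 0 \<le> d i"
  shows "emeasure (cleb n) (PiE {..<n} (\<lambda>i. ball 0 (d i))) = ennreal (pi ^ n * (\<Prod>i<n. d i)\<^sup>2)"
proof -
  have "emeasure (cleb n) (PiE {..<n} (\<lambda>i. ball 0 (d i))) = (\<Prod>i<n. emeasure lborel (ball (0::complex) (d i)))"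
    by (rule emeasure_cleb_PiE) simp
  also have "\<dots> = (\<Prod>i<n. ennreal (pi * (d i)\<^sup>2))"
    using assms by (intro prod.cong) (auto simp: emeasure_ball unit_ball_vol_2)
  also have "\<dots> = ennreal (\<Prod>i<n. pi * (d i)\<^sup>2)" by (rule prod_ennreal) simp
  also have "(\<Prod>i<n. pi * (d i)\<^sup>2) = pi ^ n * (\<Prod>i<n. d i)\<^sup>2"
    by (simp add: prod.distrib prod_power_distrib)
  finally show ?thesis .
qed

lemma polydisc_sets: "PiE {..<n} (\<lambda>i. ball 0 (d i)) \<in> sets (cleb n)"
  by (rule sets_PiM_I_finite) auto

text \<open>The ball lies between two polydiscs. Positivity and finiteness suffice, because its
  volume serves only as a common factor.\<close>

lemma emeasure_cunit_ball:
  shows "emeasure (cleb n) (cunit_ball n) \<noteq> 0" "emeasure (cleb n) (cunit_ball n) \<noteq> \<infinity>"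
proof -
  have "PiE {..<n} (\<lambda>i. ball 0 (1 / (n + 1))) \<subseteq> cunit_ball n"
  proof
    fix z assume z: "z \<in> PiE {..<n} (\<lambda>i. ball (0::complex) (1 / (n + 1)))"
    have "cnorm n z \<le> (\<Sum>i<n. cmod (z i))" by (rule cnorm_le_sum)
    also have "\<dots> \<le> (\<Sum>i<n. 1 / (n + 1))"
    proof (rule sum_mono)
      show "cmod (z i) \<le> 1 / (n + 1)" if "i \<in> {..<n}" for i using PiE_mem[OF z that] by simp
    qed
    also have "\<dots> < 1" by simp
    finally have "cnorm n z < 1" .
    moreover have "z \<in> cspace n" using z unfolding PiE_def by simp
    ultimately show "z \<in> cunit_ball n" by (simp add: cunit_ball_def)
  qed
  then have "emeasure (cleb n) (PiE {..<n} (\<lambda>i. ball 0 (1 / (n + 1)))) \<le> emeasure (cleb n) (cunit_ball n)"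
    by (rule emeasure_mono) (rule cunit_ball_sets)
  moreover have "emeasure (cleb n) (PiE {..<n} (\<lambda>i. ball 0 (1 / (n + 1)))) > 0"
    by (subst emeasure_polydisc) auto
  ultimately show "emeasure (cleb n) (cunit_ball n) \<noteq> 0" by auto
  have "cunit_ball n \<subseteq> PiE {..<n} (\<lambda>i. ball 0 1)"
  proof
    fix z assume z: "z \<in> cunit_ball n"
    show "z \<in> PiE {..<n} (\<lambda>i. ball 0 1)"
    proof (rule PiE_I)
      show "z i \<in> ball 0 1" if "i \<in> {..<n}" for i
        using component_le_cnorm[of i n z] that z by (simp add: cunit_ball_def)
      show "z i = undefined" if "i \<notin> {..<n}" for i using z PiE_arb[OF _ that] unfolding cunit_ball_def by blast
    qed
  qed
  then have "emeasure (cleb n) (cunit_ball n) \<le> emeasure (cleb n) (PiE {..<n} (\<lambda>i. ball 0 1))"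
    by (rule emeasure_mono) (rule polydisc_sets)
  also have "\<dots> < \<infinity>" by (subst emeasure_polydisc) auto
  finally show "emeasure (cleb n) (cunit_ball n) \<noteq> \<infinity>" by simp
qed

lemma cunit_ball_symmetric: "z \<in> cunit_ball n \<Longrightarrow> cscale n (-1) z \<in> cunit_ball n"
proof -
  assume z: "z \<in> cunit_ball n"
  have "cnorm n (cscale n (-1) z) = cnorm n (\<lambda>i. (-1) * z i)"
    unfolding cnorm_def cscale_def by (rule L2_set_cong) auto
  also have "\<dots> = cnorm n z" unfolding cnorm_scale by simp
  finally show ?thesis using z by (simp add: cunit_ball_def)
qed

lemma image_in_sets:
  assumes "\<And>z. z \<in> cspace n \<Longrightarrow> mv n N (mv n T z) = z" "\<And>z. z \<in> cspace n \<Longrightarrow> mv n T (mv n N z) = z"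
    "X \<in> sets (cleb n)"
  shows "mv n T ` X \<in> sets (cleb n)"
proof -
  have "X \<subseteq> cspace n" using assms(3) sets.sets_into_space space_cleb by blast
  then have "mv n T ` X = mv n N -` X \<inter> space (cleb n)" unfolding space_cleb by (intro inj_image_eq_preimage assms)
  then show ?thesis using measurable_sets[OF measurable_mv assms(3)] by simp
qed

lemma unitary_image_cunit_ball:
  assumes "unitary n U" shows "mv n U ` cunit_ball n = cunit_ball n"
proof -
  have "cmod (cdet n U) = 1" by (rule unitary_cdet[OF assms])
  then have "cdet n U \<noteq> 0" by auto
  then obtain V where V: "\<And>z. z \<in> cspace n \<Longrightarrow> mv n U (mv n V z) = z" "\<And>z. z \<in> cspace n \<Longrightarrow> mv n V (mv n U z) = z"
    by (rule cdet_inverse) blast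
  have "mv n U ` cunit_ball n = mv n V -` cunit_ball n \<inter> cspace n"
    by (rule inj_image_eq_preimage) (use V in \<open>auto simp: cunit_ball_def\<close>)
  also have "\<dots> = cunit_ball n"
  proof -
    have "cnorm n (mv n V z) = cnorm n z" if "z \<in> cspace n" for z
      using unitary_cnorm[OF assms, of "mv n V z"] V(1)[OF that] by simp
    then show ?thesis
      by (intro subset_antisym subsetI) (auto simp: cunit_ball_def)
  qed
  finally show ?thesis .
qed

lemma ennreal_mult_cancel_pos: "a * c = b * c \<Longrightarrow> c \<noteq> 0 \<Longrightarrow> c \<noteq> \<infinity> \<Longrightarrow> a = (b::ennreal)"
  by (simp add: ennreal_mult_cancel_left mult.commute[of _ c] infinity_ennreal_def)

text \<open>In \<open>linear_image_volume\<close> the unit ball is the test set; \<open>U\<close>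
  preserves it, so it cancels.\<close>

lemma unitary_volume:
  assumes "unitary n U" "X \<in> sets (cleb n)"
  shows "emeasure (cleb n) (mv n U ` X) = emeasure (cleb n) X"
proof -
  have "cmod (cdet n U) = 1" by (rule unitary_cdet[OF assms(1)])
  then have "cdet n U \<noteq> 0" by auto
  then obtain V where V: "\<And>z. z \<in> cspace n \<Longrightarrow> mv n U (mv n V z) = z" "\<And>z. z \<in> cspace n \<Longrightarrow> mv n V (mv n U z) = z"
    by (rule cdet_inverse) blast
  have "emeasure (cleb n) (mv n U ` X) * emeasure (cleb n) (cunit_ball n)
      = emeasure (cleb n) X * emeasure (cleb n) (mv n U ` cunit_ball n)"
    by (rule linear_image_volume[OF V(2,1) cunit_ball_sets assms(2) cunit_ball_symmetric])
  then show ?thesis unfolding unitary_image_cunit_ball[OF assms(1)]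
    by (rule ennreal_mult_cancel_pos) (rule emeasure_cunit_ball)+
qed

text \<open>Here the test set is the unit polydisc, whose diagonal image is again a polydisc. The
  square arises because scaling by \<open>d j\<close> multiplies the area of a disc in the plane by
  the square of \<open>d j\<close>.\<close>

lemma diagonal_volume:
  assumes d: "\<And>j. 0 < (d j :: real)"
  shows "emeasure (cleb n) (mv n (dgm (\<lambda>j. of_real (d j))) ` cunit_ball n)
    = ennreal ((\<Prod>j<n. d j)\<^sup>2) * emeasure (cleb n) (cunit_ball n)"
proof -
  let ?D = "dgm (\<lambda>j. complex_of_real (d j))" and ?E = "dgm (\<lambda>j. 1 / complex_of_real (d j))"
  let ?P = "PiE {..<n} (\<lambda>i. ball (0::complex) 1)"
  have d0: "complex_of_real (d j) \<noteq> 0" for j using d[of j] by simp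
  note inv = mv_dgm_inverse[of "\<lambda>j. complex_of_real (d j)", OF d0]
  have sym: "cscale n (-1) z \<in> ?P" if z: "z \<in> ?P" for z
  proof (rule PiE_I)
    show "cscale n (-1) z i \<in> ball 0 1" if "i \<in> {..<n}" for i
      using PiE_mem[OF z that] that by (simp add: cscale_def)
  qed (simp add: cscale_def)
  have img: "mv n ?D ` ?P = PiE {..<n} (\<lambda>i. ball (0::complex) (d i))"
  proof (rule subset_antisym; rule subsetI)
    fix y assume "y \<in> mv n ?D ` ?P"
    then obtain z where z: "z \<in> ?P" "y = mv n ?D z" by blast
    show "y \<in> PiE {..<n} (\<lambda>i. ball 0 (d i))"
    proof (rule PiE_I)
      show "y i \<in> ball 0 (d i)" if "i \<in> {..<n}" for i
        using PiE_mem[OF z(1) that] that d[of i] by (simp add: z(2) mv_dgm norm_mult)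
    qed (simp add: z(2) mv_dgm)
  next
    fix y assume y: "y \<in> PiE {..<n} (\<lambda>i. ball (0::complex) (d i))"
    then have yc: "y \<in> cspace n" unfolding PiE_def by simp
    have "mv n ?E y \<in> ?P"
    proof (rule PiE_I)
      show "mv n ?E y i \<in> ball 0 1" if "i \<in> {..<n}" for i
        using PiE_mem[OF y that] that d[of i] by (simp add: mv_dgm norm_divide)
    qed (simp add: mv_dgm)
    then show "y \<in> mv n ?D ` ?P" using inv(2)[OF yc] by (metis imageI)
  qed
  have "emeasure (cleb n) (mv n ?D ` cunit_ball n) * emeasure (cleb n) ?P
      = emeasure (cleb n) (cunit_ball n) * emeasure (cleb n) (mv n ?D ` ?P)"
    by (rule linear_image_volume[OF inv polydisc_sets cunit_ball_sets sym])
  also have "emeasure (cleb n) (mv n ?D ` ?P) = ennreal ((\<Prod>j<n. d j)\<^sup>2) * emeasure (cleb n) ?P"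
    unfolding img using d
    by (simp add: emeasure_polydisc less_imp_le ennreal_mult'[symmetric] mult.commute)
  finally have "emeasure (cleb n) (mv n ?D ` cunit_ball n) * emeasure (cleb n) ?P
      = (ennreal ((\<Prod>j<n. d j)\<^sup>2) * emeasure (cleb n) (cunit_ball n)) * emeasure (cleb n) ?P"
    by (simp only: mult_ac)
  then show ?thesis by (rule ennreal_mult_cancel_pos) (auto simp: emeasure_polydisc)
qed

lemma ellipsoid_volume:
  assumes T: "cdet n T \<noteq> 0"
  shows "emeasure (cleb n) (mv n T ` cunit_ball n) = ennreal ((cmod (cdet n T))\<^sup>2) * emeasure (cleb n) (cunit_ball n)"
proof -
  obtain U W d where U: "unitary n U" and W: "unitary n W" and d: "\<And>j. 0 < (d j :: real)"
    and det: "cmod (cdet n T) = (\<Prod>j<n. d j)"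
    and eq: "\<And>z. mv n T (mv n U z) = mv n W (\<lambda>j. of_real (d j) * z j)"
    using singular_value_decomposition[OF T] by metis
  let ?D = "dgm (\<lambda>j. complex_of_real (d j))"
  have d0: "complex_of_real (d j) \<noteq> 0" for j using d[of j] by simp
  have D: "mv n ?D ` cunit_ball n \<in> sets (cleb n)"
    by (rule image_in_sets[OF mv_dgm_inverse[of "\<lambda>j. complex_of_real (d j)", OF d0] cunit_ball_sets])
  have "mv n T ` cunit_ball n = mv n T ` (mv n U ` cunit_ball n)"
    by (simp only: unitary_image_cunit_ball[OF U])
  also have "\<dots> = mv n W ` (mv n ?D ` cunit_ball n)"
  proof -
    have "mv n T (mv n U z) = mv n W (mv n ?D z)" for z
      unfolding eq by (rule mv_cong) (simp add: mv_dgm)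
    then show ?thesis by (simp only: image_image)
  qed
  finally show ?thesis using unitary_volume[OF W D] diagonal_volume[OF d] det by simp
qed

section \<open>Existence and uniqueness\<close>

lemma invertible_clinear_matrix:
  assumes T: "invertible_clinear n T"
  obtains A where "cdet n A \<noteq> 0" "\<And>z. z \<in> cspace n \<Longrightarrow> T z = mv n A z"
proof -
  have bij: "bij_betw T (cspace n) (cspace n)"
    and add: "\<And>z w. z \<in> cspace n \<Longrightarrow> w \<in> cspace n \<Longrightarrow> T (cadd n z w) = cadd n (T z) (T w)"
    and scale: "\<And>c z. z \<in> cspace n \<Longrightarrow> T (cscale n c z) = cscale n c (T z)"
    using T unfolding invertible_clinear_def by blast+
  define e where "e = (\<lambda>j. \<lambda>i\<in>{..<n}. if i = j then 1 else (0::complex))"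
  have e: "e j \<in> cspace n" for j by (simp add: e_def)
  define A where "A = (\<lambda>i j. T (e j) i)"
  have eq: "T z = mv n A z" if z: "z \<in> cspace n" for z
  proof -
    \<comment> \<open>Truncations of \<open>z\<close>: passing from \<open>k\<close> to
      \<open>Suc k\<close> adds one multiple of a basis vector, so additivity and homogeneity apply
      one coordinate at a time.\<close>
    define t where "t = (\<lambda>k. \<lambda>i\<in>{..<n}. if i < k then z i else 0)"
    have t: "t k \<in> cspace n" for k by (simp add: t_def)
    have tk: "T (t k) i = (\<Sum>j<k. A i j * z j)" if "k \<le> n" "i < n" for k i
      using that(1)
    proof (induction k)
      case 0
      have "t 0 = cscale n 0 (t 0)" by (rule cspace_eqI[OF t cspace_cscale]) (simp add: t_def cscale_def)
      then have "T (t 0) = cscale n 0 (T (t 0))" using scale[OF t] by metis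
      from fun_cong[OF this, of i] have "T (t 0) i = 0" using that(2) by (simp add: cscale_def)
      then show ?case by simp
    next
      case (Suc k)
      have "t (Suc k) = cadd n (t k) (cscale n (z k) (e k))"
        by (rule cspace_eqI[OF t cspace_cadd]) (auto simp: t_def cadd_def cscale_def e_def less_Suc_eq)
      then have "T (t (Suc k)) = cadd n (T (t k)) (cscale n (z k) (T (e k)))"
        by (simp only: add[OF t cspace_cscale] scale[OF e])
      then have "T (t (Suc k)) i = T (t k) i + z k * T (e k) i"
        using that(2) by (simp add: cadd_def cscale_def)
      then show ?case using Suc by (simp add: A_def)
    qed
    have "t n = z" by (rule cspace_eqI[OF t z]) (simp add: t_def)
    show ?thesis
    proof (rule cspace_eqI[OF _ mv_cspace])
      show "T z \<in> cspace n" using bij_betw_apply[OF bij z] .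
      show "T z i = mv n A z i" if "i < n" for i
        using tk[OF order_refl that] that \<open>t n = z\<close> by (simp add: mv_def)
    qed
  qed
  have "inj_on (mv n A) (cspace n)"
    using bij_betw_imp_inj_on[OF bij] by (rule inj_on_cong[THEN iffD1, rotated]) (simp add: eq)
  from cdet_nonzeroI[OF this] eq show thesis using that by blast
qed

lemma mv_cscale: "mv n A (cscale n c z) = cscale n c (mv n A z)"
  unfolding cscale_mv by (rule mv_cong) (simp add: cscale_def)

lemma invertible_clinear_mv:
  assumes "cdet n A \<noteq> 0" shows "invertible_clinear n (mv n A)"
proof -
  obtain B where B: "\<And>z. z \<in> cspace n \<Longrightarrow> mv n A (mv n B z) = z" "\<And>z. z \<in> cspace n \<Longrightarrow> mv n B (mv n A z) = z"
    using assms by (rule cdet_inverse) blast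
  have "bij_betw (mv n A) (cspace n) (cspace n)"
    by (rule bij_betwI[of _ _ _ "mv n B"]) (simp_all add: B Pi_def)
  then show ?thesis unfolding invertible_clinear_def by (simp add: mv_cadd mv_cscale)
qed

lemma hermitian_ellipsoids_eq:
  "hermitian_ellipsoids n = {mv n A ` cunit_ball n | A. cdet n A \<noteq> 0}"
proof (rule subset_antisym; rule subsetI)
  fix E assume "E \<in> hermitian_ellipsoids n"
  then obtain T where T: "invertible_clinear n T" "E = T ` cunit_ball n"
    unfolding hermitian_ellipsoids_def by blast
  obtain A where A: "cdet n A \<noteq> 0" "\<And>z. z \<in> cspace n \<Longrightarrow> T z = mv n A z"
    using T(1) by (rule invertible_clinear_matrix) blast
  have "E = mv n A ` cunit_ball n"
    unfolding T(2) by (rule image_cong[OF refl]) (simp add: A(2) cunit_ball_def)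
  then show "E \<in> {mv n A ` cunit_ball n | A. cdet n A \<noteq> 0}" using A(1) by blast
next
  fix E assume "E \<in> {mv n A ` cunit_ball n | A. cdet n A \<noteq> 0}"
  then show "E \<in> hermitian_ellipsoids n"
    unfolding hermitian_ellipsoids_def using invertible_clinear_mv by blast
qed

lemma ellipsoid_volume_le_iff:
  assumes "cdet n A \<noteq> 0" "cdet n B \<noteq> 0"
  shows "emeasure (cleb n) (mv n A ` cunit_ball n) \<le> emeasure (cleb n) (mv n B ` cunit_ball n)
    \<longleftrightarrow> cmod (cdet n A) \<le> cmod (cdet n B)"
proof -
  obtain r where r: "0 \<le> r" "emeasure (cleb n) (cunit_ball n) = ennreal r"
    using emeasure_cunit_ball(2)[of n] by (cases "emeasure (cleb n) (cunit_ball n)") auto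
  then have "0 < r" using emeasure_cunit_ball(1)[of n] by (cases "r = 0") auto
  have "emeasure (cleb n) (mv n A ` cunit_ball n) \<le> emeasure (cleb n) (mv n B ` cunit_ball n)
    \<longleftrightarrow> (cmod (cdet n A))\<^sup>2 * r \<le> (cmod (cdet n B))\<^sup>2 * r"
    unfolding ellipsoid_volume[OF assms(1)] ellipsoid_volume[OF assms(2)] r(2)
    using r(1) by (simp add: ennreal_mult'[symmetric])
  also have "\<dots> \<longleftrightarrow> cmod (cdet n A) \<le> cmod (cdet n B)" using \<open>0 < r\<close> by simp
  finally show ?thesis .
qed

text \<open>All volumes share the factor of the unit ball, so from here on maximality concerns only
  moduli of determinants.\<close>

lemma maximal_ellipsoid_iff:
  assumes "cdet n A \<noteq> 0"
  shows "maximal_ellipsoid n \<Omega> (mv n A ` cunit_ball n) \<longleftrightarrow> mv n A ` cunit_ball n \<subseteq> \<Omega> \<and>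
    (\<forall>B. cdet n B \<noteq> 0 \<longrightarrow> mv n B ` cunit_ball n \<subseteq> \<Omega> \<longrightarrow> cmod (cdet n B) \<le> cmod (cdet n A))"
proof -
  let ?E = "mv n A ` cunit_ball n"
  have herm: "mv n B ` cunit_ball n \<in> hermitian_ellipsoids n" if "cdet n B \<noteq> 0" for B
    unfolding hermitian_ellipsoids_eq using that by blast
  have "(\<forall>E'\<in>hermitian_ellipsoids n. E' \<subseteq> \<Omega> \<longrightarrow> emeasure (cleb n) E' \<le> emeasure (cleb n) ?E) \<longleftrightarrow>
    (\<forall>B. cdet n B \<noteq> 0 \<longrightarrow> mv n B ` cunit_ball n \<subseteq> \<Omega> \<longrightarrow> cmod (cdet n B) \<le> cmod (cdet n A))"
  proof (intro iffI allI impI ballI)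
    fix B assume "\<forall>E'\<in>hermitian_ellipsoids n. E' \<subseteq> \<Omega> \<longrightarrow> emeasure (cleb n) E' \<le> emeasure (cleb n) ?E"
      and B: "cdet n B \<noteq> 0" "mv n B ` cunit_ball n \<subseteq> \<Omega>"
    then have "emeasure (cleb n) (mv n B ` cunit_ball n) \<le> emeasure (cleb n) ?E" using herm[OF B(1)] by simp
    then show "cmod (cdet n B) \<le> cmod (cdet n A)" by (simp only: ellipsoid_volume_le_iff[OF B(1) assms])
  next
    fix E' assume *: "\<forall>B. cdet n B \<noteq> 0 \<longrightarrow> mv n B ` cunit_ball n \<subseteq> \<Omega> \<longrightarrow> cmod (cdet n B) \<le> cmod (cdet n A)"
      and E': "E' \<in> hermitian_ellipsoids n" "E' \<subseteq> \<Omega>"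
    obtain B where B: "cdet n B \<noteq> 0" "E' = mv n B ` cunit_ball n"
      using E'(1) unfolding hermitian_ellipsoids_eq by blast
    have "cmod (cdet n B) \<le> cmod (cdet n A)" using * B E'(2) by blast
    then show "emeasure (cleb n) E' \<le> emeasure (cleb n) ?E"
      by (simp only: B(2) ellipsoid_volume_le_iff[OF B(1) assms])
  qed
  then show ?thesis unfolding maximal_ellipsoid_def using herm[OF assms] by (simp only: simp_thms)
qed

text \<open>Admits arguments that are not restricted to \<open>{..<n}\<close>, such as the pointwise
  scaled vectors.\<close>

lemma in_ellipsoid_subset:
  assumes "mv n A ` cunit_ball n \<subseteq> \<Omega>" "cnorm n w < 1"
  shows "mv n A w \<in> \<Omega>"
proof -
  define w' where "w' = (\<lambda>i\<in>{..<n}. w i)"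
  have "cnorm n w' = cnorm n w" unfolding cnorm_def by (rule L2_set_cong) (auto simp: w'_def)
  then have "w' \<in> cunit_ball n" using assms(2) by (simp add: cunit_ball_def w'_def)
  moreover have "mv n A w = mv n A w'" by (rule mv_cong) (simp add: w'_def)
  ultimately show ?thesis using assms(1) by auto
qed

text \<open>Ellipsoids inside \<open>\<Omega>\<close> converge to one inside the closure of \<open>\<Omega>\<close> only; but every smaller
  concentric copy of the limit is contained in the nearby ellipsoids.\<close>

lemma ellipsoid_limit:
  assumes NA: "\<And>z. z \<in> cspace n \<Longrightarrow> mv n A (mv n N z) = z"
    and near: "\<And>\<epsilon>. 0 < \<epsilon> \<Longrightarrow> \<exists>G. mv n G ` cunit_ball n \<subseteq> \<Omega> \<and>
      (\<forall>i<n. \<forall>j<n. cmod (mm n N G i j - (if i = j then 1 else 0)) < \<epsilon>)"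
    and y: "y \<in> cunit_ball n"
  shows "mv n A y \<in> \<Omega>"
proof -
  define s where "s = cnorm n y"
  have s: "0 \<le> s" "s < 1" and yc: "y \<in> cspace n" using y by (auto simp: s_def cunit_ball_def)
  \<comment> \<open>Then \<open>s < 1 - \<epsilon>\<close>, so a map bounded below by
    \<open>1 - \<epsilon>\<close> sends \<open>y\<close> back into the open unit ball.\<close>
  define \<epsilon> where "\<epsilon> = (1 - s) / 2"
  define \<eta> where "\<eta> = \<epsilon> / (real n * real n + 1)"
  have \<epsilon>: "0 < \<epsilon>" "\<epsilon> < 1" using s by (auto simp: \<epsilon>_def)
  then have \<eta>: "0 < \<eta>" by (simp add: \<eta>_def add_nonneg_pos)
  obtain G where G: "mv n G ` cunit_ball n \<subseteq> \<Omega>"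
    "\<And>i j. i < n \<Longrightarrow> j < n \<Longrightarrow> cmod (mm n N G i j - (if i = j then 1 else 0)) < \<eta>"
    using near[OF \<eta>] by auto
  define P where "P = mm n N G"
  \<comment> \<open>\<open>P\<close> is entrywise close to the identity and so bounded below by
    \<open>1 - \<epsilon>\<close>. This gives both its injectivity and the norm bound for the
    preimage of \<open>y\<close>.\<close>
  have close: "cnorm n w \<le> cnorm n (mv n P w) + \<epsilon> * cnorm n w" if w: "w \<in> cspace n" for w
  proof -
    define r where "r = (\<lambda>i. mv n P w i - w i)"
    have r: "cmod (r i) \<le> n * \<eta> * cnorm n w" if i: "i < n" for i
    proof -
      have "r i = (\<Sum>j<n. P i j * w j) - (\<Sum>j<n. if i = j then w j else 0)"
        using i by (simp add: r_def mv_def)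
      also have "\<dots> = (\<Sum>j<n. (P i j - (if i = j then 1 else 0)) * w j)"
        unfolding sum_subtractf[symmetric] by (rule sum.cong) (auto simp: algebra_simps)
      finally have "cmod (r i) \<le> (\<Sum>j<n. cmod ((P i j - (if i = j then 1 else 0)) * w j))"
        by (simp only: norm_sum)
      also have "\<dots> \<le> (\<Sum>j<n. \<eta> * cnorm n w)"
        unfolding norm_mult using i G(2)
        by (intro sum_mono mult_mono component_le_cnorm) (auto simp: P_def less_imp_le intro: order_trans[OF norm_ge_zero less_imp_le])
      finally show ?thesis by simp
    qed
    have "w = (\<lambda>i\<in>{..<n}. mv n P w i - r i)" using w by (intro cspace_eqI) (auto simp: r_def)
    then have "cnorm n w \<le> cnorm n (mv n P w) + (\<Sum>i<n. cmod (r i))"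
      using cnorm_triangle_diff[of n "mv n P w" r] by simp
    also have "(\<Sum>i<n. cmod (r i)) \<le> (\<Sum>i<n. n * \<eta> * cnorm n w)"
      by (intro sum_mono r) simp
    also have "\<dots> = \<epsilon> * (real n * real n / (real n * real n + 1)) * cnorm n w" by (simp add: \<eta>_def)
    also have "\<dots> \<le> \<epsilon> * 1 * cnorm n w"
      using \<epsilon> by (intro mult_right_mono mult_left_mono) (auto simp: divide_le_eq add_nonneg_pos)
    finally show ?thesis by simp
  qed
  have mvdiff: "mv n P (\<lambda>i\<in>{..<n}. v i - w i) i = mv n P v i - mv n P w i" if "i < n" for v w i
    using that by (simp add: mv_def sum_subtractf algebra_simps)
  have "inj_on (mv n P) (cspace n)"
  proof (rule inj_onI)
    fix v w assume v: "v \<in> cspace n" and w: "w \<in> cspace n" and eq: "mv n P v = mv n P w"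
    define x where "x = (\<lambda>i\<in>{..<n}. v i - w i)"
    have x: "x \<in> cspace n" by (simp add: x_def)
    have "mv n P x = czero n"
      by (rule cspace_eqI[OF mv_cspace cspace_czero]) (simp add: x_def mvdiff eq czero_def)
    then have "cnorm n x \<le> \<epsilon> * cnorm n x" using close[OF x] by simp
    moreover have "\<epsilon> * cnorm n x \<le> cnorm n x" using \<epsilon> by (simp add: mult_left_le_one_le)
    ultimately have "(1 - \<epsilon>) * cnorm n x = 0" by (simp add: algebra_simps)
    then have xz: "x = czero n" using \<epsilon> cnorm_eq_0_iff[OF x] by simp
    have "v i = w i" if "i < n" for i
      using fun_cong[OF xz, of i] that by (simp add: x_def czero_def)
    then show "v = w" by (rule cspace_eqI[OF v w])
  qed
  from cdet_nonzeroI[OF this] obtain Q where Q: "\<And>z. z \<in> cspace n \<Longrightarrow> mv n P (mv n Q z) = z"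
    by (rule cdet_inverse) blast
  define w where "w = mv n Q y"
  have w: "mv n P w = y" unfolding w_def by (rule Q[OF yc])
  have "(1 - \<epsilon>) * cnorm n w \<le> s" using close[of w] w by (simp add: w_def s_def algebra_simps)
  also have "s < 1 - \<epsilon>" using s by (simp add: \<epsilon>_def field_simps)
  finally have "cnorm n w < 1" using \<epsilon> by simp
  then have "mv n G w \<in> \<Omega>" by (rule in_ellipsoid_subset[OF G(1)])
  moreover have "mv n A y = mv n G w"
    using NA[OF mv_cspace, of G w] w by (simp add: P_def mv_mm)
  ultimately show ?thesis by simp
qed

text \<open>Since \<open>\<Omega>\<close> is bounded, matrices that map the ball into it have
  bounded entries, and the determinant attains its largest modulus on the closure of the set of
  these matrices. A small ball around the origin makes this maximum positive; an invertible
  maximiser can be compared with admissible matrices near it, and \<open>ellipsoid_limit\<close>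
  shows that it is admissible itself.\<close>

lemma maximal_ellipsoid_exists:
  assumes \<Omega>: "openin (ctop n) \<Omega>" and z0: "czero n \<in> \<Omega>" and bd: "cbounded n \<Omega>"
  obtains A where "cdet n A \<noteq> 0" "maximal_ellipsoid n \<Omega> (mv n A ` cunit_ball n)"
proof -
  obtain R where R: "\<And>z. z \<in> \<Omega> \<Longrightarrow> cnorm n z \<le> R" using bd unfolding cbounded_def by blast
  \<comment> \<open>Entries with an index from \<open>n\<close> on are fixed to zero, so that the
    set of matrices is a product of compact sets.\<close>
  define F where "F = (\<lambda>p::nat \<times> nat. if fst p < n \<and> snd p < n then cball 0 (2 * R) else {0::complex})"
  define K where "K = PiE UNIV F"
  have "compactin (product_topology (\<lambda>_. euclidean) (UNIV :: (nat \<times> nat) set)) K"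
    unfolding K_def compactin_PiE by (auto simp: F_def)
  then have K: "compact K" by (simp add: euclidean_product_topology)
  define M where "M = (\<lambda>(g :: nat \<times> nat \<Rightarrow> complex) i j. g (i, j))"
  define good where "good = {g \<in> K. mv n (M g) ` cunit_ball n \<subseteq> \<Omega>}"
  define S where "S = closure good"
  have "closed K" using K by (rule compact_imp_closed)
  then have SK: "S \<subseteq> K" unfolding S_def by (intro closure_minimal) (auto simp: good_def)
  have S: "compact S"
  proof -
    have "S = K \<inter> S" using SK by blast
    moreover have "compact (K \<inter> S)" using K by (rule compact_Int_closed) (simp add: S_def)
    ultimately show ?thesis by simp
  qed
  have trunc: "\<exists>g\<in>good. cdet n (M g) = cdet n A" if A: "mv n A ` cunit_ball n \<subseteq> \<Omega>" for A
  proof -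
    define g where "g = (\<lambda>p. if fst p < n \<and> snd p < n then A (fst p) (snd p) else 0)"
    have eq: "M g i j = A i j" if "i < n" "j < n" for i j using that by (simp add: M_def g_def)
    have "g \<in> K" unfolding K_def
    proof (rule PiE_I)
      fix p :: "nat \<times> nat"
      show "g p \<in> F p"
      proof (cases "fst p < n \<and> snd p < n")
        case True
        \<comment> \<open>Half a basis vector lies in the open ball and is mapped to half a column,
          whence the bound \<open>2 * R\<close>.\<close>
        define e where "e = (\<lambda>i. if i = snd p then 1/2 else (0::complex))"
        have "cnorm n e \<le> (\<Sum>i<n. cmod (e i))" by (rule cnorm_le_sum)
        also have "\<dots> = (\<Sum>i<n. if i = snd p then 1/2 else 0)" by (rule sum.cong) (auto simp: e_def)
        also have "\<dots> < 1" using True by simp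
        finally have "mv n A e \<in> \<Omega>" by (rule in_ellipsoid_subset[OF A])
        then have "cnorm n (mv n A e) \<le> R" by (rule R)
        moreover have "cmod (mv n A e (fst p)) \<le> cnorm n (mv n A e)" using True by (intro component_le_cnorm) simp
        moreover have "mv n A e (fst p) = A (fst p) (snd p) / 2"
          using True by (simp add: mv_def e_def if_distrib[of "\<lambda>x. _ * x"] cong: if_cong)
        ultimately have "cmod (A (fst p) (snd p)) \<le> 2 * R" by (simp add: norm_divide)
        then show ?thesis using True by (simp add: F_def g_def)
      next
        case False
        then have "g p = 0" "F p = {0}" unfolding g_def F_def by (simp_all only: if_False)
        then show ?thesis by simp
      qed
    qed simp
    moreover have "mv n (M g) z = mv n A z" for z by (rule mv_mat_cong[OF eq])
    then have "mv n (M g) ` cunit_ball n \<subseteq> \<Omega>" using A by simp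
    moreover have "cdet n (M g) = cdet n A" unfolding cdet_def by (simp only: jmat_cong[OF eq])
    ultimately show ?thesis unfolding good_def by blast
  qed
  have cont: "continuous_on S (\<lambda>g. cmod (cdet n (M g)))"
    unfolding cdet_sum_perms M_def
    by (intro continuous_on_norm continuous_on_sum continuous_on_mult continuous_on_const continuous_on_prod
        continuous_on_subset[OF continuous_on_product_coordinates subset_UNIV])
  obtain e where e: "e > 0" "\<And>w. w \<in> cspace n \<Longrightarrow> (\<And>i. i < n \<Longrightarrow> cmod (w i - czero n i) < e) \<Longrightarrow> w \<in> \<Omega>"
    using openin_cspace_ball[OF \<Omega> z0] by blast
  define A0 where "A0 = dgm (\<lambda>_. complex_of_real (e / 2))"
  have "mv n A0 ` cunit_ball n \<subseteq> \<Omega>"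
  proof
    fix y assume "y \<in> mv n A0 ` cunit_ball n"
    then obtain z where z: "z \<in> cunit_ball n" "y = mv n A0 z" by blast
    show "y \<in> \<Omega>"
    proof (rule e(2))
      fix i assume i: "i < n"
      have "cmod (z i) \<le> 1" using component_le_cnorm[OF i, of z] z(1) by (simp add: cunit_ball_def)
      then have "e / 2 * cmod (z i) \<le> e / 2 * 1" using e(1) by (intro mult_left_mono) auto
      moreover have "cmod (y i - czero n i) = e / 2 * cmod (z i)"
        using i e(1) by (simp add: z(2) A0_def mv_dgm czero_def norm_mult)
      ultimately show "cmod (y i - czero n i) < e" using e(1) by linarith
    qed (simp add: z(2))
  qed
  then obtain g1 where g1: "g1 \<in> good" "cdet n (M g1) = cdet n A0" using trunc by blast
  have goodS: "good \<subseteq> S" unfolding S_def by (rule closure_subset)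
  have "S \<noteq> {}" using g1 goodS by blast
  from continuous_attains_sup[OF S this cont] obtain g0 where g0: "g0 \<in> S"
    and max: "\<And>g. g \<in> S \<Longrightarrow> cmod (cdet n (M g)) \<le> cmod (cdet n (M g0))" by blast
  have "cmod (cdet n A0) > 0" using e(1) by (simp add: A0_def cdet_dgm)
  then have "cmod (cdet n (M g0)) > 0" using max[of g1] g1 goodS by auto
  then have det0: "cdet n (M g0) \<noteq> 0" by auto
  obtain N where N: "\<And>z. z \<in> cspace n \<Longrightarrow> mv n (M g0) (mv n N z) = z" "\<And>z. z \<in> cspace n \<Longrightarrow> mv n N (mv n (M g0) z) = z"
    using det0 by (rule cdet_inverse) blast
  have NM: "mm n N (M g0) i j = (if i = j then 1 else 0)" if "i < n" "j < n" for i j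
  proof -
    define e where "e = (\<lambda>i\<in>{..<n}. if i = j then 1 else (0::complex))"
    have "e \<in> cspace n" by (simp add: e_def)
    from fun_cong[OF N(2)[OF this, folded mv_mm], of i]
    have "mv n (mm n N (M g0)) e i = e i" .
    moreover have "mv n (mm n N (M g0)) e i = mm n N (M g0) i j"
      using that by (simp add: mv_def e_def if_distrib[of "\<lambda>x. _ * x"] cong: if_cong)
    ultimately show ?thesis using that by (simp add: e_def)
  qed
  have inside: "mv n (M g0) ` cunit_ball n \<subseteq> \<Omega>"
  proof (rule image_subsetI, rule ellipsoid_limit[OF N(1)])
    fix \<epsilon> :: real assume \<epsilon>: "0 < \<epsilon>"
    define Nb where "Nb = (\<Inter>p\<in>{..<n} \<times> {..<n}. {g. cmod (mm n N (M g) (fst p) (snd p) - (if fst p = snd p then 1 else 0)) < \<epsilon>})"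
    have o: "open {g. cmod (mm n N (M g) i j - (if i = j then 1 else 0)) < \<epsilon>}" for i j
      unfolding mm_def M_def
      by (intro open_Collect_less continuous_on_norm continuous_on_diff continuous_on_sum continuous_on_mult
          continuous_on_const continuous_on_product_coordinates)
    have "open Nb" unfolding Nb_def by (intro open_INT ballI o finite_cartesian_product finite_lessThan)
    moreover have "g0 \<in> Nb" unfolding Nb_def
    proof (rule INT_I)
      fix p assume "p \<in> {..<n} \<times> {..<n}"
      then show "g0 \<in> {g. cmod (mm n N (M g) (fst p) (snd p) - (if fst p = snd p then 1 else 0)) < \<epsilon>}"
        using NM[of "fst p" "snd p"] \<epsilon> by auto
    qed
    ultimately have "Nb \<inter> good \<noteq> {}" using g0 open_Int_closure_eq_empty[of Nb good] unfolding S_def by blast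
    then obtain g where g: "g \<in> Nb" "g \<in> good" by blast
    show "\<exists>G. mv n G ` cunit_ball n \<subseteq> \<Omega> \<and> (\<forall>i<n. \<forall>j<n. cmod (mm n N G i j - (if i = j then 1 else 0)) < \<epsilon>)"
    proof (intro exI[of _ "M g"] conjI allI impI)
      show "mv n (M g) ` cunit_ball n \<subseteq> \<Omega>" using g(2) by (simp add: good_def)
      show "cmod (mm n N (M g) i j - (if i = j then 1 else 0)) < \<epsilon>" if "i < n" "j < n" for i j
        using INT_D[OF g(1)[unfolded Nb_def], of "(i, j)"] that by simp
    qed
  qed
  have "maximal_ellipsoid n \<Omega> (mv n (M g0) ` cunit_ball n)"
    unfolding maximal_ellipsoid_iff[OF det0]
  proof (intro conjI allI impI inside)
    fix B assume "mv n B ` cunit_ball n \<subseteq> \<Omega>"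
    then obtain g where "g \<in> good" "cdet n (M g) = cdet n B" using trunc by blast
    then show "cmod (cdet n B) \<le> cmod (cdet n (M g0))" using max[of g] goodS by auto
  qed
  with det0 show thesis using that by blast
qed

lemma maximal_ellipsoid_unique:
  assumes pc: "pseudoconvex n \<Omega>" and z0: "czero n \<in> \<Omega>"
    and nodisc: "\<not> (\<exists>D. holomorphic_disc n D \<and> D \<subseteq> ctop n frontier_of \<Omega>)"
    and A: "cdet n A \<noteq> 0" "maximal_ellipsoid n \<Omega> (mv n A ` cunit_ball n)"
    and B: "cdet n B \<noteq> 0" "maximal_ellipsoid n \<Omega> (mv n B ` cunit_ball n)"
  shows "mv n A ` cunit_ball n = mv n B ` cunit_ball n"
proof -
  have \<Omega>: "openin (ctop n) \<Omega>" using pc by (simp add: pseudoconvex_def)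
  have AI: "mv n A ` cunit_ball n \<subseteq> \<Omega>" and BI: "mv n B ` cunit_ball n \<subseteq> \<Omega>"
    and Amax: "\<And>C. cdet n C \<noteq> 0 \<Longrightarrow> mv n C ` cunit_ball n \<subseteq> \<Omega> \<Longrightarrow> cmod (cdet n C) \<le> cmod (cdet n A)"
    and Bmax: "\<And>C. cdet n C \<noteq> 0 \<Longrightarrow> mv n C ` cunit_ball n \<subseteq> \<Omega> \<Longrightarrow> cmod (cdet n C) \<le> cmod (cdet n B)"
    using A(2) B(2) unfolding maximal_ellipsoid_iff[OF A(1)] maximal_ellipsoid_iff[OF B(1)] by blast+
  have det: "cmod (cdet n A) = cmod (cdet n B)"
    using Amax[OF B(1) BI] Bmax[OF A(1) AI] by (rule antisym[rotated])
  obtain N where N: "\<And>z. z \<in> cspace n \<Longrightarrow> mv n A (mv n N z) = z" "cdet n A * cdet n N = 1"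
    using A(1) by (rule cdet_inverse) blast
  \<comment> \<open>\<open>N\<close> is the inverse of \<open>A\<close>, so \<open>T\<close>
    measures the second ellipsoid against the first; equal volumes give its determinant modulus
    1.\<close>
  define T where "T = mm n N B"
  have "cmod (cdet n A) * cmod (cdet n N) = 1" using N(2) by (metis norm_mult norm_one)
  then have dT: "cmod (cdet n T) = 1" unfolding T_def cdet_mm norm_mult det[symmetric] by (simp add: mult.commute)
  then have "cdet n T \<noteq> 0" by auto
  then obtain U W d where U: "unitary n U" and W: "unitary n W" and d: "\<And>j. 0 < (d j :: real)"
    and dd: "cmod (cdet n T) = (\<Prod>j<n. d j)"
    and eq: "\<And>z. mv n T (mv n U z) = mv n W (\<lambda>j. of_real (d j) * z j)"
    using singular_value_decomposition[of n T] by metis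
  have d1: "(\<Prod>j<n. d j) = 1" using dT dd by simp
  \<comment> \<open>Unitary maps preserve the ball, so \<open>W\<close> can be absorbed into
    \<open>A\<close> and \<open>U\<close> dropped: the ellipsoids become the images of the ball
    under \<open>S\<close> and under \<open>S\<close> after the diagonal map.\<close>
  define S where "S = mm n A W"
  have SA: "mv n S ` cunit_ball n = mv n A ` cunit_ball n"
    unfolding S_def mv_mm by (simp only: image_image[symmetric] unitary_image_cunit_ball[OF W])
  have BT: "mv n B z = mv n A (mv n T z)" for z unfolding T_def mv_mm by (simp add: N(1))
  have SB: "mv n B ` cunit_ball n = (\<lambda>z. mv n S (\<lambda>j. of_real (d j) * z j)) ` cunit_ball n"
  proof -
    have "mv n B ` cunit_ball n = mv n B ` (mv n U ` cunit_ball n)" by (simp only: unitary_image_cunit_ball[OF U])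
    also have "\<dots> = (\<lambda>z. mv n A (mv n T (mv n U z))) ` cunit_ball n" by (simp only: image_image BT)
    finally show ?thesis unfolding eq S_def mv_mm .
  qed
  define \<mu> where "\<mu> = (\<lambda>j. ln (d j))"
  have exp\<mu>: "exp (complex_of_real (\<mu> j)) = of_real (d j)" for j
    unfolding exp_of_real \<mu>_def using d[of j] by simp
  have SA': "mv n S w \<in> \<Omega>" if "cnorm n w < 1" for w
    using AI that unfolding SA[symmetric] by (rule in_ellipsoid_subset)
  have SB': "mv n S (\<lambda>j. exp (of_real (\<mu> j)) * w j) \<in> \<Omega>" if "cnorm n w < 1" for w
  proof -
    have "mv n S (\<lambda>j. exp (of_real (\<mu> j)) * w j) = mv n (mm n S (dgm (\<lambda>j. of_real (d j)))) w"
      unfolding mv_mm by (rule mv_cong) (simp add: mv_dgm exp\<mu>)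
    moreover have "mv n (mm n S (dgm (\<lambda>j. of_real (d j)))) ` cunit_ball n = mv n B ` cunit_ball n"
      unfolding SB mv_mm by (intro image_cong refl mv_cong) (simp add: mv_dgm)
    ultimately show ?thesis using in_ellipsoid_subset[OF _ that] BI by metis
  qed
  have detS: "cmod (cdet n S) = cmod (cdet n A)"
    unfolding S_def cdet_mm norm_mult by (simp add: unitary_cdet[OF W])
  then have "cdet n S \<noteq> 0" using A(1) by auto
  then obtain NS where NS: "\<And>z. z \<in> cspace n \<Longrightarrow> mv n NS (mv n S z) = z" by (rule cdet_inverse) blast
  show ?thesis
  proof (cases "\<forall>j<n. \<mu> j = 0")
    case True
    then have "d j = 1" if "j < n" for j using that d[of j] by (auto simp: \<mu>_def)
    then have "mv n S (\<lambda>j. of_real (d j) * z j) = mv n S z" for z by (intro mv_cong) simp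
    then show ?thesis unfolding SB SA[symmetric] by simp
  next
    case False
    \<comment> \<open>A disc through a point with a nonzero coordinate in one of these directions is
      nonconstant.\<close>
    define J where "J = {j. j < n \<and> \<mu> j \<noteq> 0}"
    have J: "J \<subseteq> {..<n}" "J \<noteq> {}" using False by (auto simp: J_def)
    define M where "M = mm n S (dgm (\<lambda>j. exp (1/2 * complex_of_real (\<mu> j))))"
    have Mmv: "mv n M w = mv n S (\<lambda>j. exp (1/2 * complex_of_real (\<mu> j)) * w j)" for w
      unfolding M_def mv_mm by (rule mv_cong) (simp add: mv_dgm)
    have interp: "mv n S (\<lambda>j. exp (\<zeta> * of_real (\<mu> j)) * w j) \<in> \<Omega>"
      if "0 \<le> Re \<zeta>" "Re \<zeta> \<le> 1" "cnorm n w < 1" for \<zeta> w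
      by (rule ellipsoid_interpolation[OF pc z0 SA' SB' that])
    obtain a :: "nat \<Rightarrow> real" where a: "\<And>j. 0 < a j" "1 < (\<Prod>j<n. a j)"
      "\<And>w. cnorm n w < 1 \<Longrightarrow> mv n M (\<lambda>j. of_real (a j) * w j) \<in> \<Omega>"
    proof (rule stretched_ball_inside[OF \<Omega> _ J, of M])
      show "mv n M w \<in> \<Omega>" if "cnorm n w < 1" for w unfolding Mmv by (rule interp) (use that in auto)
      show "mv n M w \<in> \<Omega>" if "cnorm n w = 1" "k \<in> J" "w k \<noteq> 0" for w k
      proof -
        have k: "k < n" "\<mu> k \<noteq> 0" using that(2) by (simp_all add: J_def)
        show ?thesis unfolding Mmv
          by (rule ellipsoid_touching[OF pc z0 interp NS that(1) k(1) that(3) k(2) nodisc])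
      qed
    qed blast
    define C where "C = mm n M (dgm (\<lambda>j. of_real (a j)))"
    \<comment> \<open>Hence \<open>M\<close> has the same determinant as \<open>A\<close> in
      modulus, and the factor gained from \<open>a\<close> exceeds the maximum.\<close>
    have "(\<Prod>j<n. exp (\<mu> j / 2)) = 1"
    proof -
      have "(\<Prod>j<n. exp (\<mu> j / 2))\<^sup>2 = (\<Prod>j<n. d j)"
        unfolding prod_power_distrib
      proof (rule prod.cong[OF refl])
        fix j
        have "(exp (\<mu> j / 2))\<^sup>2 = exp (\<mu> j)" by (simp add: power2_eq_square exp_add[symmetric])
        then show "(exp (\<mu> j / 2))\<^sup>2 = d j" using d[of j] by (simp add: \<mu>_def)
      qed
      moreover have "0 \<le> (\<Prod>j<n. exp (\<mu> j / 2))" by (intro prod_nonneg) auto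
      ultimately show ?thesis using d1 by (simp add: power2_eq_1_iff)
    qed
    then have detM: "cmod (cdet n M) = cmod (cdet n S)"
      unfolding M_def cdet_mm cdet_dgm norm_mult by (simp add: prod_norm[symmetric] norm_exp_eq_Re)
    have "cmod (cdet n C) = cmod (cdet n A) * (\<Prod>j<n. a j)"
      unfolding C_def cdet_mm cdet_dgm norm_mult detM detS
      using a(1) by (simp add: prod_norm[symmetric] less_imp_le)
    moreover have "cmod (cdet n A) > 0" using A(1) by simp
    ultimately have gt: "cmod (cdet n C) > cmod (cdet n A)" using a(2) by simp
    then have "cdet n C \<noteq> 0" by auto
    moreover have "mv n C ` cunit_ball n \<subseteq> \<Omega>"
    proof
      fix y assume "y \<in> mv n C ` cunit_ball n"
      then obtain w where w: "w \<in> cunit_ball n" "y = mv n C w" by blast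
      have "y = mv n M (\<lambda>j. of_real (a j) * w j)"
        unfolding w(2) C_def mv_mm by (rule mv_cong) (simp add: mv_dgm)
      then show "y \<in> \<Omega>" using a(3)[of w] w(1) by (simp add: cunit_ball_def)
    qed
    ultimately show ?thesis using Amax[of C] gt by simp
  qed
qed

lemma maximal_ellipsoid_ex1:
  assumes "pseudoconvex n \<Omega>" "cbounded n \<Omega>" "czero n \<in> \<Omega>"
    and "\<not> (\<exists>D. holomorphic_disc n D \<and> D \<subseteq> ctop n frontier_of \<Omega>)"
  shows "\<exists>!E. maximal_ellipsoid n \<Omega> E"
proof -
  have \<Omega>: "openin (ctop n) \<Omega>" using assms(1) by (simp add: pseudoconvex_def)
  obtain A where A: "cdet n A \<noteq> 0" "maximal_ellipsoid n \<Omega> (mv n A ` cunit_ball n)"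
    using maximal_ellipsoid_exists[OF \<Omega> assms(3,2)] by blast
  show ?thesis
  proof (rule ex1I[of _ "mv n A ` cunit_ball n"])
    show "maximal_ellipsoid n \<Omega> (mv n A ` cunit_ball n)" by (rule A(2))
    fix E assume E: "maximal_ellipsoid n \<Omega> E"
    then obtain B where B: "cdet n B \<noteq> 0" "E = mv n B ` cunit_ball n"
      unfolding maximal_ellipsoid_def hermitian_ellipsoids_eq by blast
    show "E = mv n A ` cunit_ball n"
      unfolding B(2) by (rule maximal_ellipsoid_unique[OF assms(1,3,4) B(1) _ A]) (use E B(2) in simp)
  qed
qed

section \<open>A domain with several maximal ellipsoids\<close>

lemma cdet_2: "cdet 2 A = A 0 0 * A 1 1 - A 0 1 * A 1 0"
proof -
  have i: "{0..<2} = {0, 1::nat}" by auto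
  have p: "{p. p permutes {0, 1::nat}} = {id, Transposition.transpose 0 1}"
    by (simp add: permutes_doubleton_iff Collect_disj_eq insert_commute)
  have "id \<noteq> Transposition.transpose 0 (1::nat)"
  proof
    assume "id = Transposition.transpose 0 (1::nat)"
    from fun_cong[OF this, of 0] show False by simp
  qed
  then show ?thesis unfolding cdet_sum_perms i p by (simp add: sign_swap_id)
qed

section \<open>Subharmonicity of maxima and reciprocals\<close>

lemma cont_subharmonic_on_max:
  assumes f: "cont_subharmonic_on W f" and g: "cont_subharmonic_on W g"
  shows "cont_subharmonic_on W (\<lambda>\<tau>. max (f \<tau>) (g \<tau>))"
  unfolding cont_subharmonic_on_def
proof (intro conjI allI impI)
  have cf: "continuous_on W f" and cg: "continuous_on W g"
    using f g unfolding cont_subharmonic_on_def by blast+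
  then show cm: "continuous_on W (\<lambda>\<tau>. max (f \<tau>) (g \<tau>))" by (rule continuous_on_max)
  fix c :: complex and r :: real assume cr: "0 < r \<and> cball c r \<subseteq> W"
  have circ: "(\<lambda>\<theta>. h (c + of_real r * cis \<theta>)) integrable_on {0..2*pi}" if "continuous_on W h" for h :: "complex \<Rightarrow> real"
  proof (rule integrable_continuous_real, rule continuous_on_compose2[OF that])
    show "continuous_on {0..2*pi} (\<lambda>\<theta>. c + of_real r * cis \<theta>)" by (intro continuous_intros)
    show "(\<lambda>\<theta>. c + of_real r * cis \<theta>) ` {0..2*pi} \<subseteq> W"
    proof
      fix z assume "z \<in> (\<lambda>\<theta>. c + of_real r * cis \<theta>) ` {0..2*pi}"
      then have "z \<in> cball c r" using cr by (auto simp: dist_norm norm_mult)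
      then show "z \<in> W" using cr by blast
    qed
  qed
  have le: "h c \<le> 1 / (2 * pi) * integral {0..2 * pi} (\<lambda>\<theta>. max (f (c + of_real r * cis \<theta>)) (g (c + of_real r * cis \<theta>)))"
    if h: "cont_subharmonic_on W h" and hm: "\<And>z. h z \<le> max (f z) (g z)" for h
  proof -
    have "continuous_on W h" using h unfolding cont_subharmonic_on_def by blast
    have "h c \<le> 1 / (2 * pi) * integral {0..2 * pi} (\<lambda>\<theta>. h (c + of_real r * cis \<theta>))"
      using h cr unfolding cont_subharmonic_on_def by blast
    also have "\<dots> \<le> 1 / (2 * pi) * integral {0..2 * pi} (\<lambda>\<theta>. max (f (c + of_real r * cis \<theta>)) (g (c + of_real r * cis \<theta>)))"
      by (intro mult_left_mono integral_le circ[OF \<open>continuous_on W h\<close>] circ[OF cm] hm) simp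
    finally show ?thesis .
  qed
  show "max (f c) (g c) \<le> 1 / (2 * pi) * integral {0..2 * pi} (\<lambda>\<theta>. max (f (c + of_real r * cis \<theta>)) (g (c + of_real r * cis \<theta>)))"
    using le[OF f] le[OF g] by simp
qed

text \<open>The tangent line of the convex increasing function \<open>1 / (C - x)\<close> reduces the claim to the
  submean value property of \<open>\<bar>g\<bar>\<close>.\<close>

lemma cont_subharmonic_on_recip:
  assumes g: "g holomorphic_on UNIV" and C: "\<And>\<tau>. \<tau> \<in> W \<Longrightarrow> cmod (g \<tau>) < C"
  shows "cont_subharmonic_on W (\<lambda>\<tau>. 1 / (C - cmod (g \<tau>)))"
  unfolding cont_subharmonic_on_def
proof (intro conjI allI impI)
  have gc: "continuous_on S g" for S
    using holomorphic_on_imp_continuous_on[OF g] by (rule continuous_on_subset) simp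
  have nz: "C - cmod (g \<tau>) \<noteq> 0" if "\<tau> \<in> W" for \<tau> using C[OF that] by simp
  show cm: "continuous_on W (\<lambda>\<tau>. 1 / (C - cmod (g \<tau>)))"
    by (intro continuous_on_divide continuous_on_diff continuous_on_const continuous_on_norm gc) (use nz in blast)
  fix c :: complex and r :: real assume cr: "0 < r \<and> cball c r \<subseteq> W"
  define \<gamma> where "\<gamma> = (\<lambda>\<theta>. c + of_real r * cis \<theta>)"
  have \<gamma>c: "continuous_on S \<gamma>" for S unfolding \<gamma>_def by (intro continuous_intros)
  have g\<gamma>: "continuous_on S (\<lambda>\<theta>. g (\<gamma> \<theta>))" for S
    by (rule continuous_on_compose2[OF gc[of UNIV] \<gamma>c]) simp
  have \<gamma>W: "\<gamma> \<theta> \<in> W" for \<theta>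
  proof -
    have "\<gamma> \<theta> \<in> cball c r" using cr by (simp add: \<gamma>_def dist_norm norm_mult)
    then show ?thesis using cr by blast
  qed
  have cW: "c \<in> W" using cr by auto
  have gi: "((\<lambda>\<theta>. g (\<gamma> \<theta>)) has_integral (2 * pi * g c)) {0..2*pi}"
    unfolding \<gamma>_def using cr by (intro holomorphic_circle_mean[OF g]) auto
  have ni: "(\<lambda>\<theta>. cmod (g (\<gamma> \<theta>))) integrable_on {0..2*pi}"
    by (intro integrable_continuous_real continuous_on_norm g\<gamma>)
  have "cmod (integral {0..2*pi} (\<lambda>\<theta>. g (\<gamma> \<theta>))) \<le> integral {0..2*pi} (\<lambda>\<theta>. cmod (g (\<gamma> \<theta>)))"
    by (rule integral_norm_bound_integral) (use gi ni in \<open>auto simp: has_integral_integrable\<close>)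
  then have mean: "2 * pi * cmod (g c) \<le> integral {0..2*pi} (\<lambda>\<theta>. cmod (g (\<gamma> \<theta>)))"
    using integral_unique[OF gi] by (simp add: norm_mult)
  define x where "x = cmod (g c)"
  have x: "x < C" using C[OF cW] by (simp add: x_def)
  \<comment> \<open>The derivative of \<open>1 / (C - y)\<close> at \<open>y = x\<close>.\<close>
  define k where "k = 1 / (C - x)\<^sup>2"
  have k: "0 < k" using x by (simp add: k_def)
  have tangent: "1 / (C - x) + k * (y - x) \<le> 1 / (C - y)" if "y < C" for y
  proof -
    have "0 \<le> (y - x)\<^sup>2 / ((C - x)\<^sup>2 * (C - y))" using x that by simp
    also have "\<dots> = 1 / (C - y) - (1 / (C - x) + k * (y - x))"
      using x that unfolding k_def by (simp add: divide_simps power2_eq_square) (simp add: algebra_simps)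
    finally show ?thesis by simp
  qed
  have "2 * pi * (1 / (C - x)) \<le> 2 * pi * (1 / (C - x)) + k * (integral {0..2*pi} (\<lambda>\<theta>. cmod (g (\<gamma> \<theta>))) - 2 * pi * x)"
    using mean k by (simp add: x_def)
  also have "\<dots> = integral {0..2*pi} (\<lambda>\<theta>. 1 / (C - x) + k * (cmod (g (\<gamma> \<theta>)) - x))"
  proof -
    have const: "((\<lambda>_. y) has_integral (2 * pi * y)) {0..2*pi}" for y
      using has_integral_const_real[of y 0 "2*pi"] by simp
    have "((\<lambda>\<theta>. 1 / (C - x) + k * (cmod (g (\<gamma> \<theta>)) - x)) has_integral
      (2 * pi * (1 / (C - x)) + k * (integral {0..2*pi} (\<lambda>\<theta>. cmod (g (\<gamma> \<theta>))) - 2 * pi * x))) {0..2*pi}"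
      by (intro has_integral_add has_integral_mult_right has_integral_diff const integrable_integral[OF ni])
    then show ?thesis by (simp add: integral_unique)
  qed
  also have "\<dots> \<le> integral {0..2*pi} (\<lambda>\<theta>. 1 / (C - cmod (g (\<gamma> \<theta>))))"
  proof (rule integral_le)
    show "(\<lambda>\<theta>. 1 / (C - x) + k * (cmod (g (\<gamma> \<theta>)) - x)) integrable_on {0..2*pi}"
      by (intro integrable_continuous_real continuous_on_add continuous_on_mult continuous_on_diff continuous_on_const
          continuous_on_norm g\<gamma>)
    show "(\<lambda>\<theta>. 1 / (C - cmod (g (\<gamma> \<theta>)))) integrable_on {0..2*pi}"
      by (intro integrable_continuous_real continuous_on_compose2[OF cm \<gamma>c]) (use \<gamma>W in blast)
    show "1 / (C - x) + k * (cmod (g (\<gamma> \<theta>)) - x) \<le> 1 / (C - cmod (g (\<gamma> \<theta>)))" for \<theta>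
      by (rule tangent) (rule C[OF \<gamma>W])
  qed
  finally have "2 * pi * (1 / (C - x)) \<le> integral {0..2*pi} (\<lambda>\<theta>. 1 / (C - cmod (g (\<gamma> \<theta>))))" .
  from mult_left_mono[OF this, of "1 / (2 * pi)"]
  show "1 / (C - cmod (g c)) \<le> 1 / (2 * pi) * integral {0..2 * pi} (\<lambda>\<theta>. 1 / (C - cmod (g (c + of_real r * cis \<theta>))))"
    by (simp add: x_def \<gamma>_def)
qed

text \<open>The test vector is the sum of the conjugated rows, scaled to the common length
  \<open>R * Q\<close> and with a sign \<open>\<omega>\<close>; it bisects them. The two forms there
  have modulus \<open>R\<close> and \<open>Q\<close> times that of
  \<open>P + \<omega> * \<sigma>\<close>, so their product is \<open>P\<close> times a square, while
  the squared norm is \<open>2 * P * (P + \<omega> * Re \<sigma>)\<close>.\<close>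

lemma product_of_forms_lower_bound:
  fixes a b c d :: complex
  assumes det: "a * d - b * c \<noteq> 0"
  obtains x y where "0 < (cmod x)\<^sup>2 + (cmod y)\<^sup>2"
    "cmod (a * d - b * c) * ((cmod x)\<^sup>2 + (cmod y)\<^sup>2) / 2 \<le> cmod (a * x + b * y) * cmod (c * x + d * y)"
proof -
  define R where "R = sqrt ((cmod a)\<^sup>2 + (cmod b)\<^sup>2)"
  define Q where "Q = sqrt ((cmod c)\<^sup>2 + (cmod d)\<^sup>2)"
  define \<sigma> where "\<sigma> = a * cnj c + b * cnj d"
  \<comment> \<open>The sign makes \<open>\<omega> * Re \<sigma>\<close> nonnegative, so that the
    two summands of the test vector do not cancel.\<close>
  define \<omega> where "\<omega> = (if 0 \<le> Re \<sigma> then 1 else -1 :: real)"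
  define P where "P = R * Q"
  have R2: "R\<^sup>2 = (cmod a)\<^sup>2 + (cmod b)\<^sup>2" and Q2: "Q\<^sup>2 = (cmod c)\<^sup>2 + (cmod d)\<^sup>2" by (simp_all add: R_def Q_def)
  have R2c: "a * cnj a + b * cnj b = of_real (R\<^sup>2)" and Q2c: "c * cnj c + d * cnj d = of_real (Q\<^sup>2)"
    unfolding R2 Q2 of_real_add complex_norm_square by simp_all
  have RQ0: "0 \<le> R" "0 \<le> Q" by (simp_all add: R_def Q_def)
  \<comment> \<open>Lagrange's identity, which yields Hadamard's bound of the determinant by
    \<open>P\<close>.\<close>
  have lagrange: "P\<^sup>2 = (cmod \<sigma>)\<^sup>2 + (cmod (a * d - b * c))\<^sup>2"
    unfolding P_def power_mult_distrib R2 Q2 \<sigma>_def cmod_power2 by (simp add: power2_eq_square algebra_simps)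
  then have "(cmod (a * d - b * c))\<^sup>2 \<le> P\<^sup>2" by simp
  then have Pd: "cmod (a * d - b * c) \<le> P" by (rule power2_le_imp_le) (simp add: P_def RQ0)
  moreover have "0 < cmod (a * d - b * c)" using det by simp
  ultimately have P: "0 < P" by linarith
  have \<omega>: "\<omega> * \<omega> = 1" "\<bar>\<omega>\<bar> = 1" "0 \<le> \<omega> * Re \<sigma>" by (auto simp: \<omega>_def)
  define x where "x = of_real Q * cnj a + of_real (\<omega> * R) * cnj c"
  define y where "y = of_real Q * cnj b + of_real (\<omega> * R) * cnj d"
  have "a * x + b * y = of_real Q * (a * cnj a + b * cnj b) + of_real (\<omega> * R) * \<sigma>"
    by (simp add: x_def y_def \<sigma>_def algebra_simps)
  also have "\<dots> = of_real R * (of_real P + of_real \<omega> * \<sigma>)"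
    unfolding R2c by (simp add: P_def power2_eq_square algebra_simps)
  finally have 1: "cmod (a * x + b * y) = R * cmod (of_real P + of_real \<omega> * \<sigma>)"
    using RQ0 by (simp add: norm_mult)
  have "c * x + d * y = of_real Q * cnj \<sigma> + of_real (\<omega> * R) * (c * cnj c + d * cnj d)"
    by (simp add: x_def y_def \<sigma>_def algebra_simps)
  also have "\<dots> = of_real (\<omega> * \<omega>) * (of_real Q * cnj \<sigma>) + of_real (\<omega> * R) * of_real (Q\<^sup>2)" unfolding Q2c \<omega>(1) by simp
  also have "\<dots> = of_real (\<omega> * Q) * cnj (of_real P + of_real \<omega> * \<sigma>)"
    by (simp add: P_def power2_eq_square algebra_simps)
  finally have 2: "cmod (c * x + d * y) = Q * cmod (of_real P + of_real \<omega> * \<sigma>)"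
    using RQ0 \<omega>(2) by (simp only: norm_mult complex_mod_cnj norm_of_real abs_mult)
  have "(cmod x)\<^sup>2 + (cmod y)\<^sup>2 = Q\<^sup>2 * ((cmod a)\<^sup>2 + (cmod b)\<^sup>2) + (\<omega> * \<omega>) * R\<^sup>2 * ((cmod c)\<^sup>2 + (cmod d)\<^sup>2)
      + 2 * \<omega> * R * Q * Re \<sigma>"
    unfolding x_def y_def \<sigma>_def cmod_power2 by (simp add: power2_eq_square algebra_simps)
  also have "\<dots> = 2 * P * (P + \<omega> * Re \<sigma>)"
    unfolding R2[symmetric] Q2[symmetric] \<omega>(1) P_def by (simp add: power2_eq_square algebra_simps)
  finally have n: "(cmod x)\<^sup>2 + (cmod y)\<^sup>2 = 2 * P * (P + \<omega> * Re \<sigma>)" .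
  have "P + \<omega> * Re \<sigma> \<le> cmod (of_real P + of_real \<omega> * \<sigma>)"
    using complex_Re_le_cmod[of "of_real P + of_real \<omega> * \<sigma>"] by simp
  then have "(P + \<omega> * Re \<sigma>)\<^sup>2 \<le> (cmod (of_real P + of_real \<omega> * \<sigma>))\<^sup>2" using P \<omega>(3) by (intro power_mono) auto
  moreover have "P * (P + \<omega> * Re \<sigma>) \<le> (P + \<omega> * Re \<sigma>)\<^sup>2"
    unfolding power2_eq_square using P \<omega>(3) by (intro mult_right_mono) auto
  ultimately have "P * (P * (P + \<omega> * Re \<sigma>)) \<le> P * (cmod (of_real P + of_real \<omega> * \<sigma>))\<^sup>2"
    using P by (intro mult_left_mono) auto
  moreover have "cmod (a * d - b * c) * (P * (P + \<omega> * Re \<sigma>)) \<le> P * (P * (P + \<omega> * Re \<sigma>))"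
    using Pd P \<omega>(3) by (intro mult_right_mono) auto
  ultimately have "cmod (a * d - b * c) * ((cmod x)\<^sup>2 + (cmod y)\<^sup>2) / 2 \<le> cmod (a * x + b * y) * cmod (c * x + d * y)"
    unfolding n 1 2 by (simp add: P_def power2_eq_square algebra_simps)
  moreover have "0 < (cmod x)\<^sup>2 + (cmod y)\<^sup>2" unfolding n using P \<omega>(3) by (intro mult_pos_pos) auto
  ultimately show thesis using that by blast
qed

text \<open>The bounds by 2 cut an unbounded set down to a bounded one that still contains the
  ellipsoids for all \<open>d\<close> between 1/2 and 2.\<close>

definition hyp_bidisc :: "(nat \<Rightarrow> complex) set" where
  "hyp_bidisc = {z \<in> cspace 2. cmod (z 0 * z 1) < 1/2 \<and> cmod (z 0) < 2 \<and> cmod (z 1) < 2}"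

lemma lessThan_2: "{..<2::nat} = {0, 1}"
  by auto

lemma hyp_bidisc_openin: "openin (ctop 2) hyp_bidisc"
proof -
  have "open {z::nat\<Rightarrow>complex. cmod (z 0 * z 1) < 1/2}"
    by (intro open_Collect_less continuous_on_norm continuous_on_mult continuous_on_product_coordinates continuous_on_const)
  moreover have "open {z::nat\<Rightarrow>complex. cmod (z i) < 2}" for i
    by (intro open_Collect_less continuous_on_norm continuous_on_product_coordinates continuous_on_const)
  ultimately have "open ({z::nat\<Rightarrow>complex. cmod (z 0 * z 1) < 1/2} \<inter> ({z. cmod (z 0) < 2} \<inter> {z. cmod (z 1) < 2}))"
    by (intro open_Int)
  moreover have "hyp_bidisc = cspace 2 \<inter> ({z::nat\<Rightarrow>complex. cmod (z 0 * z 1) < 1/2} \<inter> ({z. cmod (z 0) < 2} \<inter> {z. cmod (z 1) < 2}))"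
    unfolding hyp_bidisc_def by blast
  ultimately show ?thesis unfolding ctop_eq openin_open by blast
qed

lemma hyp_bidisc_zero: "czero 2 \<in> hyp_bidisc"
  unfolding hyp_bidisc_def using cspace_czero[of 2] by (simp add: czero_def)

text \<open>The set is star-shaped about the origin, hence a union of segments with a common
  point.\<close>

lemma hyp_bidisc_cdomain: "cdomain 2 hyp_bidisc"
proof -
  define L where "L = (\<lambda>z. (\<lambda>t. cscale 2 (complex_of_real t) z) ` {0..1})"
  have conn: "connected (L z)" for z
    unfolding L_def
  proof (rule connected_continuous_image[OF _ connected_Icc])
    show "continuous_on {0..1} (\<lambda>t. cscale 2 (complex_of_real t) z)"
    proof (rule continuous_on_into_cspace)
      show "continuous_on {0..1} (\<lambda>t. cscale 2 (complex_of_real t) z i)" if "i < 2" for i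
        using that unfolding cscale_def by (simp, intro continuous_intros)
    qed simp
  qed
  have zL: "czero 2 \<in> L z" for z
  proof -
    have "czero 2 = cscale 2 (complex_of_real 0) z" unfolding czero_def cscale_def by (rule restrict_ext) simp
    then show ?thesis unfolding L_def by (rule image_eqI) simp
  qed
  have "czero 2 \<in> \<Inter>(L ` hyp_bidisc)" using zL by blast
  then have "connected (\<Union>(L ` hyp_bidisc))"
    using conn by (intro connected_Union) blast+
  moreover have "\<Union>(L ` hyp_bidisc) = hyp_bidisc"
  proof (rule subset_antisym; rule subsetI)
    fix w assume "w \<in> \<Union>(L ` hyp_bidisc)"
    then obtain z t where z: "z \<in> hyp_bidisc" and t: "0 \<le> t" "t \<le> 1" and w: "w = cscale 2 (complex_of_real t) z"
      unfolding L_def by auto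
    have le: "cmod (w i) \<le> cmod (z i)" if "i < 2" for i
    proof -
      have "cmod (w i) = t * cmod (z i)" using that t by (simp add: w cscale_def norm_mult)
      also have "\<dots> \<le> 1 * cmod (z i)" using t by (intro mult_right_mono) auto
      finally show ?thesis by simp
    qed
    have "cmod (w 0) * cmod (w 1) \<le> cmod (z 0) * cmod (z 1)" by (intro mult_mono le) auto
    then show "w \<in> hyp_bidisc"
      using z le[of 0] le[of 1] unfolding hyp_bidisc_def by (simp add: w norm_mult)
  next
    fix z assume z: "z \<in> hyp_bidisc"
    then have "z \<in> cspace 2" unfolding hyp_bidisc_def by blast
    then have "z = cscale 2 (complex_of_real 1) z"
      by (rule cspace_eqI[OF _ cspace_cscale]) (simp add: cscale_def)
    then have "z \<in> L z" unfolding L_def by (rule image_eqI) simp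
    then show "z \<in> \<Union>(L ` hyp_bidisc)" using z by blast
  qed
  moreover have "hyp_bidisc \<subseteq> cspace 2" unfolding hyp_bidisc_def by blast
  ultimately show ?thesis unfolding cdomain_def
    using hyp_bidisc_openin by (simp add: ctop_eq connectedin_subtopology)
qed

lemma hyp_bidisc_cbounded: "cbounded 2 hyp_bidisc"
  unfolding cbounded_def
proof (intro exI ballI)
  fix z assume z: "z \<in> hyp_bidisc"
  have "cnorm 2 z \<le> (\<Sum>i<2. cmod (z i))" by (rule cnorm_le_sum)
  also have "\<dots> \<le> 4" using z unfolding lessThan_2 hyp_bidisc_def by simp
  finally show "cnorm 2 z \<le> 4" .
qed

text \<open>Each of the three conditions has the form \<open>cmod g < C\<close> with
  \<open>g\<close> holomorphic; the maximum of the functions \<open>1 / (C - cmod g)\<close> is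
  plurisubharmonic and tends to infinity at the boundary.\<close>

lemma hyp_bidisc_pseudoconvex: "pseudoconvex 2 hyp_bidisc"
proof -
  let ?\<Omega> = hyp_bidisc
  define u where "u = (\<lambda>z::nat\<Rightarrow>complex. max (1 / (1/2 - cmod (z 0 * z 1))) (max (1 / (2 - cmod (z 0))) (1 / (2 - cmod (z 1)))))"
  have \<Omega>: "z \<in> cspace 2" "cmod (z 0 * z 1) < 1/2" "cmod (z 0) < 2" "cmod (z 1) < 2" if "z \<in> ?\<Omega>" for z
    using that unfolding hyp_bidisc_def by blast+
  have sub: "?\<Omega> \<subseteq> cspace 2" using \<Omega>(1) by blast
  have "continuous_on ?\<Omega> u"
    unfolding u_def
  proof (intro continuous_on_const continuous_on_max continuous_on_divide continuous_on_diff continuous_on_norm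
      continuous_on_mult continuous_on_subset[OF continuous_on_product_coordinates subset_UNIV] ballI)
    fix z assume "z \<in> ?\<Omega>"
    from \<Omega>[OF this] show "1/2 - cmod (z 0 * z 1) \<noteq> 0" "2 - cmod (z 0) \<noteq> 0" "2 - cmod (z 1) \<noteq> 0" by linarith+
  qed
  then have cm: "continuous_map (subtopology (ctop 2) ?\<Omega>) euclideanreal u"
    by (simp only: continuous_map_ctop_iff[OF sub])
  have psh: "cont_subharmonic_on {\<tau>. cadd 2 a (cscale 2 \<tau> b) \<in> ?\<Omega>} (\<lambda>\<tau>. u (cadd 2 a (cscale 2 \<tau> b)))"
    for a b
  proof -
    let ?z = "\<lambda>\<tau>. cadd 2 a (cscale 2 \<tau> b)"
    have co: "?z \<tau> i = a i + \<tau> * b i" if "i < 2" for i \<tau> using that by (simp add: cadd_def cscale_def)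
    have hol: "(\<lambda>\<tau>. ?z \<tau> i) holomorphic_on UNIV" if "i < 2" for i
      unfolding co[OF that] by (intro holomorphic_intros)
    show ?thesis unfolding u_def
      by (intro cont_subharmonic_on_max cont_subharmonic_on_recip holomorphic_on_mult hol)
         (use \<Omega> in auto)
  qed
  have cpt: "compactin (ctop 2) {z\<in>?\<Omega>. u z \<le> c}" for c
    unfolding compactin_ctop
  proof
    have recip: "1 / (C - x) \<le> c \<longleftrightarrow> x \<le> C - 1 / c" if "0 < c" "x < C" for C x :: real
      using that by (simp add: field_simps)
    show "compact {z\<in>?\<Omega>. u z \<le> c}"
    \<comment> \<open>For \<open>c \<le> 0\<close> the sublevel set is empty because
      \<open>u\<close> is positive; for \<open>c > 0\<close> it is given by the closed conditions
      \<open>cmod g \<le> C - 1 / c\<close>.\<close>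
    proof (cases "0 < c")
      case False
      have "0 < u z" if "z \<in> ?\<Omega>" for z
      proof -
        have "0 < 1 / (2 - cmod (z 0))" using \<Omega>(3)[OF that] by simp
        then show ?thesis unfolding u_def by linarith
      qed
      then have "{z\<in>?\<Omega>. u z \<le> c} = {}" using False by fastforce
      then show ?thesis by (simp only: compact_empty)
    next
      case True
      have eq: "{z\<in>?\<Omega>. u z \<le> c} = cspace 2 \<inter> ({z. cmod (z 0 * z 1) \<le> 1/2 - 1/c} \<inter>
          ({z. cmod (z 0) \<le> 2 - 1/c} \<inter> {z. cmod (z 1) \<le> 2 - 1/c}))" (is "_ = ?K")
      proof (rule subset_antisym; rule subsetI)
        fix z assume z: "z \<in> {z\<in>?\<Omega>. u z \<le> c}"
        then show "z \<in> ?K" using \<Omega>[of z] recip[OF True] unfolding u_def by simp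
      next
        fix z assume z: "z \<in> ?K"
        have "1 / c > 0" using True by simp
        moreover from z have "z \<in> cspace 2" "cmod (z 0 * z 1) \<le> 1/2 - 1/c" "cmod (z 0) \<le> 2 - 1/c" "cmod (z 1) \<le> 2 - 1/c"
          by blast+
        ultimately have "z \<in> ?\<Omega>" unfolding hyp_bidisc_def by (intro CollectI conjI) linarith+
        then show "z \<in> {z\<in>?\<Omega>. u z \<le> c}" using z \<Omega>[of z] recip[OF True] unfolding u_def by simp
      qed
      have c1: "closed {z::nat\<Rightarrow>complex. cmod (z 0 * z 1) \<le> 1/2 - 1/c}"
        by (intro closed_Collect_le continuous_on_norm continuous_on_mult continuous_on_product_coordinates continuous_on_const)
      have c2: "closed {z::nat\<Rightarrow>complex. cmod (z i) \<le> 2 - 1/c}" for i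
        by (intro closed_Collect_le continuous_on_norm continuous_on_product_coordinates continuous_on_const)
      show ?thesis
      proof (rule cspace_bounded_closed_compact)
        show "{z\<in>?\<Omega>. u z \<le> c} \<subseteq> cspace 2" using sub by blast
        show "closed {z\<in>?\<Omega>. u z \<le> c}" unfolding eq by (intro closed_Int closed_cspace c1 c2)
        show "cmod (z i) \<le> 2" if "z \<in> {z\<in>?\<Omega>. u z \<le> c}" "i < 2" for z i
        proof -
          have "z \<in> ?\<Omega>" using that(1) by blast
          then have "cmod (z 0) \<le> 2" "cmod (z 1) \<le> 2" using \<Omega>(3,4) by (simp_all add: less_imp_le)
          then show ?thesis using less_2_cases[OF that(2)] by (metis One_nat_def)
        qed
      qed
    qed
    show "{z\<in>?\<Omega>. u z \<le> c} \<subseteq> cspace 2" using sub by blast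
  qed
  show ?thesis
    unfolding pseudoconvex_def cont_plurisubharmonic_on_def
    by (intro conjI exI[of _ u] allI ballI cm psh cpt hyp_bidisc_openin)
qed

text \<open>The rows of \<open>B\<close> are two linear forms whose product stays below 1/2 on the
  open unit ball, which limits their determinant by
  \<open>product_of_forms_lower_bound\<close>.\<close>

lemma hyp_bidisc_ellipsoid_cdet_le:
  assumes B: "mv 2 B ` cunit_ball 2 \<subseteq> hyp_bidisc"
  shows "cmod (cdet 2 B) \<le> 1"
proof (rule ccontr)
  define D where "D = cmod (cdet 2 B)"
  assume "\<not> cmod (cdet 2 B) \<le> 1"
  then have D: "1 < D" by (simp add: D_def)
  have det: "cdet 2 B = B 0 0 * B 1 1 - B 0 1 * B 1 0" by (rule cdet_2)
  have "B 0 0 * B 1 1 - B 0 1 * B 1 0 \<noteq> 0" using D unfolding D_def det by auto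
  then obtain x y where xy: "0 < (cmod x)\<^sup>2 + (cmod y)\<^sup>2"
    "cmod (B 0 0 * B 1 1 - B 0 1 * B 1 0) * ((cmod x)\<^sup>2 + (cmod y)\<^sup>2) / 2 \<le> cmod (B 0 0 * x + B 0 1 * y) * cmod (B 1 0 * x + B 1 1 * y)"
    by (rule product_of_forms_lower_bound) blast
  define n2 where "n2 = (cmod x)\<^sup>2 + (cmod y)\<^sup>2"
  \<comment> \<open>Division by \<open>s\<close> brings the squared norm to
    \<open>1 / D < 1\<close>, exactly where the lower bound for the product of the forms becomes
    1/2.\<close>
  define s where "s = sqrt (D * n2)"
  have "0 < n2" using xy(1) by (simp only: n2_def)
  then have "0 < D * n2" using D by simp
  then have s: "0 < s" "s\<^sup>2 = D * n2" by (simp_all add: s_def)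
  define w where "w = (\<lambda>i::nat. of_real (1 / s) * (if i = 0 then x else y))"
  have "(cnorm 2 w)\<^sup>2 = n2 / s\<^sup>2"
    unfolding cnorm_sq lessThan_2 using s(1) by (simp add: w_def norm_mult norm_divide power_mult_distrib power_divide n2_def add_divide_distrib)
  also have "\<dots> = 1 / D" unfolding s(2) using D \<open>0 < n2\<close> by simp
  also have "\<dots> < 1" using D by simp
  finally have "cnorm 2 w < 1" by (simp add: abs_square_less_1)
  then have "mv 2 B w \<in> hyp_bidisc" by (rule in_ellipsoid_subset[OF B])
  then have lt: "cmod (mv 2 B w 0 * mv 2 B w 1) < 1/2" unfolding hyp_bidisc_def by blast
  have m: "mv 2 B w i = of_real (1 / s) * (B i 0 * x + B i 1 * y)" if "i < 2" for i
    using that unfolding mv_def lessThan_2 by (auto simp: w_def algebra_simps)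
  have "cmod (mv 2 B w 0 * mv 2 B w 1) = (cmod (B 0 0 * x + B 0 1 * y) * cmod (B 1 0 * x + B 1 1 * y)) / s\<^sup>2"
    using s(1) by (simp add: m norm_mult norm_divide power2_eq_square)
  also have "\<dots> \<ge> (D * n2 / 2) / s\<^sup>2"
    using xy(2) unfolding D_def det n2_def by (intro divide_right_mono) auto
  finally have "(D * n2 / 2) / s\<^sup>2 < 1/2" using lt by linarith
  moreover have "(D * n2 / 2) / s\<^sup>2 = 1/2" unfolding s(2)[symmetric] using s(1) by simp
  ultimately show False by simp
qed

text \<open>The factors \<open>d\<close> and \<open>1 / d\<close> cancel in the product, and twice
  \<open>cmod (z 0) * cmod (z 1)\<close> is at most the squared norm; the determinant 1 meets the
  upper bound.\<close>

lemma hyp_bidisc_maximal: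
  assumes d: "0 < d" "d < 2" "1/2 < d"
  shows "maximal_ellipsoid 2 hyp_bidisc (mv 2 (dgm (\<lambda>i. of_real (if i = 0 then d else 1 / d))) ` cunit_ball 2)"
proof -
  let ?A = "dgm (\<lambda>i. complex_of_real (if i = 0 then d else 1 / d))"
  have det: "cdet 2 ?A = 1" using d unfolding cdet_dgm lessThan_2 by simp
  have "mv 2 ?A ` cunit_ball 2 \<subseteq> hyp_bidisc"
  proof
    fix w assume "w \<in> mv 2 ?A ` cunit_ball 2"
    then obtain z where z: "z \<in> cunit_ball 2" "w = mv 2 ?A z" by blast
    have z1: "cnorm 2 z < 1" using z(1) by (simp add: cunit_ball_def)
    then have "(cnorm 2 z)\<^sup>2 < 1" by (simp add: abs_square_less_1)
    then have n: "(cmod (z 0))\<^sup>2 + (cmod (z 1))\<^sup>2 < 1" unfolding cnorm_sq lessThan_2 by simp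
    have w01: "w 0 = of_real d * z 0" "w 1 = of_real (1 / d) * z 1" by (simp_all add: z(2) mv_dgm)
    have "cmod (w 0 * w 1) = cmod (z 0) * cmod (z 1)" unfolding w01 using d by (simp add: norm_mult norm_divide)
    moreover have "0 \<le> (cmod (z 0) - cmod (z 1))\<^sup>2" by simp
    ultimately have "cmod (w 0 * w 1) < 1/2" using n by (simp add: power2_diff)
    moreover have zi: "cmod (z i) \<le> 1" if "i < 2" for i using component_le_cnorm[OF that, of z] z1 by simp
    have "cmod (w 0) < 2"
    proof -
      have "cmod (w 0) = d * cmod (z 0)" unfolding w01 using d by (simp add: norm_mult)
      also have "\<dots> \<le> d * 1" using d zi[of 0] by (intro mult_left_mono) auto
      finally show ?thesis using d by simp
    qed
    moreover have "cmod (w 1) < 2"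
    proof -
      have "cmod (w 1) = 1 / d * cmod (z 1)" unfolding w01 using d by (simp add: norm_divide)
      also have "\<dots> \<le> 1 / d * 1" using d zi[of 1] by (intro mult_left_mono) auto
      also have "\<dots> < 2" using d by (simp add: field_simps)
      finally show ?thesis .
    qed
    ultimately show "w \<in> hyp_bidisc" unfolding hyp_bidisc_def using mv_cspace z(2) by blast
  qed
  moreover have "cdet 2 ?A \<noteq> 0" by (simp add: det)
  ultimately show ?thesis
    unfolding maximal_ellipsoid_iff[OF \<open>cdet 2 ?A \<noteq> 0\<close>] using hyp_bidisc_ellipsoid_cdet_le by (simp add: det)
qed

lemma hyp_bidisc_two_maximal:
  "\<exists>E E'. maximal_ellipsoid 2 hyp_bidisc E \<and> maximal_ellipsoid 2 hyp_bidisc E' \<and> E \<noteq> E'"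
proof -
  let ?A = "\<lambda>d. dgm (\<lambda>i. complex_of_real (if i = 0 then d else 1 / d))"
  \<comment> \<open>The factor \<open>3/2\<close> takes \<open>9/10\<close> to
    \<open>27/20 > 1\<close>, outside the unit ball, which is the ellipsoid for
    \<open>d = 1\<close>.\<close>
  define e where "e = (\<lambda>i\<in>{..<2::nat}. if i = 0 then 9/10 else (0::complex))"
  have "e \<in> cunit_ball 2"
  proof -
    have "(cnorm 2 e)\<^sup>2 = (9/10)\<^sup>2" unfolding cnorm_sq lessThan_2 by (simp add: e_def)
    then have "cnorm 2 e = 9/10" by (simp add: power2_eq_iff_nonneg)
    then show ?thesis by (simp add: cunit_ball_def e_def)
  qed
  then have "mv 2 (?A (3/2)) e \<in> mv 2 (?A (3/2)) ` cunit_ball 2" by (rule imageI)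
  moreover have "mv 2 (?A (3/2)) e \<notin> mv 2 (?A 1) ` cunit_ball 2"
  proof
    assume "mv 2 (?A (3/2)) e \<in> mv 2 (?A 1) ` cunit_ball 2"
    then obtain z where z: "z \<in> cunit_ball 2" "mv 2 (?A (3/2)) e = mv 2 (?A 1) z" by blast
    from fun_cong[OF z(2), of 0] have "z 0 = 27/20" by (simp add: mv_dgm e_def)
    then have "cmod (z 0) = cmod (27/20)" by (simp only:)
    then have "cmod (z 0) = 27/20" by (simp add: norm_divide)
    moreover have "cmod (z 0) \<le> cnorm 2 z" by (rule component_le_cnorm) simp
    ultimately show False using z(1) by (simp add: cunit_ball_def)
  qed
  ultimately have "mv 2 (?A (3/2)) ` cunit_ball 2 \<noteq> mv 2 (?A 1) ` cunit_ball 2" by blast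
  moreover have "maximal_ellipsoid 2 hyp_bidisc (mv 2 (?A (3/2)) ` cunit_ball 2)"
    by (rule hyp_bidisc_maximal) simp_all
  moreover have "maximal_ellipsoid 2 hyp_bidisc (mv 2 (?A 1) ` cunit_ball 2)"
    by (rule hyp_bidisc_maximal) simp_all
  ultimately show ?thesis by blast
qed

theorem theorem1p2:
  shows "(\<exists>n \<Omega>. cdomain n \<Omega> \<and> cbounded n \<Omega> \<and> pseudoconvex n \<Omega> \<and> czero n \<in> \<Omega> \<and>
            (\<exists>E E'. maximal_ellipsoid n \<Omega> E \<and> maximal_ellipsoid n \<Omega> E' \<and> E \<noteq> E'))
       \<and> (\<forall>n \<Omega>. cdomain n \<Omega> \<and> cbounded n \<Omega> \<and> pseudoconvex n \<Omega> \<and> czero n \<in> \<Omega> \<and>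
            \<not> (\<exists>D. holomorphic_disc n D \<and> D \<subseteq> ctop n frontier_of \<Omega>)
          \<longrightarrow> (\<exists>!E. maximal_ellipsoid n \<Omega> E))"
proof (intro conjI allI impI)
  show "\<exists>n \<Omega>. cdomain n \<Omega> \<and> cbounded n \<Omega> \<and> pseudoconvex n \<Omega> \<and> czero n \<in> \<Omega> \<and>
      (\<exists>E E'. maximal_ellipsoid n \<Omega> E \<and> maximal_ellipsoid n \<Omega> E' \<and> E \<noteq> E')"
    by (intro exI[of _ 2] exI[of _ hyp_bidisc] conjI hyp_bidisc_cdomain hyp_bidisc_cbounded
        hyp_bidisc_pseudoconvex hyp_bidisc_zero hyp_bidisc_two_maximal)
next
  fix n \<Omega>
  assume *: "cdomain n \<Omega> \<and> cbounded n \<Omega> \<and> pseudoconvex n \<Omega> \<and> czero n \<in> \<Omega> \<and>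
    \<not> (\<exists>D. holomorphic_disc n D \<and> D \<subseteq> ctop n frontier_of \<Omega>)"
  show "\<exists>!E. maximal_ellipsoid n \<Omega> E"
    using * by (intro maximal_ellipsoid_ex1) blast+
qed

end
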